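(* Let $n\in\mathbb{N}$ and let $\rho:\mathbb{R}^n\setminus\{0\}\to[0,\infty)$ be a radial kernel with $\rho\in L^1_{\mathrm{loc}}(\mathbb{R}^n)$, $\int_{\mathbb{R}^n}\min\{1,|x|^{-1}\}\rho(x)\,dx<\infty$ and $\inf_{\overline{B(0,\varepsilon)}}\rho>0$ for some $\varepsilon>0$. Assume that $K_\rho(x)\ge0$ for $x\neq0$, and let $$\mathcal{L}u(x)=\int_{\mathbb{R}^n}\bigl(u(x)-u(x+h)\bigr)K_\rho(h)\,dh$$ (in the principal value sense). Let $\Omega\subset\mathbb{R}^n$ be a bounded open set and let $u,v\in C^{1,1}_{\mathrm{loc}}(\mathbb{R}^n)\cap L^\infty(\mathbb{R}^n)$. If $\mathcal{L}u\ge\mathcal{L}v$ in $\Omega$ and $u\ge v$ in $\Omega^c=\mathbb{R}^n\setminus\Omega$, then $u\ge v$ in $\mathbb{R}^n$.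
   Context: Fourier transform convention: $\widehat f(\xi)=\int_{\mathbb{R}^n}f(x)e^{-2\pi i x\cdot\xi}\,dx$, extended to tempered distributions. $\overline\rho$ is the radial representation of $\rho$, $\rho(x)=\overline\rho(|x|)$. $Q_\rho(x):=\int_{|x|}^\infty\frac{\overline\rho(t)}{t}\,dt$ ($x\ne0$) is a locally integrable tempered distribution; its Fourier transform is the function $\widehat{Q_\rho}(\xi)=\frac{1}{2\pi|\xi|}\int_{\mathbb{R}^n}\frac{\rho(x)x_1}{|x|^2}\sin(2\pi|\xi|x_1)\,dx$, $\xi\ne0$, and $\lambda_\rho(\xi):=2\pi i\,\xi\,\widehat{Q_\rho}(\xi)$. $K_\rho$ is the tempered distribution $K_\rho=\sum_{j}\partial_jQ_\rho*\partial_jQ_\rho$, equivalently the one with $\widehat{K_\rho}(\xi)=-|\lambda_\rho(\xi)|^2$. The assumption "$K_\rho(x)\ge0$ for $x\ne0$" means that the restriction of $K_\rho$ to $\mathbb{R}^n\setminus\{0\}$ is given by a nonnegative function in $L^1_{\mathrm{loc}}(\mathbb{R}^n\setminus\{0\})$, again denoted $K_\rho$ and used in the integral. The principal value is $\lim_{r\to0^+}\int_{|h|>r}$. *)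

theory Defs
  imports "HOL-Analysis.Analysis"
begin

section \<open>Function spaces\<close>

definition loc_integrable_on :: "(real^'n \<Rightarrow> 'b::{banach, second_countable_topology}) \<Rightarrow> (real^'n) set \<Rightarrow> bool"
  where "loc_integrable_on f U \<longleftrightarrow> (\<forall>C. compact C \<and> C \<subseteq> U \<longrightarrow> set_integrable lebesgue C f)"

definition C11_loc :: "(real^'n \<Rightarrow> real) \<Rightarrow> bool"
  where "C11_loc u \<longleftrightarrow> (\<exists>g :: real^'n \<Rightarrow> real^'n.
    (\<forall>x. (u has_derivative (\<lambda>h. g x \<bullet> h)) (at x)) \<and>
    (\<forall>C. compact C \<longrightarrow> (\<exists>L. L-lipschitz_on C g)))"

definition L_infinity :: "(real^'n \<Rightarrow> real) \<Rightarrow> bool"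
  where "L_infinity u \<longleftrightarrow> u \<in> borel_measurable lebesgue \<and> (\<exists>M. AE x in lebesgue. \<bar>u x\<bar> \<le> M)"

definition partial :: "'n \<Rightarrow> (real^'n \<Rightarrow> complex) \<Rightarrow> real^'n \<Rightarrow> complex"
  where "partial j f x = vector_derivative (\<lambda>t. f (x + t *\<^sub>R axis j 1)) (at 0)"

definition smooth :: "(real^'n \<Rightarrow> complex) \<Rightarrow> bool"
  where "smooth f \<longleftrightarrow> (\<forall>js x. foldr partial js f differentiable (at x))"

definition test_function_on :: "(real^'n) set \<Rightarrow> (real^'n \<Rightarrow> complex) \<Rightarrow> bool"
  where "test_function_on U \<phi> \<longleftrightarrow> smooth \<phi> \<and>
    (\<exists>C. compact C \<and> C \<subseteq> U \<and> (\<forall>x. x \<notin> C \<longrightarrow> \<phi> x = 0))"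


section \<open>Distributions\<close>

text \<open>
  A tempered distribution is represented by its pairing with (Schwartz) functions; its values
  at other arguments carry no meaning. The Fourier transform is normalised as
  the integral of f(x) exp(-2 pi i x.xi) dx, so that its inverse has kernel exp(2 pi i x.xi);
  on distributions the inverse acts by duality.
\<close>

type_synonym 'n distribution = "(real^'n \<Rightarrow> complex) \<Rightarrow> complex"

definition regular_dist :: "(real^'n \<Rightarrow> complex) \<Rightarrow> 'n distribution"
  where "regular_dist g \<phi> = (LINT x|lebesgue. g x * \<phi> x)"

definition inv_fourier :: "(real^'n \<Rightarrow> complex) \<Rightarrow> real^'n \<Rightarrow> complex"
  where "inv_fourier \<phi> \<xi> = (LINT x|lebesgue. \<phi> x * exp (2 * of_real pi * \<i> * of_real (x \<bullet> \<xi>)))"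

definition inv_fourier_dist :: "'n::finite distribution \<Rightarrow> 'n distribution"
  where "inv_fourier_dist T \<phi> = T (inv_fourier \<phi>)"

definition represented_on :: "'n::finite distribution \<Rightarrow> (real^'n) set \<Rightarrow> (real^'n \<Rightarrow> real) \<Rightarrow> bool"
  where "represented_on T U k \<longleftrightarrow> loc_integrable_on k U \<and>
    (\<forall>\<phi>. test_function_on U \<phi> \<longrightarrow> T \<phi> = regular_dist (\<lambda>x. of_real (k x)) \<phi>)"


section \<open>The kernels\<close>

definition radial :: "(real^'n \<Rightarrow> real) \<Rightarrow> bool"
  where "radial \<rho> \<longleftrightarrow> (\<exists>\<rho>bar :: real \<Rightarrow> real. \<forall>x. x \<noteq> 0 \<longrightarrow> \<rho> x = \<rho>bar (norm x))"

text \<open>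
  The index type carries no order, so the coordinate called 1 is an arbitrary fixed one. For radial
  kernels the choice is immaterial.
\<close>

definition first_index :: "'n::finite"
  where "first_index = (SOME j. True)"

text \<open>
  The Fourier transform, as a function away from the origin, of the radial potential Q with
  Q(x) = integral of rhobar(t)/t over t > |x|, where rho(x) = rhobar(|x|).
\<close>

definition Q_hat :: "(real^'n \<Rightarrow> real) \<Rightarrow> real^'n \<Rightarrow> real"
  where "Q_hat \<rho> \<xi> = 1 / (2 * pi * norm \<xi>) *
    (LINT x|lebesgue. \<rho> x * x $ first_index / (norm x)\<^sup>2 * sin (2 * pi * norm \<xi> * x $ first_index))"

definition lambda_rho :: "(real^'n \<Rightarrow> real) \<Rightarrow> real^'n \<Rightarrow> complex^'n"
  where "lambda_rho \<rho> \<xi> = (\<chi> j. 2 * of_real pi * \<i> * of_real (\<xi> $ j) * of_real (Q_hat \<rho> \<xi>))"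

text \<open>
  K is the sum over j of the convolution squares of the distributional derivatives of Q in
  direction j, that is, the tempered distribution whose Fourier transform is -|lambda|^2.
\<close>

definition K_rho :: "(real^'n \<Rightarrow> real) \<Rightarrow> 'n distribution"
  where "K_rho \<rho> = inv_fourier_dist (regular_dist (\<lambda>\<xi>. - of_real ((norm (lambda_rho \<rho> \<xi>))\<^sup>2)))"

definition admissible_kernel :: "(real^'n \<Rightarrow> real) \<Rightarrow> bool"
  where "admissible_kernel \<rho> \<longleftrightarrow>
    (\<forall>x. x \<noteq> 0 \<longrightarrow> 0 \<le> \<rho> x) \<and> radial \<rho> \<and> loc_integrable_on \<rho> UNIV \<and>
    integrable lebesgue (\<lambda>x. min 1 (1 / norm x) * \<rho> x) \<and>
    (\<exists>\<epsilon>>0. (INF x\<in>cball 0 \<epsilon> - {0}. \<rho> x) > 0)"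

definition pv_operator :: "(real^'n \<Rightarrow> real) \<Rightarrow> (real^'n \<Rightarrow> real) \<Rightarrow> real^'n \<Rightarrow> real"
  where "pv_operator k u x =
    Lim (at_right 0) (\<lambda>r. LINT h:{h. norm h > r}|lebesgue. (u x - u (x + h)) * k h)"

end

theory Submission
  imports Defs
begin

text \<open>
  Write \<open>f = \<bar>\<lambda>\<^sub>\<rho>\<bar>\<^sup>2\<close>, so that \<open>K\<^sub>\<rho>\<close> acts on a test function \<open>\<phi>\<close> as minus the integral of \<open>f\<close> times the
  inverse Fourier transform of \<open>\<phi>\<close>. The symbol \<open>f\<close> is continuous, even, of quadratic growth, \<open>o(\<bar>\<xi>\<bar>\<^sup>2)\<close>
  along rays, and not identically zero. Testing against dilated cutoffs gives integrability of
  \<open>min 1 \<bar>h\<bar>\<^sup>2\<close> against the kernel \<open>k\<close>; evenness gives vanishing first moments on annuli, so the principal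
  value exists for bounded functions in \<open>C\<^sup>1\<^sup>,\<^sup>1\<close> and equals a compensated absolutely convergent
  integral. If \<open>k\<close> vanished almost everywhere, \<open>K\<^sub>\<rho>\<close> would be concentrated at the origin, and the
  subquadratic growth would force \<open>f = 0\<close>. The maximum principle then applies to \<open>v - u\<close>: at a
  maximum point with extreme \<open>j\<close>-th coordinate the operator inequality makes \<open>k\<close> vanish on the half
  space \<open>h\<^sub>j > 0\<close>, hence everywhere by the first moment identity, a contradiction.
\<close>

section \<open>A supply of test functions\<close>

text \<open>The obstacle is that \<open>k\<close> is known only away from the origin. A priori the
  distribution may carry a further part concentrated at 0, invisible to all test functions to which
  the hypothesis on \<open>k\<close> applies. Differences of two dilates of one cutoff get around
  this: they vanish near 0, so they can be paired with \<open>k\<close>, while each dilate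
  separately is estimated on the Fourier side. A part concentrated at 0 is recognised by its
  scaling. Heuristically its symbol would be a polynomial; growth below order two together with
  evenness leaves a constant, and the value 0 at the origin leaves nothing. This explains why
  exactly these properties of the symbol are collected. Nonnegativity gives no particular place
  where \<open>k\<close> is positive, so an arbitrary maximum point would give no contradiction.
  Only the vanishing first moments link opposite half spaces, which is why the maximum point is
  chosen extreme in one direction.\<close>

text \<open>\<open>smooth\<close> asks for all iterated partial derivatives. A syntactic class that
  consists of differentiable functions and is closed under partial derivatives settles this by
  induction. Rule \<open>comp\<close> takes a whole sequence \<open>D\<close> of successive
  derivatives, since otherwise the derivative of a composition would leave the class.\<close>

inductive elem_smooth :: "(real^'n \<Rightarrow> real) \<Rightarrow> bool" where
  const: "elem_smooth (\<lambda>x. c)"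
| coord: "elem_smooth (\<lambda>x. x $ i)"
| add: "elem_smooth f \<Longrightarrow> elem_smooth g \<Longrightarrow> elem_smooth (\<lambda>x. f x + g x)"
| mult: "elem_smooth f \<Longrightarrow> elem_smooth g \<Longrightarrow> elem_smooth (\<lambda>x. f x * g x)"
| inverse: "elem_smooth f \<Longrightarrow> (\<And>x. f x \<noteq> 0) \<Longrightarrow> elem_smooth (\<lambda>x. inverse (f x))"
| comp: "(\<And>m t. (D m has_real_derivative D (Suc m) t) (at t)) \<Longrightarrow> elem_smooth f \<Longrightarrow>
    elem_smooth (\<lambda>x. D (m::nat) (f x))"

lemmas elem_smooth_intros = elem_smooth.const elem_smooth.coord elem_smooth.add elem_smooth.mult

lemma elem_smooth_differentiable:
  assumes "elem_smooth f"
  shows "f differentiable (at x)"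
  using assms
proof (induction arbitrary: x)
  case (coord i)
  show ?case
    by (simp add: bounded_linear_imp_differentiable bounded_linear_vec_nth)
next
  case (inverse f)
  then show ?case
    using differentiable_compose[of inverse f x UNIV]
    by (metis UNIV_I DERIV_inverse real_differentiable_def differentiable_chain_at o_def
        differentiable_inverse)
next
  case (comp D f m)
  have "D m differentiable (at (f x))"
    using comp.hyps(1) real_differentiable_def by blast
  then have "(D m \<circ> f) differentiable (at x)"
    using comp.IH by (intro differentiable_chain_at)
  then show ?case by (simp add: o_def)
qed auto

lemma elem_smooth_continuous: "elem_smooth f \<Longrightarrow> continuous_on A f"
  by (simp add: continuous_at_imp_continuous_on differentiable_imp_continuous_within
      elem_smooth_differentiable)

lemma elem_smooth_partial:
  assumes "elem_smooth f"
  shows "\<exists>g. elem_smooth g \<and>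
    (\<forall>x. ((\<lambda>t. f (x + t *\<^sub>R axis j 1)) has_real_derivative g x) (at 0))"
  using assms
proof induction
  case (const c)
  show ?case by (intro exI[of _ "\<lambda>x. 0"]) (auto intro: elem_smooth_intros)
next
  case (coord i)
  show ?case
    by (intro exI[of _ "\<lambda>x. axis j 1 $ i"])
      (auto intro!: elem_smooth_intros derivative_eq_intros)
next
  case (add f g)
  then obtain f' g' where "elem_smooth f'" "elem_smooth g'"
    "\<And>x. ((\<lambda>t. f (x + t *\<^sub>R axis j 1)) has_real_derivative f' x) (at 0)"
    "\<And>x. ((\<lambda>t. g (x + t *\<^sub>R axis j 1)) has_real_derivative g' x) (at 0)"
    by blast
  then show ?case
    by (intro exI[of _ "\<lambda>x. f' x + g' x"]) (auto intro!: elem_smooth_intros DERIV_add)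
next
  case (mult f g)
  then obtain f' g' where "elem_smooth f'" "elem_smooth g'"
    "\<And>x. ((\<lambda>t. f (x + t *\<^sub>R axis j 1)) has_real_derivative f' x) (at 0)"
    "\<And>x. ((\<lambda>t. g (x + t *\<^sub>R axis j 1)) has_real_derivative g' x) (at 0)"
    by blast
  then show ?case
    using mult.hyps
    by (intro exI[of _ "\<lambda>x. f' x * g x + f x * g' x"])
      (auto intro!: elem_smooth_intros derivative_eq_intros)
next
  case (inverse f)
  then obtain f' where "elem_smooth f'"
    and f': "\<And>x. ((\<lambda>t. f (x + t *\<^sub>R axis j 1)) has_real_derivative f' x) (at 0)"
    by blast
  then have "elem_smooth (\<lambda>x. (- 1) * (inverse (f x) * f' x * inverse (f x)))"
    using inverse.hyps by (intro elem_smooth_intros elem_smooth.inverse)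
  moreover have "((\<lambda>t. inverse (f (x + t *\<^sub>R axis j 1))) has_real_derivative
      (- 1) * (inverse (f x) * f' x * inverse (f x))) (at 0)" for x
    using inverse.hyps(2) f' by (auto intro!: derivative_eq_intros)
  ultimately show ?case by blast
next
  case (comp D f m)
  then obtain f' where f': "elem_smooth f'"
    "\<And>x. ((\<lambda>t. f (x + t *\<^sub>R axis j 1)) has_real_derivative f' x) (at 0)"
    by blast
  have "((\<lambda>t. D m (f (x + t *\<^sub>R axis j 1))) has_real_derivative D (Suc m) (f x) * f' x) (at 0)" for x
    using DERIV_chain2[OF _ f'(2)[of x], of "D m"] comp.hyps(1) by simp
  then show ?case
    using elem_smooth.mult[OF elem_smooth.comp[of D f "Suc m", OF comp.hyps] f'(1)] by blast
qed

lemma elem_smooth_foldr_partial: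
  assumes "elem_smooth f"
  shows "\<exists>g. elem_smooth g \<and> foldr partial js (\<lambda>x. complex_of_real (f x)) = (\<lambda>x. of_real (g x))"
proof (induction js)
  case Nil
  then show ?case using assms by auto
next
  case (Cons j js)
  then obtain g where g: "elem_smooth g"
    "foldr partial js (\<lambda>x. complex_of_real (f x)) = (\<lambda>x. of_real (g x))"
    by blast
  obtain g' where g': "elem_smooth g'"
    "\<And>x. ((\<lambda>t. g (x + t *\<^sub>R axis j 1)) has_real_derivative g' x) (at 0)"
    using elem_smooth_partial[OF g(1)] by blast
  have "partial j (\<lambda>x. complex_of_real (g x)) = (\<lambda>x. of_real (g' x))"
    unfolding partial_def
    by (intro ext vector_derivative_at has_vector_derivative_of_real)
      (use g'(2) in \<open>simp add: has_real_derivative_iff_has_vector_derivative\<close>)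
  then show ?case using g g' by auto
qed

lemma smooth_of_real:
  assumes "elem_smooth f"
  shows "smooth (\<lambda>x. complex_of_real (f x))"
  unfolding smooth_def
proof (intro allI)
  fix js x
  obtain g where "elem_smooth g"
    and *: "foldr partial js (\<lambda>x. complex_of_real (f x)) = (\<lambda>x. of_real (g x))"
    using elem_smooth_foldr_partial[OF assms] by blast
  then have "(of_real \<circ> g :: _ \<Rightarrow> complex) differentiable (at x)"
    using elem_smooth_differentiable
    by (intro differentiable_chain_at)
      (auto intro: bounded_linear_imp_differentiable bounded_linear_of_real)
  then show "foldr partial js (\<lambda>x. complex_of_real (f x)) differentiable (at x)"
    unfolding * by (simp add: o_def)
qed

lemma test_function_on_of_real:
  assumes "elem_smooth f" "compact C" "C \<subseteq> U" "\<And>x. x \<notin> C \<Longrightarrow> f x = 0"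
  shows "test_function_on U (\<lambda>x. of_real (f x))"
  unfolding test_function_on_def using smooth_of_real[OF assms(1)] assms(2-4) by auto

lemma elem_smooth_affine:
  assumes "elem_smooth f"
  shows "elem_smooth (\<lambda>x. f (s *\<^sub>R x + b))"
  using assms
proof induction
  case (comp D f m)
  show ?case by (rule elem_smooth.comp[of D, OF comp.hyps(1) comp.IH])
qed (auto intro!: elem_smooth_intros elem_smooth.inverse)

lemma elem_smooth_scale: "elem_smooth f \<Longrightarrow> elem_smooth (\<lambda>x. f (s *\<^sub>R x))"
  using elem_smooth_affine[of f s 0] by simp

lemma elem_smooth_diff:
  "elem_smooth f \<Longrightarrow> elem_smooth g \<Longrightarrow> elem_smooth (\<lambda>x. f x - g x)"
  using elem_smooth.add[of f "\<lambda>x. (-1) * g x"] elem_smooth.mult[OF elem_smooth.const[of "-1"], of g]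
  by simp

lemma elem_smooth_sum:
  assumes "\<And>i. i \<in> I \<Longrightarrow> elem_smooth (f i)"
  shows "elem_smooth (\<lambda>x. \<Sum>i\<in>I. f i x)"
  using assms
  by (induction I rule: infinite_finite_induct) (auto intro: elem_smooth_intros)

lemma elem_smooth_inner: "elem_smooth (\<lambda>x. a \<bullet> x)"
  by (auto simp: inner_vec_def intro!: elem_smooth_intros elem_smooth_sum)

lemma elem_smooth_norm_sq: "elem_smooth (\<lambda>x. (norm x)\<^sup>2)"
  unfolding power2_norm_eq_inner inner_vec_def
  by (auto intro!: elem_smooth_intros elem_smooth_sum)

lemma elem_smooth_cos: "elem_smooth f \<Longrightarrow> elem_smooth (\<lambda>x. cos (f x))"
proof -
  assume f: "elem_smooth f"
  \<comment> \<open>Each derivative of the cosine is a phase shift by a quarter period, which gives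
    the sequence required by \<open>comp\<close> in closed form.\<close>
  define D where "D m t = cos (t + real m * (pi / 2))" for m and t :: real
  have "(D m has_real_derivative D (Suc m) t) (at t)" for m t
  proof -
    have "cos (t + real m * (pi / 2) + pi / 2) = - sin (t + real m * (pi / 2))"
      by (simp add: cos_add)
    moreover have "t + real m * (pi / 2) + pi / 2 = t + real (Suc m) * (pi / 2)"
      by (simp add: algebra_simps)
    ultimately have "D (Suc m) t = - sin (t + real m * (pi / 2))"
      unfolding D_def by (simp only:)
    then show ?thesis
      unfolding D_def by (auto intro!: derivative_eq_intros)
  qed
  from elem_smooth.comp[of D, OF this f, of 0] show ?thesis
    by (simp add: D_def)
qed

section \<open>Smooth cutoffs for balls and annuli\<close>

text \<open>The polynomial parameter makes the family closed under differentiation: with z = 1/t,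
  differentiating p(z) exp(-z) in t gives z^2 (p - p')(z) exp(-z).\<close>

definition flat :: "real poly \<Rightarrow> real \<Rightarrow> real"
  where "flat p t = (if t \<le> 0 then 0 else poly p (1 / t) * exp (- (1 / t)))"

lemma poly_times_exp_tendsto_0: "((\<lambda>z::real. poly p z * exp (- z)) \<longlongrightarrow> 0) at_top"
proof -
  have "((\<lambda>z. \<Sum>i\<le>degree p. coeff p i * (z ^ i / exp z)) \<longlongrightarrow> (\<Sum>i\<le>degree p. coeff p i * 0)) at_top"
    by (intro tendsto_sum tendsto_mult tendsto_const tendsto_power_div_exp_0)
  then show ?thesis
    by (simp add: poly_altdef exp_minus field_simps sum_distrib_left sum_distrib_right)
qed

lemma flat_tendsto_0: "(flat p \<longlongrightarrow> 0) (at 0)"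
proof -
  have "(flat p \<longlongrightarrow> 0) (at_left 0)"
    by (rule tendsto_eventually) (auto simp: flat_def eventually_at intro: exI[of _ 1])
  moreover have "((\<lambda>t. poly p (inverse t) * exp (- inverse t)) \<longlongrightarrow> 0) (at_right 0)"
    by (rule filterlim_compose[OF poly_times_exp_tendsto_0 filterlim_inverse_at_top_right])
  then have "(flat p \<longlongrightarrow> 0) (at_right 0)"
    by (rule Lim_transform_eventually)
      (auto simp: flat_def eventually_at inverse_eq_divide intro!: exI[of _ 1])
  ultimately show ?thesis by (simp add: filterlim_split_at)
qed

lemma flat_derivative: "(flat p has_real_derivative flat ([:0,0,1:] * (p - pderiv p)) t) (at t)"
proof (cases t "0::real" rule: linorder_cases)
  case less
  then have "\<forall>\<^sub>F s in nhds t. flat p s = 0"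
    by (auto simp: flat_def eventually_nhds intro!: exI[of _ "{..<0}"])
  then have "(flat p has_real_derivative 0) (at t) = ((\<lambda>_. 0) has_real_derivative 0) (at t)"
    by (intro DERIV_cong_ev) auto
  then show ?thesis using less by (auto simp: flat_def)
next
  case greater
  then have "\<forall>\<^sub>F s in nhds t. flat p s = poly p (1 / s) * exp (- (1 / s))"
    by (auto simp: flat_def eventually_nhds intro!: exI[of _ "{0<..}"])
  moreover have "((\<lambda>s. poly p (1 / s) * exp (- (1 / s))) has_real_derivative
      flat ([:0,0,1:] * (p - pderiv p)) t) (at t)"
    using greater
    by (auto intro!: derivative_eq_intros DERIV_chain2[OF poly_DERIV]
        simp: flat_def field_simps power2_eq_square)
  ultimately show ?thesis
    by (subst DERIV_cong_ev[OF refl _ refl]) auto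
next
  case equal
  \<comment> \<open>The difference quotient at 0 is again a flat function: dividing by
    \<open>h\<close> multiplies the polynomial by its variable, which is
    \<open>pCons 0 p\<close>.\<close>
  have "((\<lambda>s. flat (pCons 0 p) s) \<longlongrightarrow> 0) (at 0)"
    by (rule flat_tendsto_0)
  then have "((\<lambda>h. (flat p (0 + h) - flat p 0) / h) \<longlongrightarrow> 0) (at 0)"
    by (rule Lim_transform_eventually)
      (auto simp: flat_def eventually_at intro!: exI[of _ 1])
  then show ?thesis
    using equal by (simp add: DERIV_def flat_def)
qed

lemma elem_smooth_flat: "elem_smooth f \<Longrightarrow> elem_smooth (\<lambda>x. flat p (f x))"
proof -
  assume f: "elem_smooth f"
  define D where "D m = flat (((\<lambda>p. [:0,0,1:] * (p - pderiv p)) ^^ m) p)" for m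
  have "(D m has_real_derivative D (Suc m) t) (at t)" for m t
    using flat_derivative by (simp add: D_def)
  from elem_smooth.comp[of D, OF this f, of 0] show ?thesis
    by (simp add: D_def)
qed

lemma flat_1_nonneg: "flat 1 t \<ge> 0" and flat_1_pos_iff: "flat 1 t > 0 \<longleftrightarrow> t > 0"
  by (auto simp: flat_def)

text \<open>The usual quotient of flat functions. The squared norm keeps it smooth at the origin,
  and the two summands of the denominator are never zero together, since 4 - |x|^2 <= 0 forces |x|^2
  > 1.\<close>

definition plateau :: "real^'n \<Rightarrow> real"
  where "plateau x = flat 1 (4 - (norm x)\<^sup>2) *
    inverse (flat 1 (4 - (norm x)\<^sup>2) + flat 1 ((norm x)\<^sup>2 - 1))"

lemma plateau_denominator_pos: "flat 1 (4 - (norm x)\<^sup>2) + flat 1 ((norm x)\<^sup>2 - 1) > 0"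
proof (cases "4 - (norm x)\<^sup>2 > 0")
  case True
  then show ?thesis
    using flat_1_pos_iff flat_1_nonneg by (meson add_pos_nonneg)
next
  case False
  then have "(norm x)\<^sup>2 - 1 > 0" by simp
  then show ?thesis
    using flat_1_pos_iff flat_1_nonneg by (meson add_nonneg_pos)
qed

lemma elem_smooth_plateau: "elem_smooth plateau"
  unfolding plateau_def
  by (intro elem_smooth.mult elem_smooth.inverse elem_smooth.add elem_smooth_flat elem_smooth_diff
      elem_smooth.const elem_smooth_norm_sq)
    (use plateau_denominator_pos in \<open>metis less_irrefl\<close>)

lemma plateau_eq_1: "norm x \<le> 1 \<Longrightarrow> plateau x = 1"
proof -
  assume x: "norm x \<le> 1"
  then have "(norm x)\<^sup>2 \<le> 1" by (simp add: power_le_one)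
  then have "flat 1 ((norm x)\<^sup>2 - 1) = 0" "flat 1 (4 - (norm x)\<^sup>2) \<noteq> 0"
    by (auto simp: flat_def)
  then show ?thesis by (simp add: plateau_def)
qed

lemma plateau_eq_0: "norm x \<ge> 2 \<Longrightarrow> plateau x = 0"
proof -
  assume x: "norm x \<ge> 2"
  then have "(norm x)\<^sup>2 \<ge> 2\<^sup>2" by (intro power_mono) auto
  then show ?thesis by (simp add: plateau_def flat_def)
qed

lemma plateau_bounds: "0 \<le> plateau x" "plateau x \<le> 1"
  using plateau_denominator_pos[of x] flat_1_nonneg[of "4 - (norm x)\<^sup>2"]
    flat_1_nonneg[of "(norm x)\<^sup>2 - 1"]
  by (auto simp: plateau_def field_simps)

text \<open>For nonnegative radii \<open>b\<close> is positive exactly on the open annulus, so m b /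
  (1 + m b) lies in [0,1], has a support independent of m, and tends to the indicator of that
  annulus: test functions made for dominated convergence.\<close>

definition annulus_cutoff :: "real \<Rightarrow> real \<Rightarrow> nat \<Rightarrow> real^'n \<Rightarrow> real"
  where "annulus_cutoff r R m x =
    (let b = flat 1 ((norm x)\<^sup>2 - r\<^sup>2) * flat 1 (R\<^sup>2 - (norm x)\<^sup>2)
     in (real m * b) * inverse (1 + real m * b))"

lemma elem_smooth_annulus_cutoff: "elem_smooth (annulus_cutoff r R m)"
  unfolding annulus_cutoff_def Let_def
proof (intro elem_smooth.mult elem_smooth.inverse elem_smooth.add elem_smooth_flat elem_smooth_diff
      elem_smooth.const elem_smooth_norm_sq)
  fix x :: "real^'n"
  have "0 \<le> real m * (flat 1 ((norm x)\<^sup>2 - r\<^sup>2) * flat 1 (R\<^sup>2 - (norm x)\<^sup>2))"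
    by (intro mult_nonneg_nonneg flat_1_nonneg) auto
  then show "1 + real m * (flat 1 ((norm x)\<^sup>2 - r\<^sup>2) * flat 1 (R\<^sup>2 - (norm x)\<^sup>2)) \<noteq> 0"
    by linarith
qed

lemma annulus_cutoff_eq_0: "0 \<le> r \<Longrightarrow> 0 \<le> R \<Longrightarrow> norm x \<le> r \<or> R \<le> norm x \<Longrightarrow> annulus_cutoff r R m x = 0"
  by (auto simp: annulus_cutoff_def flat_def power_mono)

lemma annulus_cutoff_bounds: "0 \<le> annulus_cutoff r R m x" "annulus_cutoff r R m x \<le> 1"
proof -
  define b where "b = flat 1 ((norm x)\<^sup>2 - r\<^sup>2) * flat 1 (R\<^sup>2 - (norm x)\<^sup>2)"
  have "0 \<le> real m * b" unfolding b_def
    by (intro mult_nonneg_nonneg flat_1_nonneg) auto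
  then show "0 \<le> annulus_cutoff r R m x" "annulus_cutoff r R m x \<le> 1"
    unfolding annulus_cutoff_def b_def[symmetric] Let_def by (auto simp: field_simps)
qed

lemma annulus_cutoff_tendsto:
  assumes "0 \<le> r" "0 \<le> R"
  shows "(\<lambda>m. annulus_cutoff r R m x) \<longlonglongrightarrow> (if r < norm x \<and> norm x < R then 1 else 0)"
proof (cases "r < norm x \<and> norm x < R")
  case True
  define b where "b = flat 1 ((norm x)\<^sup>2 - r\<^sup>2) * flat 1 (R\<^sup>2 - (norm x)\<^sup>2)"
  have "(norm x)\<^sup>2 - r\<^sup>2 > 0" "R\<^sup>2 - (norm x)\<^sup>2 > 0"
    using True assms by (auto simp: power_strict_mono)
  then have b: "b > 0"
    unfolding b_def using flat_1_pos_iff by (meson mult_pos_pos)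
  have "filterlim (\<lambda>m. 1 + b * real m) at_top sequentially"
    by (intro filterlim_tendsto_add_at_top[OF tendsto_const]
        filterlim_tendsto_pos_mult_at_top[OF tendsto_const b filterlim_real_sequentially])
  then have "(\<lambda>m. 1 - inverse (1 + b * real m)) \<longlonglongrightarrow> 1 - 0"
    by (intro tendsto_diff tendsto_const filterlim_compose[OF tendsto_inverse_0_at_top]) 
      (auto intro: filterlim_ident)
  moreover have "1 - inverse (1 + b * real m) = annulus_cutoff r R m x" for m
  proof -
    have "1 + b * real m > 0" using b by (simp add: add_pos_nonneg)
    then show ?thesis
      unfolding annulus_cutoff_def b_def[symmetric] Let_def by (simp add: field_simps)
  qed
  ultimately show ?thesis using True by simp
next
  case False
  then have "annulus_cutoff r R m x = 0" for m
    using assms by (intro annulus_cutoff_eq_0) auto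
  with False show ?thesis by (simp only: if_False tendsto_const)
qed

section \<open>Fourier transforms of test functions\<close>

lemma integral_lborel_affine:
  fixes f :: "'a::euclidean_space \<Rightarrow> 'b::{banach, second_countable_topology}"
  assumes [measurable]: "f \<in> borel_measurable borel" and "c \<noteq> 0"
  shows "(LINT x|lborel. f x) = \<bar>c\<bar> ^ DIM('a) *\<^sub>R (LINT x|lborel. f (t + c *\<^sub>R x))"
  using assms(2) by (subst lborel_affine[of c t]) (auto simp: integral_density integral_distr)

lemma integral_lborel_translate:
  fixes f :: "'a::euclidean_space \<Rightarrow> 'b::{banach, second_countable_topology}"
  assumes "f \<in> borel_measurable borel"
  shows "(LINT x|lborel. f (x + t)) = (LINT x|lborel. f x)"
  using integral_lborel_affine[OF assms, of 1 t] by (simp add: add.commute)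

lemma integral_lborel_uminus:
  fixes f :: "'a::euclidean_space \<Rightarrow> 'b::{banach, second_countable_topology}"
  assumes "f \<in> borel_measurable borel"
  shows "(LINT x|lborel. f (- x)) = (LINT x|lborel. f x)"
  using integral_lborel_affine[OF assms, of "-1" 0] by simp

text \<open>Sum over the unit shells m <= |x| < m + 1, each enlarged to the ball of radius m + 1.
  Its volume, of order (m + 1)^d, against (1 + m)^-(d + 2) leaves (m + 1)^-2. The enlargement costs
  one power, hence the exponent d + 2.\<close>

lemma integrable_inverse_power_norm:
  "integrable lborel (\<lambda>x::'a::euclidean_space. inverse ((1 + norm x) ^ (DIM('a) + 2)))"
proof -
  define N where "N = DIM('a) + 2"
  define h where "h m x = ennreal (inverse ((1 + real m) ^ N)) *
    indicator (ball (0::'a) (real (Suc m))) x" for m x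
  have bd: "ennreal (inverse ((1 + norm x) ^ N)) \<le> (\<Sum>m. h m x)" for x :: 'a
  proof -
    define m where "m = nat \<lfloor>norm x\<rfloor>"
    have m: "real m \<le> norm x" "norm x < real (Suc m)" unfolding m_def using norm_ge_zero[of x] by (simp_all, linarith?)
    have "ennreal (inverse ((1 + norm x) ^ N)) \<le> h m x"
      unfolding h_def using m
      by (auto simp: indicator_def intro!: ennreal_leI le_imp_inverse_le power_mono)
    also have "\<dots> \<le> (\<Sum>m. h m x)"
      using sum_le_suminf[of "\<lambda>m. h m x" "{m}"] by simp
    finally show ?thesis .
  qed
  have "(\<integral>\<^sup>+x. ennreal (inverse ((1 + norm x) ^ N)) \<partial>(lborel :: 'a measure)) \<le>
      (\<integral>\<^sup>+x. (\<Sum>m. h m x) \<partial>lborel)"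
    by (intro nn_integral_mono bd)
  also have "\<dots> = (\<Sum>m. \<integral>\<^sup>+x. h m x \<partial>lborel)"
    unfolding h_def
    by (intro nn_integral_suminf borel_measurable_times_ennreal borel_measurable_const
        borel_measurable_indicator) auto
  also have "\<dots> = (\<Sum>m. ennreal (unit_ball_vol (DIM('a)) * (1 / real (Suc m) ^ 2)))"
  proof (intro suminf_cong)
    fix m
    have "(\<integral>\<^sup>+x. h m x \<partial>lborel) = ennreal (inverse ((1 + real m) ^ N)) *
        ennreal (unit_ball_vol (DIM('a)) * real (Suc m) ^ DIM('a))"
      by (simp add: h_def nn_integral_cmult_indicator emeasure_ball)
    also have "\<dots> = ennreal (inverse ((1 + real m) ^ N) *
        (unit_ball_vol (DIM('a)) * real (Suc m) ^ DIM('a)))"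
      by (intro ennreal_mult[symmetric]) auto
    also have "inverse ((1 + real m) ^ N) * (unit_ball_vol (DIM('a)) * real (Suc m) ^ DIM('a)) =
        unit_ball_vol (DIM('a)) * (1 / real (Suc m) ^ 2)"
    proof -
      have "inverse (r ^ N) * (v * r ^ DIM('a)) = v * (1 / r ^ 2)" if "r > 0" for r v :: real
        using that by (simp add: N_def power_add field_simps power2_eq_square)
      from this[of "1 + real m" "unit_ball_vol (DIM('a))"] show ?thesis by simp
    qed
    finally show "(\<integral>\<^sup>+x. h m x \<partial>lborel) = ennreal (unit_ball_vol (DIM('a)) * (1 / real (Suc m) ^ 2))" .
  qed
  also have "\<dots> < \<infinity>"
  proof -
    have "summable (\<lambda>m. unit_ball_vol (DIM('a)) * (1 / real (Suc m) ^ 2))"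
      using inverse_power_summable[of 2, where ?'a=real]
      by (intro summable_mult, subst summable_Suc_iff[of "\<lambda>m. 1 / real m ^ 2"])
        (simp add: inverse_eq_divide)
    then show ?thesis
      by (subst suminf_ennreal2) (auto intro: unit_ball_vol_nonneg)
  qed
  finally show ?thesis
    by (intro integrableI_bounded) (auto simp: N_def)
qed

lemma integrable_compact_support:
  fixes f :: "'a::euclidean_space \<Rightarrow> 'b::{banach, second_countable_topology}"
  assumes "continuous_on UNIV f" "\<And>x. norm x \<ge> R \<Longrightarrow> f x = 0"
  shows "integrable lborel f"
proof -
  have "integrable lborel (\<lambda>x. indicator (cball 0 R) x *\<^sub>R f x)"
    by (intro borel_integrable_compact continuous_on_subset[OF assms(1)]) auto
  also have "(\<lambda>x. indicator (cball 0 R) x *\<^sub>R f x) = f"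
    using assms(2) by (auto simp: indicator_def)
  finally show ?thesis .
qed

section \<open>Support and regularity of test functions\<close>

lemma test_function_continuous:
  assumes "test_function_on U \<phi>"
  shows "continuous_on A \<phi>"
proof -
  have "\<phi> differentiable (at x)" for x
    using assms unfolding test_function_on_def smooth_def by (metis foldr.simps(1) id_apply)
  then show ?thesis
    by (simp add: continuous_at_imp_continuous_on differentiable_imp_continuous_within)
qed

lemma test_function_measurable [measurable_dest]:
  "test_function_on U \<phi> \<Longrightarrow> \<phi> \<in> borel_measurable borel"
  by (intro borel_measurable_continuous_onI test_function_continuous)

lemma test_function_bounded_support:
  assumes "test_function_on U \<phi>"
  obtains R where "R > 0" "\<And>x. norm x \<ge> R \<Longrightarrow> \<phi> x = 0"
proof -
  obtain C where C: "compact C" "\<And>x. x \<notin> C \<Longrightarrow> \<phi> x = 0"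
    using assms unfolding test_function_on_def by blast
  obtain R where "R > 0" "\<And>x. x \<in> C \<Longrightarrow> norm x \<le> R"
    using compact_imp_bounded[OF C(1)] by (auto simp: bounded_pos)
  then show ?thesis
    using C(2) that[of "R + 1"] by force
qed

lemma test_function_bounded:
  assumes "test_function_on U \<phi>"
  obtains B where "B > 0" "\<And>x. norm (\<phi> x) \<le> B"
proof -
  obtain R where R: "R > 0" "\<And>x. norm x \<ge> R \<Longrightarrow> \<phi> x = 0"
    using test_function_bounded_support[OF assms] by blast
  have "bounded (\<phi> ` cball 0 R)"
    by (intro compact_imp_bounded compact_continuous_image test_function_continuous[OF assms]) auto
  then obtain B where "B > 0" "\<And>x. x \<in> cball 0 R \<Longrightarrow> norm (\<phi> x) \<le> B"
    by (auto simp: bounded_pos)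
  then have "norm (\<phi> x) \<le> B" for x
    using R(2)[of x] by (cases "norm x \<le> R") auto
  with \<open>B > 0\<close> show ?thesis using that by blast
qed

lemma test_function_integrable: "test_function_on U \<phi> \<Longrightarrow> integrable lborel \<phi>"
  by (metis integrable_compact_support test_function_bounded_support test_function_continuous)

text \<open>\<open>partial\<close> is a derivative at parameter 0. Moving the base point gives the
  derivative at every parameter of the line, which the mean value inequality needs.\<close>

lemma test_function_line_derivative:
  assumes "test_function_on U \<phi>"
  shows "((\<lambda>t. \<phi> (x + t *\<^sub>R axis j 1)) has_vector_derivative partial j \<phi> (x + s *\<^sub>R axis j 1)) (at s)"
proof -
  have "\<phi> differentiable (at y)" for y
    using assms unfolding test_function_on_def smooth_def by (metis foldr.simps(1) id_apply)
  then have d: "(\<lambda>t. \<phi> (y + t *\<^sub>R axis j 1)) differentiable (at r)" for y r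
    using differentiable_chain_at[of "\<lambda>t. y + t *\<^sub>R axis j 1" r \<phi>]
    by (auto simp: o_def)
  have "((\<lambda>t. \<phi> ((x + s *\<^sub>R axis j 1) + t *\<^sub>R axis j 1)) has_vector_derivative
      partial j \<phi> (x + s *\<^sub>R axis j 1)) (at 0)"
    using d unfolding partial_def by (simp add: vector_derivative_works)
  then have *: "((\<lambda>t. \<phi> ((x + s *\<^sub>R axis j 1) + t *\<^sub>R axis j 1)) has_vector_derivative
      partial j \<phi> (x + s *\<^sub>R axis j 1)) (at (s - s))"
    by simp
  have "((\<lambda>t. t - s) has_vector_derivative 1) (at s)"
    by (auto intro!: derivative_eq_intros)
  from vector_diff_chain_at[OF this *] show ?thesis
    by (simp add: o_def algebra_simps)
qed

lemma test_function_on_partial: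
  assumes "test_function_on U \<phi>"
  shows "test_function_on U (partial j \<phi>)"
proof -
  obtain C where C: "compact C" "C \<subseteq> U" "\<And>x. x \<notin> C \<Longrightarrow> \<phi> x = 0"
    using assms unfolding test_function_on_def by blast
  have "partial j \<phi> x = 0" if "x \<notin> C" for x
  proof -
    have "open ((\<lambda>t. x + t *\<^sub>R axis j 1) -` (- C))"
      using C(1) by (intro open_vimage continuous_intros) (auto simp: compact_imp_closed open_Compl)
    then have "((\<lambda>t. \<phi> (x + t *\<^sub>R axis j 1)) has_vector_derivative 0) (at 0)"
      by (rule has_vector_derivative_transform_within_open[OF has_vector_derivative_const])
        (use that C(3) in auto)
    then show ?thesis unfolding partial_def by (rule vector_derivative_at)
  qed
  moreover have "smooth (partial j \<phi>)"
    unfolding smooth_def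
  proof (intro allI)
    fix js x
    have "foldr partial (js @ [j]) \<phi> differentiable (at x)"
      using assms unfolding test_function_on_def smooth_def by blast
    then show "foldr partial js (partial j \<phi>) differentiable (at x)" by simp
  qed
  ultimately show ?thesis
    using C unfolding test_function_on_def by blast
qed

section \<open>The inverse Fourier transform under translation, dilation and modulation\<close>

text \<open>Passing from the completed measure to \<open>lborel\<close> makes Fubini and affine
  substitutions available; with \<open>cis\<close> it is evident that the kernel has modulus
  1.\<close>

lemma inv_fourier_lborel:
  assumes [measurable]: "\<phi> \<in> borel_measurable borel"
  shows "inv_fourier \<phi> \<xi> = (LINT x|lborel. \<phi> x * cis (2 * pi * (x \<bullet> \<xi>)))"
proof -
  have [measurable]: "(\<lambda>x. cis (2 * pi * (x \<bullet> \<xi>))) \<in> borel_measurable borel"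
    by (intro borel_measurable_continuous_onI continuous_intros)
  have "inv_fourier \<phi> \<xi> = (LINT x|lebesgue. \<phi> x * cis (2 * pi * (x \<bullet> \<xi>)))"
    by (simp add: inv_fourier_def cis_conv_exp mult_ac)
  then show ?thesis by (simp add: integral_completion)
qed

lemma cis_inner_measurable [measurable]:
  "(\<lambda>x. cis (2 * pi * (x \<bullet> \<xi>))) \<in> borel_measurable borel"
  by (intro borel_measurable_continuous_onI continuous_intros)

lemma integrable_times_cis:
  assumes "integrable lborel \<phi>"
  shows "integrable lborel (\<lambda>x. \<phi> x * cis (2 * pi * (x \<bullet> \<xi>)))"
  using assms by (rule Bochner_Integration.integrable_bound) (use assms in \<open>auto simp: norm_mult\<close>)

lemma norm_inv_fourier_le:
  assumes "\<phi> \<in> borel_measurable borel"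
  shows "norm (inv_fourier \<phi> \<xi>) \<le> (LINT x|lborel. norm (\<phi> x))"
  unfolding inv_fourier_lborel[OF assms]
  by (rule order_trans[OF integral_norm_bound]) (simp add: norm_mult)

lemma inv_fourier_continuous:
  assumes "integrable lborel \<phi>"
  shows "continuous_on A (inv_fourier \<phi>)"
proof -
  have [measurable]: "\<phi> \<in> borel_measurable borel" using assms by auto
  have "isCont (inv_fourier \<phi>) \<xi>" for \<xi>
    unfolding continuous_at_sequentially o_def
  proof (intro allI impI)
    fix X assume X: "X \<longlonglongrightarrow> \<xi>"
    have "(\<lambda>i. LINT x|lborel. \<phi> x * cis (2 * pi * (x \<bullet> X i))) \<longlonglongrightarrow>
        (LINT x|lborel. \<phi> x * cis (2 * pi * (x \<bullet> \<xi>)))"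
      by (rule integral_dominated_convergence[where w="\<lambda>x. norm (\<phi> x)"])
        (use assms X in \<open>auto intro!: tendsto_intros simp: norm_mult\<close>)
    then show "(\<lambda>i. inv_fourier \<phi> (X i)) \<longlonglongrightarrow> inv_fourier \<phi> \<xi>"
      by (simp add: inv_fourier_lborel)
  qed
  then show ?thesis by (simp add: continuous_at_imp_continuous_on)
qed

lemma inv_fourier_translate:
  assumes [measurable]: "\<phi> \<in> borel_measurable borel"
  shows "inv_fourier (\<lambda>x. \<phi> (x + y)) \<xi> = cis (- (2 * pi * (y \<bullet> \<xi>))) * inv_fourier \<phi> \<xi>"
proof -
  have "inv_fourier (\<lambda>x. \<phi> (x + y)) \<xi> =
      (LINT x|lborel. cis (- (2 * pi * (y \<bullet> \<xi>))) * (\<phi> (x + y) * cis (2 * pi * ((x + y) \<bullet> \<xi>))))"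
    by (simp add: inv_fourier_lborel inner_add_left distrib_left mult_ac flip: cis_mult)
      (simp add: cis_mult mult.assoc[symmetric])
  also have "\<dots> = cis (- (2 * pi * (y \<bullet> \<xi>))) * (LINT x|lborel. \<phi> (x + y) * cis (2 * pi * ((x + y) \<bullet> \<xi>)))"
    by simp
  also have "(LINT x|lborel. \<phi> (x + y) * cis (2 * pi * ((x + y) \<bullet> \<xi>))) = inv_fourier \<phi> \<xi>"
    by (subst integral_lborel_translate[of "\<lambda>x. \<phi> x * cis (2 * pi * (x \<bullet> \<xi>))"])
      (simp_all add: inv_fourier_lborel)
  finally show ?thesis .
qed

lemma inv_fourier_scale:
  fixes \<phi> :: "real^'n \<Rightarrow> complex"
  assumes [measurable]: "\<phi> \<in> borel_measurable borel" and "s > 0"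
  shows "inv_fourier (\<lambda>x. \<phi> ((1 / s) *\<^sub>R x)) \<xi> = s ^ CARD('n) *\<^sub>R inv_fourier \<phi> (s *\<^sub>R \<xi>)"
  using integral_lborel_affine[of "\<lambda>x. \<phi> ((1 / s) *\<^sub>R x) * cis (2 * pi * (x \<bullet> \<xi>))" s 0] assms(2)
  by (simp add: inv_fourier_lborel)

lemma inv_fourier_modulate:
  assumes "integrable lborel \<phi>"
  shows "inv_fourier (\<lambda>x. of_real (cos (2 * pi * (b \<bullet> x))) * \<phi> x) \<xi> =
    (inv_fourier \<phi> (\<xi> + b) + inv_fourier \<phi> (\<xi> - b)) / 2"
proof -
  have [measurable]: "\<phi> \<in> borel_measurable borel" using assms by auto
  have *: "of_real (cos (2 * pi * (b \<bullet> x))) * \<phi> x * cis (2 * pi * (x \<bullet> \<xi>)) =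
      (\<phi> x * cis (2 * pi * (x \<bullet> (\<xi> + b))) + \<phi> x * cis (2 * pi * (x \<bullet> (\<xi> - b)))) / 2" for x
  proof -
    define t where "t = 2 * pi * (b \<bullet> x)"
    define z where "z = 2 * pi * (x \<bullet> \<xi>)"
    have "2 * of_real (cos t) = cis t + cis (- t)"
      by (simp add: complex_eq_iff)
    then have "2 * (of_real (cos t) * \<phi> x * cis z) = (cis t + cis (- t)) * \<phi> x * cis z"
      by (metis mult.assoc)
    also have "\<dots> = \<phi> x * (cis z * cis t) + \<phi> x * (cis z * cis (- t))"
      by (simp only: algebra_simps)
    also have "\<dots> = \<phi> x * cis (z + t) + \<phi> x * cis (z - t)"
      by (simp add: cis_mult)
    finally have "of_real (cos t) * \<phi> x * cis z = (\<phi> x * cis (z + t) + \<phi> x * cis (z - t)) / 2"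
      by (subst eq_divide_eq) (simp add: mult.commute)
    moreover have "2 * pi * (x \<bullet> (\<xi> + b)) = z + t" "2 * pi * (x \<bullet> (\<xi> - b)) = z - t"
      by (simp_all add: t_def z_def inner_add_right inner_diff_right inner_commute[of b x]
          algebra_simps)
    ultimately show ?thesis
      unfolding t_def[symmetric] z_def[symmetric] by simp
  qed
  have [measurable]: "(\<lambda>x. complex_of_real (cos (2 * pi * (b \<bullet> x))) * \<phi> x) \<in> borel_measurable borel"
    by measurable
  have "inv_fourier (\<lambda>x. of_real (cos (2 * pi * (b \<bullet> x))) * \<phi> x) \<xi> =
      (LINT x|lborel. (\<phi> x * cis (2 * pi * (x \<bullet> (\<xi> + b))) + \<phi> x * cis (2 * pi * (x \<bullet> (\<xi> - b)))) / 2)"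
    by (subst inv_fourier_lborel) (simp_all only: *, measurable)
  then show ?thesis
    using integrable_times_cis[OF assms] by (simp add: inv_fourier_lborel)
qed


section \<open>Derivatives and decay on the Fourier side\<close>

text \<open>The sequential form lets derivatives under an integral sign come out of dominated
  convergence, which is a statement on sequences.\<close>

lemma has_vector_derivative_sequentially:
  "(f has_vector_derivative d) (at x) \<longleftrightarrow>
    (\<forall>t. t \<longlonglongrightarrow> 0 \<longrightarrow> (\<forall>m. t m \<noteq> 0) \<longrightarrow> (\<lambda>m. (f (x + t m) - f x) /\<^sub>R t m) \<longlonglongrightarrow> d)"
proof -
  have *: "(\<lambda>m. norm (f (x + t m) - f x - t m *\<^sub>R d) / norm (t m)) \<longlonglongrightarrow> 0 \<longleftrightarrow>
      (\<lambda>m. (f (x + t m) - f x) /\<^sub>R t m) \<longlonglongrightarrow> d" if "\<forall>m. t m \<noteq> 0" for t :: "nat \<Rightarrow> real"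
  proof -
    have "norm (f (x + t m) - f x - t m *\<^sub>R d) / norm (t m) =
        norm ((f (x + t m) - f x) /\<^sub>R t m - d)" for m
    proof -
      have "(f (x + t m) - f x) /\<^sub>R t m - d = (f (x + t m) - f x - t m *\<^sub>R d) /\<^sub>R t m"
        using that by (simp add: scaleR_diff_right)
      then show ?thesis by (simp add: divide_inverse_commute)
    qed
    then show ?thesis
      by (simp add: tendsto_norm_zero_iff LIM_zero_iff)
  qed
  show ?thesis
    unfolding has_vector_derivative_def has_derivative_at tendsto_at_iff_sequentially
    using * by (auto simp: o_def bounded_linear_scaleR_left)
qed

lemma vector_derivative_bound:
  fixes f :: "real \<Rightarrow> 'a::real_normed_vector"
  assumes "\<And>s. s \<in> {0..t} \<Longrightarrow> (f has_vector_derivative f' s) (at s)"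
    and "\<And>s. s \<in> {0..t} \<Longrightarrow> norm (f' s) \<le> B" and "0 \<le> t"
  shows "norm (f t - f 0) \<le> B * t"
proof -
  have "norm (f t - f 0) \<le> B * norm (t - 0)"
  proof (rule differentiable_bound[of "{0..t}"])
    show "(f has_derivative (\<lambda>h. h *\<^sub>R f' s)) (at s within {0..t})" if "s \<in> {0..t}" for s
      using assms(1)[OF that] has_derivative_at_withinI unfolding has_vector_derivative_def by blast
    show "onorm (\<lambda>h. h *\<^sub>R f' s) \<le> B" if "s \<in> {0..t}" for s
      using assms(2)[OF that] by (intro onorm_le) (auto simp: mult.commute[of B] intro!: mult_left_mono)
  qed (use assms(3) in auto)
  then show ?thesis using assms(3) by simp
qed

text \<open>Difference quotients replace integration by parts: a translation of
  \<open>\<phi>\<close> multiplies its transform by a character, so both sides of the identity are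
  limits of the same sequence.\<close>

lemma inv_fourier_partial:
  fixes \<phi> :: "real^'n \<Rightarrow> complex"
  assumes \<phi>: "test_function_on U \<phi>"
  shows "inv_fourier (partial j \<phi>) \<xi> = - (2 * of_real pi * \<i> * of_real (\<xi> $ j)) * inv_fourier \<phi> \<xi>"
proof -
  note [measurable] = test_function_measurable[OF \<phi>] test_function_measurable[OF test_function_on_partial[OF \<phi>]]
  define t where "t m = inverse (real (Suc m))" for m
  have "t \<longlonglongrightarrow> 0" unfolding t_def by (rule LIMSEQ_inverse_real_of_nat)
  moreover have "\<And>m. t m \<noteq> 0" "\<And>m. 0 < t m" "\<And>m. t m \<le> 1"
    by (auto simp: t_def inverse_le_1_iff)
  ultimately have t: "t \<longlonglongrightarrow> 0" "\<And>m. t m \<noteq> 0" "\<And>m. 0 < t m" "\<And>m. t m \<le> 1"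
    by blast+
  define q where "q m x = (\<phi> (x + t m *\<^sub>R axis j 1) - \<phi> x) /\<^sub>R t m" for m x
  obtain R where R: "R > 0" "\<And>x. norm x \<ge> R \<Longrightarrow> \<phi> x = 0"
    using test_function_bounded_support[OF \<phi>] by blast
  obtain B where B: "B > 0" "\<And>x. norm (partial j \<phi> x) \<le> B"
    using test_function_bounded[OF test_function_on_partial[OF \<phi>]] by blast
  \<comment> \<open>Because 0 < \<open>t m\<close> <= 1, the shifted support stays in the ball of
    radius R + 1; inside it the mean value inequality gives the bound \<open>B\<close>.\<close>
  have q_bound: "norm (q m x) \<le> B * indicator (cball 0 (R + 1)) x" for m x
  proof (cases "norm x \<le> R + 1")
    case True
    have "norm (\<phi> (x + t m *\<^sub>R axis j 1) - \<phi> (x + 0 *\<^sub>R axis j 1)) \<le> B * t m"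
      by (rule vector_derivative_bound[OF test_function_line_derivative[OF \<phi>] B(2)])
        (use t(3)[of m] in auto)
    then show ?thesis
      using True t(3)[of m] by (simp add: q_def divide_inverse_commute[symmetric] pos_divide_le_eq)
  next
    case False
    have "norm x \<le> norm (x + t m *\<^sub>R axis j 1) + norm (t m *\<^sub>R axis j (1::real))"
      by (metis add_diff_cancel_right' norm_triangle_ineq4)
    moreover have "norm (t m *\<^sub>R axis j (1::real)) \<le> 1"
      using t(3,4)[of m] by simp
    ultimately have "norm (x + t m *\<^sub>R axis j 1) \<ge> R" using False by linarith
    then show ?thesis using False R by (simp add: q_def)
  qed
  have q_meas [measurable]: "q m \<in> borel_measurable borel" for m
    unfolding q_def by measurable
  have "(\<lambda>m. LINT x|lborel. q m x * cis (2 * pi * (x \<bullet> \<xi>))) \<longlonglongrightarrow>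
      (LINT x|lborel. partial j \<phi> x * cis (2 * pi * (x \<bullet> \<xi>)))"
  proof (rule integral_dominated_convergence[where w="\<lambda>x. B * indicator (cball 0 (R + 1)) x"])
    show "integrable lborel (\<lambda>x::real^'n. B * indicator (cball 0 (R + 1)) x :: real)"
      using emeasure_bounded_finite[of "cball (0::real^'n) (R + 1)"]
      by (intro integrable_mult_right integrable_real_indicator) auto
    show "AE x in lborel. (\<lambda>m. q m x * cis (2 * pi * (x \<bullet> \<xi>))) \<longlonglongrightarrow> partial j \<phi> x * cis (2 * pi * (x \<bullet> \<xi>))"
    proof (intro AE_I2 tendsto_mult tendsto_const)
      fix x
      have "((\<lambda>t. \<phi> (x + t *\<^sub>R axis j 1)) has_vector_derivative partial j \<phi> x) (at 0)"
        using test_function_line_derivative[OF \<phi>, of x j 0] by simp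
      then show "(\<lambda>m. q m x) \<longlonglongrightarrow> partial j \<phi> x"
        unfolding has_vector_derivative_sequentially q_def using t(1,2) by fastforce
    qed
  qed (use q_bound in \<open>auto simp: norm_mult\<close>)
  moreover have "(LINT x|lborel. q m x * cis (2 * pi * (x \<bullet> \<xi>))) =
      ((cis (- (2 * pi * \<xi> $ j * t m)) - 1) /\<^sub>R t m) * inv_fourier \<phi> \<xi>" for m
  proof -
    have i: "integrable lborel (\<lambda>x. \<phi> (x + t m *\<^sub>R axis j 1))"
      using test_function_integrable[OF \<phi>] lborel_distr_plus[of "t m *\<^sub>R axis j 1 :: real^'n"]
        integrable_distr_eq[of "(+) (t m *\<^sub>R axis j 1 :: real^'n)" lborel borel \<phi>]
      by (simp add: add.commute)
    have "(LINT x|lborel. q m x * cis (2 * pi * (x \<bullet> \<xi>))) =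
        (inv_fourier (\<lambda>x. \<phi> (x + t m *\<^sub>R axis j 1)) \<xi> - inv_fourier \<phi> \<xi>) /\<^sub>R t m"
      using integrable_times_cis[OF i] integrable_times_cis[OF test_function_integrable[OF \<phi>]]
      by (simp add: q_def inv_fourier_lborel left_diff_distrib scaleR_diff_right)
    then show ?thesis
      by (simp add: inv_fourier_translate inner_axis' algebra_simps)
  qed
  ultimately have "(\<lambda>m. ((cis (- (2 * pi * \<xi> $ j * t m)) - 1) /\<^sub>R t m) * inv_fourier \<phi> \<xi>)
      \<longlonglongrightarrow> inv_fourier (partial j \<phi>) \<xi>"
    by (simp add: inv_fourier_lborel)
  moreover have "((\<lambda>t. cis (- (2 * pi * \<xi> $ j * t))) has_vector_derivative
      - (2 * of_real pi * \<i> * of_real (\<xi> $ j))) (at 0)"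
    unfolding has_vector_derivative_def
    by (auto intro!: derivative_eq_intros simp: fun_eq_iff scaleR_conv_of_real)
  then have "(\<lambda>m. ((cis (- (2 * pi * \<xi> $ j * t m)) - 1) /\<^sub>R t m)) \<longlonglongrightarrow>
      - (2 * of_real pi * \<i> * of_real (\<xi> $ j))"
    unfolding has_vector_derivative_sequentially using t(1,2) by fastforce
  then have "(\<lambda>m. ((cis (- (2 * pi * \<xi> $ j * t m)) - 1) /\<^sub>R t m) * inv_fourier \<phi> \<xi>)
      \<longlonglongrightarrow> - (2 * of_real pi * \<i> * of_real (\<xi> $ j)) * inv_fourier \<phi> \<xi>"
    by (intro tendsto_mult tendsto_const)
  ultimately show ?thesis by (rule LIMSEQ_unique)
qed

text \<open>N derivatives in direction j multiply the transform by a factor of modulus (2 pi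
  |\<xi>_j|)^N, and every transform is bounded by an L1 norm. The direction is chosen after \<xi>:
  the largest coordinate controls the whole norm.\<close>

lemma inv_fourier_decay:
  fixes \<phi> :: "real^'n \<Rightarrow> complex"
  assumes \<phi>: "test_function_on U \<phi>"
  obtains C where "C \<ge> 0" "\<And>\<xi>. (1 + norm \<xi>) ^ N * norm (inv_fourier \<phi> \<xi>) \<le> C"
proof -
  have it: "test_function_on U ((partial j ^^ N) \<phi>)" for j N
    by (induction N) (auto intro: \<phi> test_function_on_partial)
  have it_norm: "norm (inv_fourier ((partial j ^^ N) \<phi>) \<xi>) =
      (2 * pi * \<bar>\<xi> $ j\<bar>) ^ N * norm (inv_fourier \<phi> \<xi>)" for j N \<xi>
    by (induction N) (simp_all add: inv_fourier_partial[OF it] norm_mult)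
  define B where "B j = (LINT x|lborel. norm ((partial j ^^ N) \<phi> x))" for j
  define B0 where "B0 = (LINT x|lborel. norm (\<phi> x))"
  have B_nonneg: "B j \<ge> 0" "B0 \<ge> 0" for j by (auto simp: B_def B0_def)
  have B: "\<bar>\<xi> $ j\<bar> ^ N * norm (inv_fourier \<phi> \<xi>) \<le> B j" for \<xi> j
  proof -
    have "1 \<le> 2 * pi" using pi_gt3 by linarith
    then have "\<bar>\<xi> $ j\<bar> \<le> 2 * pi * \<bar>\<xi> $ j\<bar>"
      using mult_right_mono[of 1 "2 * pi" "\<bar>\<xi> $ j\<bar>"] by simp
    then have "\<bar>\<xi> $ j\<bar> ^ N * norm (inv_fourier \<phi> \<xi>) \<le> (2 * pi * \<bar>\<xi> $ j\<bar>) ^ N * norm (inv_fourier \<phi> \<xi>)"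
      by (intro mult_right_mono power_mono) auto
    also have "\<dots> \<le> B j"
      unfolding it_norm[symmetric] B_def
      by (rule norm_inv_fourier_le[OF test_function_measurable[OF it]])
    finally show ?thesis .
  qed
  define n where "n = real CARD('n)"
  have n: "n \<ge> 1" unfolding n_def by (simp add: Suc_le_eq)
  have "(1 + norm \<xi>) ^ N * norm (inv_fourier \<phi> \<xi>) \<le> (1 + n) ^ N * (B0 + sum B UNIV)" for \<xi>
  proof -
    \<comment> \<open>If all coordinates are at most 1, then |\<xi>| <= n and the bound without
      derivatives is enough. Otherwise 1 + |\<xi>| <= (1 + n) M, the origin of the factor (1 +
      n)^N.\<close>
    define M where "M = Max (range (\<lambda>j. \<bar>\<xi> $ j\<bar>))"
    have "M \<in> range (\<lambda>j. \<bar>\<xi> $ j\<bar>)" unfolding M_def by (intro Max_in) auto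
    then obtain j where j: "M = \<bar>\<xi> $ j\<bar>" by blast
    have "norm \<xi> \<le> (\<Sum>i\<in>UNIV. \<bar>\<xi> $ i\<bar>)" by (rule norm_le_l1_cart)
    also have "\<dots> \<le> (\<Sum>i\<in>(UNIV::'n set). M)"
      unfolding M_def by (intro sum_mono Max_ge) auto
    finally have nM: "norm \<xi> \<le> n * M" by (simp add: n_def)
    show ?thesis
    proof (cases "M \<le> 1")
      case True
      then have "norm \<xi> \<le> n"
        using nM n mult_left_mono[of M 1 n] by linarith
      then have "(1 + norm \<xi>) ^ N * norm (inv_fourier \<phi> \<xi>) \<le> (1 + n) ^ N * B0"
        unfolding B0_def
        by (intro mult_mono power_mono norm_inv_fourier_le[OF test_function_measurable[OF \<phi>]]) (use n in auto)
      also have "\<dots> \<le> (1 + n) ^ N * (B0 + sum B UNIV)"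
        using n B_nonneg by (intro mult_left_mono) (auto intro: sum_nonneg)
      finally show ?thesis .
    next
      case False
      then have "1 + norm \<xi> \<le> (1 + n) * M"
        using nM by (simp add: distrib_right)
      then have "(1 + norm \<xi>) ^ N * norm (inv_fourier \<phi> \<xi>) \<le> ((1 + n) * M) ^ N * norm (inv_fourier \<phi> \<xi>)"
        by (intro mult_right_mono power_mono) auto
      also have "\<dots> = (1 + n) ^ N * (M ^ N * norm (inv_fourier \<phi> \<xi>))"
        by (simp add: power_mult_distrib)
      also have "\<dots> \<le> (1 + n) ^ N * B j"
        using B[of \<xi> j] n unfolding j by (intro mult_left_mono) auto
      also have "B j \<le> B0 + sum B UNIV"
        using B_nonneg member_le_sum[of j UNIV B] by auto
      finally show ?thesis using n by (simp add: mult_left_mono)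
    qed
  qed
  moreover have "0 \<le> (1 + n) ^ N * (B0 + sum B UNIV)"
    using n B_nonneg by (auto intro!: mult_nonneg_nonneg add_nonneg_nonneg sum_nonneg)
  ultimately show ?thesis using that by blast
qed

lemma integrable_decaying:
  fixes g :: "'a::euclidean_space \<Rightarrow> 'b::{banach, second_countable_topology}"
  assumes "g \<in> borel_measurable borel"
    and "\<And>\<xi>. (1 + norm \<xi>) ^ (DIM('a) + 2) * norm (g \<xi>) \<le> C"
  shows "integrable lborel g"
proof (rule Bochner_Integration.integrable_bound)
  show "integrable lborel (\<lambda>\<xi>::'a. C * inverse ((1 + norm \<xi>) ^ (DIM('a) + 2)))"
    by (intro integrable_mult_right integrable_inverse_power_norm)
  have "norm (g \<xi>) \<le> C * inverse ((1 + norm \<xi>) ^ (DIM('a) + 2))" for \<xi>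
  proof -
    have "1 + norm \<xi> > 0" by (simp add: add_pos_nonneg)
    then have "(1 + norm \<xi>) ^ (DIM('a) + 2) > 0" by simp
    then show ?thesis
      using assms(2)[of \<xi>] by (simp add: field_simps)
  qed
  then show "AE \<xi> in lborel. norm (g \<xi>) \<le> norm (C * inverse ((1 + norm \<xi>) ^ (DIM('a) + 2)))"
    by (intro AE_I2) (metis abs_ge_self order_trans real_norm_def)
qed (use assms in auto)

lemma inv_fourier_integrable:
  fixes \<phi> :: "real^'n \<Rightarrow> complex"
  assumes \<phi>: "test_function_on U \<phi>" shows "integrable lborel (inv_fourier \<phi>)"
proof -
  obtain C where "C \<ge> 0" "\<And>\<xi>. (1 + norm \<xi>) ^ (CARD('n) + 2) * norm (inv_fourier \<phi> \<xi>) \<le> C"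
    using inv_fourier_decay[OF \<phi>] by blast
  then show ?thesis
    by (intro integrable_decaying borel_measurable_continuous_onI inv_fourier_continuous
        test_function_integrable[OF \<phi>]) auto
qed

lemma norm_cis_minus_1_le: "norm (cis t - 1) \<le> \<bar>t\<bar>"
proof -
  have "norm (cis t - cis 0) \<le> 1 * norm (t - 0)"
  proof (rule differentiable_bound[of UNIV])
    show "(cis has_derivative (\<lambda>h. h *\<^sub>R (\<i> * cis s))) (at s within UNIV)" for s
      using has_derivative_cis[OF has_derivative_ident] by simp
    show "onorm (\<lambda>h. h *\<^sub>R (\<i> * cis s)) \<le> 1" for s
      by (intro onorm_le) (simp add: norm_mult)
  qed auto
  then show ?thesis by simp
qed

text \<open>Here the exponential is differentiated and not \<open>\<phi>\<close>, so continuity and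
  bounded support are enough: the support makes \<phi>(x) (a \<bullet> x) integrable.\<close>

lemma inv_fourier_directional_derivative:
  fixes \<phi> :: "real^'n \<Rightarrow> complex"
  assumes \<phi>: "continuous_on UNIV \<phi>" and R: "\<And>x. norm x \<ge> R \<Longrightarrow> \<phi> x = 0"
  shows "((\<lambda>t. inv_fourier \<phi> (\<xi> + t *\<^sub>R a)) has_vector_derivative
    2 * of_real pi * \<i> * inv_fourier (\<lambda>x. of_real (a \<bullet> x) * \<phi> x) (\<xi> + t *\<^sub>R a)) (at t)"
  unfolding has_vector_derivative_sequentially
proof (intro allI impI)
  fix s :: "nat \<Rightarrow> real" assume s: "s \<longlonglongrightarrow> 0" "\<forall>m. s m \<noteq> 0"
  have [measurable]: "\<phi> \<in> borel_measurable borel" by (intro borel_measurable_continuous_onI \<phi>)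
  have [measurable]: "(\<lambda>x. a \<bullet> x) \<in> borel_measurable borel"
    by (intro borel_measurable_continuous_onI continuous_intros)
  have [measurable]: "(\<lambda>x. cis (2 * pi * (a \<bullet> x) * s m)) \<in> borel_measurable borel" for m
    by (intro borel_measurable_continuous_onI continuous_intros)
  have int: "integrable lborel \<phi>" by (rule integrable_compact_support[OF \<phi> R])
  define \<zeta> where "\<zeta> = \<xi> + t *\<^sub>R a"
  define q where "q m x = \<phi> x * cis (2 * pi * (x \<bullet> \<zeta>)) * ((cis (2 * pi * (a \<bullet> x) * s m) - 1) /\<^sub>R s m)" for m x
  have "(\<lambda>m. LINT x|lborel. q m x) \<longlonglongrightarrow>
      (LINT x|lborel. \<phi> x * cis (2 * pi * (x \<bullet> \<zeta>)) * (2 * of_real pi * \<i> * of_real (a \<bullet> x)))"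
  proof (rule integral_dominated_convergence[where w="\<lambda>x. norm (\<phi> x) * (2 * pi * \<bar>a \<bullet> x\<bar>)"])
    show "integrable lborel (\<lambda>x. norm (\<phi> x) * (2 * pi * \<bar>a \<bullet> x\<bar>))"
      by (rule integrable_compact_support[of _ R]) (use R in \<open>auto intro!: continuous_intros \<phi>\<close>)
    show "AE x in lborel. (\<lambda>m. q m x) \<longlonglongrightarrow>
        \<phi> x * cis (2 * pi * (x \<bullet> \<zeta>)) * (2 * of_real pi * \<i> * of_real (a \<bullet> x))"
    proof (intro AE_I2)
      fix x
      have "((\<lambda>t. cis (2 * pi * (a \<bullet> x) * t)) has_vector_derivative
          (2 * of_real pi * \<i> * of_real (a \<bullet> x))) (at 0)"
        unfolding has_vector_derivative_def
        by (auto intro!: derivative_eq_intros simp: fun_eq_iff scaleR_conv_of_real)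
      then have "(\<lambda>m. (cis (2 * pi * (a \<bullet> x) * s m) - 1) /\<^sub>R s m) \<longlonglongrightarrow> 2 * of_real pi * \<i> * of_real (a \<bullet> x)"
        unfolding has_vector_derivative_sequentially using s by fastforce
      then show "(\<lambda>m. q m x) \<longlonglongrightarrow>
          \<phi> x * cis (2 * pi * (x \<bullet> \<zeta>)) * (2 * of_real pi * \<i> * of_real (a \<bullet> x))"
        unfolding q_def by (intro tendsto_mult tendsto_const)
    qed
    show "AE x in lborel. norm (q m x) \<le> norm (\<phi> x) * (2 * pi * \<bar>a \<bullet> x\<bar>)" for m
    proof (intro AE_I2)
      fix x
      have "norm (cis (2 * pi * (a \<bullet> x) * s m) - 1) / \<bar>s m\<bar> \<le> \<bar>2 * pi * (a \<bullet> x) * s m\<bar> / \<bar>s m\<bar>"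
        by (intro divide_right_mono norm_cis_minus_1_le) auto
      then have "norm ((cis (2 * pi * (a \<bullet> x) * s m) - 1) /\<^sub>R s m) \<le> 2 * pi * \<bar>a \<bullet> x\<bar>"
        using s(2) by (simp add: abs_mult divide_inverse_commute[symmetric])
      then show "norm (q m x) \<le> norm (\<phi> x) * (2 * pi * \<bar>a \<bullet> x\<bar>)"
        unfolding q_def norm_mult by (auto intro!: mult_left_mono)
    qed
  qed (auto simp: q_def)
  moreover have "(LINT x|lborel. q m x) = (inv_fourier \<phi> (\<xi> + (t + s m) *\<^sub>R a) - inv_fourier \<phi> \<zeta>) /\<^sub>R s m" for m
  proof -
    have "q m x = (\<phi> x * cis (2 * pi * (x \<bullet> (\<xi> + (t + s m) *\<^sub>R a))) - \<phi> x * cis (2 * pi * (x \<bullet> \<zeta>))) /\<^sub>R s m" for x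
    proof -
      have "2 * pi * (x \<bullet> (\<xi> + (t + s m) *\<^sub>R a)) = 2 * pi * (x \<bullet> \<zeta>) + 2 * pi * (a \<bullet> x) * s m"
        by (simp add: \<zeta>_def algebra_simps inner_add_right inner_commute)
      then have "cis (2 * pi * (x \<bullet> (\<xi> + (t + s m) *\<^sub>R a))) = cis (2 * pi * (x \<bullet> \<zeta>)) * cis (2 * pi * (a \<bullet> x) * s m)"
        by (simp only: cis_mult)
      then show ?thesis
        by (simp only: q_def) (simp add: algebra_simps)
    qed
    then show ?thesis
      using integrable_times_cis[OF int] by (simp add: inv_fourier_lborel)
  qed
  moreover have "(LINT x|lborel. \<phi> x * cis (2 * pi * (x \<bullet> \<zeta>)) * (2 * of_real pi * \<i> * of_real (a \<bullet> x))) =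
      2 * of_real pi * \<i> * inv_fourier (\<lambda>x. of_real (a \<bullet> x) * \<phi> x) \<zeta>"
    by (simp add: inv_fourier_lborel mult_ac flip: integral_mult_right_zero)
  ultimately show "(\<lambda>m. (inv_fourier \<phi> (\<xi> + (t + s m) *\<^sub>R a) - inv_fourier \<phi> (\<xi> + t *\<^sub>R a)) /\<^sub>R s m) \<longlonglongrightarrow>
      2 * of_real pi * \<i> * inv_fourier (\<lambda>x. of_real (a \<bullet> x) * \<phi> x) (\<xi> + t *\<^sub>R a)"
    by (simp add: \<zeta>_def)
qed

text \<open>The second derivative of the transform along \<open>a\<close> is a multiple of the
  transform of (a \<bullet> x)^2 \<phi>(x), which decays to any order; two mean value estimates turn
  this into the factor t^2. The decay in \<xi> is kept because it must later absorb the quadratic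
  growth of the symbol.\<close>

lemma inv_fourier_second_difference:
  fixes f :: "real^'n \<Rightarrow> real"
  assumes f: "elem_smooth f" and R: "\<And>x. norm x \<ge> R \<Longrightarrow> f x = 0"
  defines "\<phi> \<equiv> \<lambda>x. complex_of_real (f x)"
  obtains C where "C \<ge> 0" "\<And>\<xi> t. 0 \<le> t \<Longrightarrow> t \<le> 1 \<Longrightarrow> (1 + norm \<xi>) ^ N *
    norm (inv_fourier \<phi> (\<xi> + t *\<^sub>R a) + inv_fourier \<phi> (\<xi> - t *\<^sub>R a) - 2 * inv_fourier \<phi> \<xi>) \<le> C * t\<^sup>2"
proof -
  define \<phi>1 where "\<phi>1 x = complex_of_real (a \<bullet> x) * \<phi> x" for x
  define \<phi>2 where "\<phi>2 x = complex_of_real (a \<bullet> x) * \<phi>1 x" for x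
  have "test_function_on UNIV (\<lambda>x. complex_of_real ((a \<bullet> x) * ((a \<bullet> x) * f x)))"
    by (rule test_function_on_of_real[of _ "cball 0 R"])
      (use R in \<open>auto intro!: elem_smooth.mult elem_smooth_inner f\<close>)
  then have "test_function_on UNIV \<phi>2"
    by (simp add: \<phi>2_def[abs_def] \<phi>1_def \<phi>_def)
  then obtain C where C: "C \<ge> 0" "\<And>\<xi>. (1 + norm \<xi>) ^ N * norm (inv_fourier \<phi>2 \<xi>) \<le> C"
    using inv_fourier_decay by metis
  have cont: "continuous_on UNIV \<phi>" "continuous_on UNIV \<phi>1"
    unfolding \<phi>1_def[abs_def] \<phi>_def by (intro continuous_intros elem_smooth_continuous f)+
  have supp: "\<phi> x = 0" "\<phi>1 x = 0" if "norm x \<ge> R" for x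
    using R[OF that] by (auto simp: \<phi>_def \<phi>1_def)
  have d: "((\<lambda>t. inv_fourier \<phi> (\<xi> + t *\<^sub>R b)) has_vector_derivative
      2 * of_real pi * \<i> * inv_fourier (\<lambda>x. of_real (b \<bullet> x) * \<phi> x) (\<xi> + t *\<^sub>R b)) (at t)" for \<xi> t b
    by (rule inv_fourier_directional_derivative[OF cont(1) supp(1)])
  have d1: "((\<lambda>t. inv_fourier \<phi>1 (\<xi> + t *\<^sub>R a)) has_vector_derivative
      2 * of_real pi * \<i> * inv_fourier \<phi>2 (\<xi> + t *\<^sub>R a)) (at t)" for \<xi> t
    unfolding \<phi>2_def by (rule inv_fourier_directional_derivative[OF cont(2) supp(2)])
  have neg: "inv_fourier (\<lambda>x. of_real (- a \<bullet> x) * \<phi> x) \<xi> = - inv_fourier \<phi>1 \<xi>" for \<xi>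
    by (simp add: inv_fourier_def \<phi>1_def)
  have fold: "inv_fourier (\<lambda>x. of_real (a \<bullet> x) * \<phi> x) = inv_fourier \<phi>1"
    by (simp add: \<phi>1_def[abs_def])
  \<comment> \<open>Each derivative contributes 2 pi, the inner factor 2 comes from the parameter
    interval from -s to s, and (1 + |a|)^N is the cost of moving \<xi> by at most |a|.\<close>
  define D where "D = 2 * pi * (2 * (2 * pi * (C * (1 + norm a) ^ N)))"
  have "(1 + norm \<xi>) ^ N *
    norm (inv_fourier \<phi> (\<xi> + t *\<^sub>R a) + inv_fourier \<phi> (\<xi> - t *\<^sub>R a) - 2 * inv_fourier \<phi> \<xi>) \<le> D * t\<^sup>2"
    if t: "0 \<le> t" "t \<le> 1" for \<xi> t
  proof -
    define K where "K = C * (1 + norm a) ^ N / (1 + norm \<xi>) ^ N"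
    have pos: "(1 + norm \<xi>) ^ N > 0" by (simp add: add_pos_nonneg)
    have \<phi>2_le: "norm (inv_fourier \<phi>2 (\<xi> + s *\<^sub>R a)) \<le> K" if "\<bar>s\<bar> \<le> 1" for s
    proof -
      have "norm \<xi> \<le> norm (\<xi> + s *\<^sub>R a) + norm (s *\<^sub>R a)"
        by (metis add_diff_cancel_right' norm_triangle_ineq4)
      moreover have "norm (s *\<^sub>R a) \<le> norm a"
        using that by (simp add: mult_left_le_one_le)
      moreover have "0 \<le> norm a * norm (\<xi> + s *\<^sub>R a)" by simp
      ultimately have "1 + norm \<xi> \<le> (1 + norm a) * (1 + norm (\<xi> + s *\<^sub>R a))"
        by (simp only: distrib_left distrib_right mult_1_right mult_1_left)
      then have "(1 + norm \<xi>) ^ N * norm (inv_fourier \<phi>2 (\<xi> + s *\<^sub>R a)) \<le>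
          ((1 + norm a) * (1 + norm (\<xi> + s *\<^sub>R a))) ^ N * norm (inv_fourier \<phi>2 (\<xi> + s *\<^sub>R a))"
        by (intro mult_right_mono power_mono) auto
      also have "\<dots> = (1 + norm a) ^ N * ((1 + norm (\<xi> + s *\<^sub>R a)) ^ N * norm (inv_fourier \<phi>2 (\<xi> + s *\<^sub>R a)))"
        by (simp add: power_mult_distrib mult_ac)
      also have "\<dots> \<le> (1 + norm a) ^ N * C"
        by (intro mult_left_mono C(2)) simp
      finally show ?thesis using pos by (simp add: K_def field_simps)
    qed
    have \<phi>1_le: "norm (inv_fourier \<phi>1 (\<xi> + s *\<^sub>R a) - inv_fourier \<phi>1 (\<xi> - s *\<^sub>R a)) \<le> 2 * (2 * pi * K * s)"
      if s: "0 \<le> s" "s \<le> 1" for s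
    proof -
      have "norm (inv_fourier \<phi>1 ((\<xi> - s *\<^sub>R a) + (2 * s) *\<^sub>R a) - inv_fourier \<phi>1 ((\<xi> - s *\<^sub>R a) + 0 *\<^sub>R a)) \<le> (2 * pi * K) * (2 * s)"
      proof (rule vector_derivative_bound[OF d1])
        fix r assume r: "r \<in> {0..2 * s}"
        have eq: "(\<xi> - s *\<^sub>R a) + r *\<^sub>R a = \<xi> + (r - s) *\<^sub>R a" by (simp add: algebra_simps)
        have "\<bar>r - s\<bar> \<le> 1" using r s by auto
        then show "norm (2 * complex_of_real pi * \<i> * inv_fourier \<phi>2 (\<xi> - s *\<^sub>R a + r *\<^sub>R a)) \<le> 2 * pi * K"
          unfolding eq using \<phi>2_le[of "r - s"] by (simp add: norm_mult)
      qed (use s in auto)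
      moreover have "(\<xi> - s *\<^sub>R a) + (2 * s) *\<^sub>R a = \<xi> + s *\<^sub>R a" by (simp add: algebra_simps flip: scaleR_add_left)
      ultimately show ?thesis by simp
    qed
    \<comment> \<open>The sum of the two shifted values has as derivative a difference of first
      derivatives, already of size s; a second use of the mean value inequality gives t^2.\<close>
    define q where "q s = inv_fourier \<phi> (\<xi> + s *\<^sub>R a) + inv_fourier \<phi> (\<xi> + s *\<^sub>R (- a))" for s
    have "norm (q t - q 0) \<le> (2 * pi * (2 * (2 * pi * K * t))) * t"
    proof (rule vector_derivative_bound)
      fix s assume s: "s \<in> {0..t}"
      show "(q has_vector_derivative 2 * of_real pi * \<i> *
          (inv_fourier \<phi>1 (\<xi> + s *\<^sub>R a) - inv_fourier \<phi>1 (\<xi> - s *\<^sub>R a))) (at s)"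
        using has_vector_derivative_add[OF d[of \<xi> a s] d[of \<xi> "- a" s]] unfolding neg fold
        by (simp add: q_def[abs_def] algebra_simps)
      have K: "0 \<le> K" using C(1) by (simp add: K_def)
      have "norm (inv_fourier \<phi>1 (\<xi> + s *\<^sub>R a) - inv_fourier \<phi>1 (\<xi> - s *\<^sub>R a)) \<le> 2 * (2 * pi * K * s)"
        using s t by (intro \<phi>1_le) auto
      also have "\<dots> \<le> 2 * (2 * pi * K * t)"
        using s K by (auto intro!: mult_left_mono)
      finally have "2 * pi * norm (inv_fourier \<phi>1 (\<xi> + s *\<^sub>R a) - inv_fourier \<phi>1 (\<xi> - s *\<^sub>R a))
          \<le> 2 * pi * (2 * (2 * pi * K * t))"
        by (intro mult_left_mono) auto
      then show "norm (2 * of_real pi * \<i> *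
          (inv_fourier \<phi>1 (\<xi> + s *\<^sub>R a) - inv_fourier \<phi>1 (\<xi> - s *\<^sub>R a))) \<le> 2 * pi * (2 * (2 * pi * K * t))"
        by (simp only: norm_mult norm_of_real norm_ii norm_numeral mult_1_right abs_of_pos pi_gt_zero)
    qed (use t in auto)
    then have "norm (inv_fourier \<phi> (\<xi> + t *\<^sub>R a) + inv_fourier \<phi> (\<xi> - t *\<^sub>R a) - 2 * inv_fourier \<phi> \<xi>)
        \<le> (2 * pi * (2 * (2 * pi * K * t))) * t"
      by (simp add: q_def)
    also have "\<dots> = D * t\<^sup>2 / (1 + norm \<xi>) ^ N"
      by (simp add: D_def K_def power2_eq_square field_simps)
    finally show ?thesis using pos by (simp add: field_simps)
  qed
  moreover have "D \<ge> 0" using C(1) by (simp add: D_def)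
  ultimately show ?thesis using that by blast
qed

section \<open>A weak form of Fourier inversion\<close>

text \<open>Nonempty open sets are not null, so an almost everywhere statement can be evaluated at
  some point of a chosen open set.\<close>

lemma AE_lebesgue_open_ex:
  fixes S :: "'a::euclidean_space set"
  assumes "open S" "x \<in> S" "AE y in lebesgue. P y"
  obtains y where "y \<in> S" "P y"
proof -
  obtain N where N: "N \<in> null_sets lebesgue" "{y. \<not> P y} \<subseteq> N"
    using assms(3) unfolding eventually_ae_filter by auto
  then have "\<not> S \<subseteq> N"
    using open_not_negligible[OF assms(1)] assms(2) negligible_subset negligible_iff_null_sets by blast
  then show ?thesis using that N(2) by blast
qed

text \<open>Fubini for the compactly supported function \<open>h\<close>, followed by the
  substitution of s x for x. The dilation sits on \<open>\<eta>\<close> on one side and on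
  \<open>\<phi>\<close> on the other, so both are flattened when s grows.\<close>

lemma integral_inv_fourier_exchange:
  fixes \<phi> \<eta> :: "real^'n \<Rightarrow> complex"
  assumes \<phi>: "test_function_on U \<phi>" and \<eta>: "test_function_on V \<eta>" and "s > 0"
  shows "(LINT \<xi>|lborel. \<eta> ((1 / s) *\<^sub>R \<xi>) * inv_fourier \<phi> \<xi>) =
    (LINT x|lborel. \<phi> ((1 / s) *\<^sub>R x) * inv_fourier \<eta> x)"
proof -
  note [measurable] = test_function_measurable[OF \<phi>] test_function_measurable[OF \<eta>]
  define h where "h x \<xi> = \<eta> ((1 / s) *\<^sub>R \<xi>) * (\<phi> x * cis (2 * pi * (x \<bullet> \<xi>)))" for x \<xi>
  obtain R where R: "R > 0" "\<And>x. norm x \<ge> R \<Longrightarrow> \<phi> x = 0"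
    using test_function_bounded_support[OF \<phi>] by blast
  obtain S where S: "S > 0" "\<And>x. norm x \<ge> S \<Longrightarrow> \<eta> x = 0"
    using test_function_bounded_support[OF \<eta>] by blast
  have "integrable lborel (case_prod h)"
  proof (rule integrable_compact_support)
    have "continuous_on UNIV (\<lambda>p. h (fst p) (snd p))"
      unfolding h_def
      by (intro continuous_intros continuous_on_compose2[OF test_function_continuous[OF \<phi>, of UNIV]]
          continuous_on_compose2[OF test_function_continuous[OF \<eta>, of UNIV]]) auto
    then show "continuous_on UNIV (case_prod h)" by (simp add: case_prod_unfold)
    fix p :: "(real^'n) \<times> (real^'n)" assume p: "norm p \<ge> R + s * S"
    have "norm p \<le> norm (fst p) + norm (snd p)"
      by (metis norm_Pair_le prod.collapse)
    then have "norm (fst p) \<ge> R \<or> norm (snd p) \<ge> s * S" using p by linarith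
    then have "\<phi> (fst p) = 0 \<or> \<eta> ((1 / s) *\<^sub>R snd p) = 0"
      using R(2) S(2)[of "(1 / s) *\<^sub>R snd p"] assms(3) by (auto simp: field_simps)
    then show "case_prod h p = 0" by (auto simp: h_def case_prod_unfold)
  qed
  then have "(LINT \<xi>|lborel. LINT x|lborel. h x \<xi>) = (LINT x|lborel. LINT \<xi>|lborel. h x \<xi>)"
    by (intro lborel_pair.Fubini_integral) (simp add: lborel_prod)
  moreover have "(LINT x|lborel. h x \<xi>) = \<eta> ((1 / s) *\<^sub>R \<xi>) * inv_fourier \<phi> \<xi>" for \<xi>
    by (simp add: h_def inv_fourier_lborel)
  moreover have "(LINT \<xi>|lborel. h x \<xi>) = \<phi> x * (s ^ CARD('n) *\<^sub>R inv_fourier \<eta> (s *\<^sub>R x))" for x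
  proof -
    have "(LINT \<xi>|lborel. h x \<xi>) = (LINT \<xi>|lborel. \<phi> x * (\<eta> ((1 / s) *\<^sub>R \<xi>) * cis (2 * pi * (\<xi> \<bullet> x))))"
      by (simp add: h_def inner_commute mult_ac)
    also have "\<dots> = \<phi> x * inv_fourier (\<lambda>\<xi>. \<eta> ((1 / s) *\<^sub>R \<xi>)) x"
      by (simp add: inv_fourier_lborel)
    finally show ?thesis using assms(3) by (simp add: inv_fourier_scale)
  qed
  moreover have "(LINT x|lborel. \<phi> ((1 / s) *\<^sub>R x) * inv_fourier \<eta> x) =
      (LINT x|lborel. \<phi> x * (s ^ CARD('n) *\<^sub>R inv_fourier \<eta> (s *\<^sub>R x)))"
  proof -
    have [measurable]: "inv_fourier \<eta> \<in> borel_measurable borel"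
      by (intro borel_measurable_continuous_onI inv_fourier_continuous test_function_integrable[OF \<eta>])
    show ?thesis
      using integral_lborel_affine[of "\<lambda>x. \<phi> ((1 / s) *\<^sub>R x) * inv_fourier \<eta> x" s 0] assms(3)
      by simp
  qed
  ultimately show ?thesis by simp
qed

lemma scaled_argument_tendsto:
  fixes \<xi> :: "'a::real_normed_vector"
  assumes "continuous_on UNIV \<eta>"
  shows "(\<lambda>m. \<eta> ((1 / real (Suc m)) *\<^sub>R \<xi>)) \<longlonglongrightarrow> \<eta> 0"
proof -
  have "(\<lambda>m. 1 / real (Suc m)) \<longlonglongrightarrow> 0"
    using LIMSEQ_inverse_real_of_nat by (simp only: inverse_eq_divide)
  then have "(\<lambda>m. (1 / real (Suc m)) *\<^sub>R \<xi>) \<longlonglongrightarrow> 0 *\<^sub>R \<xi>"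
    by (rule tendsto_scaleR[OF _ tendsto_const])
  then show ?thesis
    using continuous_on_tendsto_compose[OF assms] by simp
qed

text \<open>Let s tend to infinity in the exchange formula. With \<eta>(0) = 1 this says that the
  integral of a transform is the value at 0 times a constant independent of the test function. The
  constant is never computed; it only has to be nonzero.\<close>

lemma integral_inv_fourier_swap_at_0:
  fixes \<phi> \<eta> :: "real^'n \<Rightarrow> complex"
  assumes \<phi>: "test_function_on U \<phi>" and \<eta>: "test_function_on V \<eta>"
  shows "\<eta> 0 * (LINT \<xi>|lborel. inv_fourier \<phi> \<xi>) = \<phi> 0 * (LINT x|lborel. inv_fourier \<eta> x)"
proof -
  have lim: "(\<lambda>m. LINT \<xi>|lborel. \<eta> ((1 / real (Suc m)) *\<^sub>R \<xi>) * inv_fourier \<phi> \<xi>) \<longlonglongrightarrow>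
      (LINT \<xi>|lborel. \<eta> 0 * inv_fourier \<phi> \<xi>)"
    if \<phi>: "test_function_on U \<phi>" and \<eta>: "test_function_on V \<eta>" for \<phi> \<eta> :: "real^'n \<Rightarrow> complex" and U V
  proof -
    note [measurable] = test_function_measurable[OF \<eta>]
      borel_measurable_integrable[OF inv_fourier_integrable[OF \<phi>]]
    obtain B where B: "B > 0" "\<And>x. norm (\<eta> x) \<le> B" using test_function_bounded[OF \<eta>] by blast
    show ?thesis
    proof (rule integral_dominated_convergence[where w="\<lambda>\<xi>. B * norm (inv_fourier \<phi> \<xi>)"])
      show "integrable lborel (\<lambda>\<xi>. B * norm (inv_fourier \<phi> \<xi>))"
        using inv_fourier_integrable[OF \<phi>] by auto
      show "AE \<xi> in lborel. (\<lambda>m. \<eta> ((1 / real (Suc m)) *\<^sub>R \<xi>) * inv_fourier \<phi> \<xi>) \<longlonglongrightarrow> \<eta> 0 * inv_fourier \<phi> \<xi>"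
        by (intro AE_I2 tendsto_mult tendsto_const scaled_argument_tendsto test_function_continuous[OF \<eta>])
    qed (use B in \<open>auto simp: norm_mult intro!: mult_right_mono\<close>)
  qed
  have "(LINT \<xi>|lborel. \<eta> 0 * inv_fourier \<phi> \<xi>) = (LINT x|lborel. \<phi> 0 * inv_fourier \<eta> x)"
    using lim[OF \<phi> \<eta>] lim[OF \<eta> \<phi>] integral_inv_fourier_exchange[OF \<phi> \<eta>, of "real (Suc m)" for m]
    by (simp add: LIMSEQ_unique)
  then show ?thesis by simp
qed

lemma test_function_plateau: "test_function_on UNIV (\<lambda>x. complex_of_real (plateau x))"
  by (rule test_function_on_of_real[of _ "cball 0 2"]) (auto simp: elem_smooth_plateau plateau_eq_0)

lemma integral_plateau_pos: "(LINT x::real^'a|lborel. plateau x) > 0"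
proof (rule ccontr)
  assume "\<not> ?thesis"
  moreover have i: "integrable lborel (plateau :: real^'a \<Rightarrow> real)"
    by (rule integrable_compact_support[of _ 2])
      (auto simp: plateau_eq_0 elem_smooth_continuous elem_smooth_plateau)
  moreover have "0 \<le> (LINT x::real^'a|lborel. plateau x)"
    by (rule Bochner_Integration.integral_nonneg) (rule plateau_bounds)
  ultimately have "(LINT x::real^'a|lborel. plateau x) = 0" by simp
  then have "AE x::real^'a in lborel. plateau x = 0"
    using integral_nonneg_eq_0_iff_AE[OF i AE_I2[OF plateau_bounds(1)]] by blast
  then obtain y :: "real^'a" where "y \<in> ball 0 1" "plateau y = 0"
    by (rule AE_lebesgue_open_ex[OF _ _ AE_completion, of "ball 0 1" 0, rotated 2]) auto
  then show False using plateau_eq_1[of y] by simp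
qed

text \<open>If the integral were 0, so would be that of the transform of every translate of
  \<open>\<eta>\<close>. Integrating these identities against \<open>\<eta>\<close> gives the
  integral of |\<open>inv_fourier \<eta>\<close>|^2, so the transform would vanish, although its
  value at 0 is the integral of \<open>plateau\<close>.\<close>

lemma integral_inv_fourier_plateau_nonzero:
  "(LINT \<xi>::real^'n|lborel. inv_fourier (\<lambda>x. complex_of_real (plateau x)) \<xi>) \<noteq> 0"
proof
  define \<eta> where "\<eta> = (\<lambda>x::real^'n. complex_of_real (plateau x))"
  assume "(LINT \<xi>::real^'n|lborel. inv_fourier (\<lambda>x. complex_of_real (plateau x)) \<xi>) = 0"
  then have I\<eta>: "(LINT \<xi>|lborel. inv_fourier \<eta> \<xi>) = 0" by (simp add: \<eta>_def)
  have \<eta>: "test_function_on UNIV \<eta>" unfolding \<eta>_def by (rule test_function_plateau)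
  note [measurable] = test_function_measurable[OF \<eta>]
    borel_measurable_integrable[OF inv_fourier_integrable[OF \<eta>]]
  have I0: "(LINT \<xi>|lborel. cis (- (2 * pi * (y \<bullet> \<xi>))) * inv_fourier \<eta> \<xi>) = 0" for y
  proof -
    have "test_function_on UNIV (\<lambda>x. complex_of_real (plateau (1 *\<^sub>R x + y)))"
    proof (rule test_function_on_of_real[of _ "cball 0 (2 + norm y)"])
      fix x :: "real^'n" assume "x \<notin> cball 0 (2 + norm y)"
      moreover have "norm x \<le> norm (x + y) + norm y"
        by (metis add_diff_cancel_right' norm_triangle_ineq4)
      ultimately show "plateau (1 *\<^sub>R x + y) = 0"
        by (intro plateau_eq_0) simp
    qed (use elem_smooth_affine[OF elem_smooth_plateau, of 1 y] in auto)
    then have \<eta>y: "test_function_on UNIV (\<lambda>x. \<eta> (x + y))" by (simp add: \<eta>_def)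
    have "\<eta> 0 * (LINT \<xi>|lborel. inv_fourier (\<lambda>x. \<eta> (x + y)) \<xi>) = 0"
      using integral_inv_fourier_swap_at_0[OF \<eta>y \<eta>] I\<eta> by simp
    moreover have "\<eta> 0 = 1" by (simp add: \<eta>_def plateau_eq_1)
    ultimately show ?thesis by (simp add: inv_fourier_translate)
  qed
  define h where "h x \<xi> = \<eta> x * (cis (- (2 * pi * (x \<bullet> \<xi>))) * inv_fourier \<eta> \<xi>)" for x \<xi>
  have cis_meas: "(\<lambda>p. cis (- (2 * pi * (fst p \<bullet> snd p)))) \<in>
      borel_measurable ((lborel :: (real^'n) measure) \<Otimes>\<^sub>M (lborel :: (real^'n) measure))"
  proof -
    have "(\<lambda>p. cis (- (2 * pi * (fst p \<bullet> snd p)))) \<in> borel_measurable (borel :: ((real^'n) \<times> (real^'n)) measure)"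
      by (intro borel_measurable_continuous_onI continuous_intros)
    then show ?thesis by (simp add: lborel_prod)
  qed
  have "integrable (lborel \<Otimes>\<^sub>M lborel) (case_prod h)"
  proof (rule Bochner_Integration.integrable_bound)
    show "integrable (lborel \<Otimes>\<^sub>M lborel) (\<lambda>(x, \<xi>). \<eta> x * inv_fourier \<eta> \<xi>)"
      by (intro lborel_pair.Fubini_integrable)
        (auto simp: norm_mult intro!: integrable_mult_left integrable_mult_right integrable_norm
          test_function_integrable[OF \<eta>] inv_fourier_integrable[OF \<eta>])
    show "case_prod h \<in> borel_measurable (lborel \<Otimes>\<^sub>M lborel)"
      unfolding h_def case_prod_unfold using cis_meas by measurable
  qed (auto simp: h_def norm_mult)
  then have "(LINT \<xi>|lborel. LINT x|lborel. h x \<xi>) = (LINT x|lborel. LINT \<xi>|lborel. h x \<xi>)"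
    by (rule lborel_pair.Fubini_integral)
  also have "\<dots> = 0" by (simp add: h_def I0)
  finally have z: "(LINT \<xi>|lborel. LINT x|lborel. h x \<xi>) = 0" .
  have hx: "(LINT x|lborel. h x \<xi>) = complex_of_real ((norm (inv_fourier \<eta> \<xi>))\<^sup>2)" for \<xi>
  proof -
    \<comment> \<open>\<open>\<eta>\<close> is real, so reversing the sign in the exponent is
      complex conjugation.\<close>
    have "(LINT x|lborel. \<eta> x * cis (- (2 * pi * (x \<bullet> \<xi>)))) = cnj (inv_fourier \<eta> \<xi>)"
    proof -
      have "cnj (inv_fourier \<eta> \<xi>) = (LINT x|lborel. cnj (\<eta> x * cis (2 * pi * (x \<bullet> \<xi>))))"
        by (simp only: inv_fourier_lborel[OF test_function_measurable[OF \<eta>]] Bochner_Integration.integral_cnj)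
      then show ?thesis by (simp add: \<eta>_def cis_cnj)
    qed
    then show ?thesis
      unfolding h_def complex_norm_square
      by (simp add: mult.assoc[symmetric])
  qed
  from z have i0: "(LINT \<xi>|lborel. (norm (inv_fourier \<eta> \<xi>))\<^sup>2) = 0"
    unfolding hx integral_complex_of_real of_real_eq_0_iff .
  have "integrable lborel (\<lambda>\<xi>. (norm (inv_fourier \<eta> \<xi>))\<^sup>2)"
  proof (rule Bochner_Integration.integrable_bound)
    define B where "B = (LINT x|lborel. norm (\<eta> x))"
    show "integrable lborel (\<lambda>\<xi>. B * norm (inv_fourier \<eta> \<xi>))"
      using inv_fourier_integrable[OF \<eta>] by auto
    have "norm (inv_fourier \<eta> \<xi>) \<le> B" for \<xi>
      unfolding B_def by (rule norm_inv_fourier_le) auto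
    moreover have "B \<ge> 0" by (simp add: B_def)
    ultimately show "AE \<xi> in lborel. norm ((norm (inv_fourier \<eta> \<xi>))\<^sup>2) \<le> norm (B * norm (inv_fourier \<eta> \<xi>))"
      by (auto simp: power2_eq_square intro!: mult_right_mono)
  qed auto
  then have ae: "AE \<xi> in lborel. inv_fourier \<eta> \<xi> = 0"
    using integral_nonneg_eq_0_iff_AE[of lborel "\<lambda>\<xi>. (norm (inv_fourier \<eta> \<xi>))\<^sup>2"] i0 by auto
  have "open (inv_fourier \<eta> -` (- {0}))"
    by (intro open_vimage inv_fourier_continuous test_function_integrable[OF \<eta>]) auto
  moreover have "inv_fourier \<eta> 0 = of_real (LINT x::real^'n|lborel. plateau x)"
    by (simp add: inv_fourier_lborel) (simp add: \<eta>_def)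
  then have "inv_fourier \<eta> 0 \<noteq> 0" using integral_plateau_pos by (metis less_irrefl of_real_eq_0_iff)
  ultimately obtain \<xi> where "\<xi> \<in> inv_fourier \<eta> -` (- {0})" "inv_fourier \<eta> \<xi> = 0"
    using AE_lebesgue_open_ex[OF _ _ AE_completion[OF ae], of "inv_fourier \<eta> -` (- {0})" 0] by auto
  then show False by simp
qed

section \<open>Nonnegative kernels with a subquadratic symbol\<close>

text \<open>The properties that the argument needs, detached from \<open>\<rho>\<close>. The
  subquadratic condition is pointwise along rays; \<open>f_growth\<close> supplies the majorant that
  allows it to be integrated. Nothing is said about \<open>k 0\<close>.\<close>

locale symbol_kernel =
  fixes f k :: "real^'n \<Rightarrow> real"
  assumes f_continuous: "continuous_on UNIV f"
    and f_even: "f (- \<xi>) = f \<xi>"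
    and f_0: "f 0 = 0"
    and f_growth: "\<exists>C\<ge>0. \<forall>\<xi>. \<bar>f \<xi>\<bar> \<le> C * (1 + norm \<xi>)\<^sup>2"
    and f_subquadratic: "(\<lambda>m. f (real (Suc m) *\<^sub>R \<xi>) / (real (Suc m))\<^sup>2) \<longlonglongrightarrow> 0"
    and k_nonneg: "h \<noteq> 0 \<Longrightarrow> k h \<ge> 0"
    and k_loc_integrable: "loc_integrable_on k (- {0})"
    and k_pairing: "test_function_on (- {0}) \<phi> \<Longrightarrow>
      (LINT h|lebesgue. of_real (k h) * \<phi> h) = - (LINT \<xi>|lborel. of_real (f \<xi>) * inv_fourier \<phi> \<xi>)"
begin

section \<open>The distribution defined by the symbol\<close>

text \<open>\<open>T\<close> makes sense for test functions on the whole space, where a pairing with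
  \<open>k\<close> may diverge; \<open>k_pairing\<close> says that the two agree away from the
  origin. Bounds are proved for \<open>T\<close> on functions that do not vanish near 0 and reach
  \<open>k\<close> through differences.\<close>

definition T :: "(real^'n \<Rightarrow> complex) \<Rightarrow> complex"
  where "T \<phi> = - (LINT \<xi>|lborel. of_real (f \<xi>) * inv_fourier \<phi> \<xi>)"

definition growth :: real
  where "growth = (SOME C. C \<ge> 0 \<and> (\<forall>\<xi>. \<bar>f \<xi>\<bar> \<le> C * (1 + norm \<xi>)\<^sup>2))"

lemma growth: "growth \<ge> 0" "\<bar>f \<xi>\<bar> \<le> growth * (1 + norm \<xi>)\<^sup>2"
  using someI_ex[OF f_growth[unfolded Bex_def]] f_growth unfolding growth_def
  by (smt (verit, best) someI_ex)+

lemma f_measurable [measurable]: "f \<in> borel_measurable borel"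
  by (rule borel_measurable_continuous_onI[OF f_continuous])

lemma weight_integrable:
  fixes \<phi> :: "real^'n \<Rightarrow> complex"
  assumes \<phi>: "test_function_on U \<phi>"
  shows "integrable lborel (\<lambda>\<xi>. C * (1 + norm \<xi>)\<^sup>2 * norm (inv_fourier \<phi> \<xi>))"
proof -
  note [measurable] = borel_measurable_integrable[OF inv_fourier_integrable[OF \<phi>]]
  obtain B where B: "\<And>\<xi>. (1 + norm \<xi>) ^ (CARD('n) + 4) * norm (inv_fourier \<phi> \<xi>) \<le> B"
    using inv_fourier_decay[OF \<phi>] by metis
  have "integrable lborel (\<lambda>\<xi>. (1 + norm \<xi>)\<^sup>2 * norm (inv_fourier \<phi> \<xi>))"
  proof (rule integrable_decaying)
    fix \<xi> :: "real^'n"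
    have "(1 + norm \<xi>) ^ (DIM(real^'n) + 2) * norm ((1 + norm \<xi>)\<^sup>2 * norm (inv_fourier \<phi> \<xi>)) =
        (1 + norm \<xi>) ^ (CARD('n) + 4) * norm (inv_fourier \<phi> \<xi>)"
    proof -
      have e: "CARD('n) + 4 = (CARD('n) + 2) + 2" by simp
      have "x ^ (CARD('n) + 4) = x ^ (CARD('n) + 2) * x\<^sup>2" for x :: real
        unfolding e by (rule power_add)
      then show ?thesis by (simp only: abs_mult real_norm_def abs_norm_cancel abs_power2 DIM_cart DIM_real mult.assoc mult_1_right)
    qed
    also have "\<dots> \<le> B" by (rule B)
    finally show "(1 + norm \<xi>) ^ (DIM(real^'n) + 2) * norm ((1 + norm \<xi>)\<^sup>2 * norm (inv_fourier \<phi> \<xi>)) \<le> B" .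
  qed measurable
  then show ?thesis by (simp add: mult.assoc)
qed

lemma growth_integrable:
  fixes \<phi> :: "real^'n \<Rightarrow> complex"
  assumes \<phi>: "test_function_on U \<phi>" and p: "p \<in> borel_measurable borel"
    and bd: "\<And>\<xi>. \<bar>p \<xi>\<bar> \<le> C * (1 + norm \<xi>)\<^sup>2"
  shows "integrable lborel (\<lambda>\<xi>. complex_of_real (p \<xi>) * inv_fourier \<phi> \<xi>)"
proof (rule Bochner_Integration.integrable_bound[OF weight_integrable[OF \<phi>, of C]])
  note [measurable] = borel_measurable_integrable[OF inv_fourier_integrable[OF \<phi>]] p
  show "(\<lambda>\<xi>. complex_of_real (p \<xi>) * inv_fourier \<phi> \<xi>) \<in> borel_measurable lborel"
    by measurable
  have "norm (complex_of_real (p \<xi>) * inv_fourier \<phi> \<xi>) \<le> C * (1 + norm \<xi>)\<^sup>2 * norm (inv_fourier \<phi> \<xi>)" for \<xi>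
    using bd[of \<xi>] by (auto simp: norm_mult intro!: mult_right_mono)
  then show "AE \<xi> in lborel. norm (complex_of_real (p \<xi>) * inv_fourier \<phi> \<xi>) \<le>
      norm (C * (1 + norm \<xi>)\<^sup>2 * norm (inv_fourier \<phi> \<xi>))"
    by (intro AE_I2) (metis abs_ge_self order_trans real_norm_def)
qed

lemma T_integrable:
  "test_function_on U \<phi> \<Longrightarrow> integrable lborel (\<lambda>\<xi>. complex_of_real (f \<xi>) * inv_fourier \<phi> \<xi>)"
  using growth_integrable growth(2) f_measurable by blast

lemma inv_fourier_add:
  assumes "integrable lborel \<phi>" "integrable lborel \<psi>"
  shows "inv_fourier (\<lambda>x. \<phi> x + \<psi> x) \<xi> = inv_fourier \<phi> \<xi> + inv_fourier \<psi> \<xi>"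
proof -
  have [measurable]: "\<phi> \<in> borel_measurable borel" "\<psi> \<in> borel_measurable borel" using assms by auto
  show ?thesis
    using integrable_times_cis[OF assms(1)] integrable_times_cis[OF assms(2)]
    by (simp add: inv_fourier_lborel distrib_right)
qed

lemma inv_fourier_cmult: "inv_fourier (\<lambda>x. c * \<phi> x) \<xi> = c * inv_fourier \<phi> \<xi>"
  by (simp add: inv_fourier_def mult.assoc)

lemma T_add:
  assumes "test_function_on U \<phi>" "test_function_on V \<psi>"
  shows "T (\<lambda>x. \<phi> x + \<psi> x) = T \<phi> + T \<psi>"
  using T_integrable[OF assms(1)] T_integrable[OF assms(2)]
  by (simp add: T_def inv_fourier_add[OF test_function_integrable[OF assms(1)] test_function_integrable[OF assms(2)]]
      distrib_left)

lemma T_cmult: "T (\<lambda>x. c * \<phi> x) = c * T \<phi>"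
proof -
  have "T (\<lambda>x. c * \<phi> x) = - (LINT \<xi>|lborel. c * (of_real (f \<xi>) * inv_fourier \<phi> \<xi>))"
    by (simp add: T_def inv_fourier_cmult mult_ac)
  then show ?thesis by (simp add: T_def)
qed

lemma T_diff:
  assumes "test_function_on U \<phi>" "test_function_on V \<psi>"
  shows "T (\<lambda>x. \<phi> x - \<psi> x) = T \<phi> - T \<psi>"
proof -
  have "inv_fourier (\<lambda>x. \<phi> x - \<psi> x) \<xi> = inv_fourier \<phi> \<xi> - inv_fourier \<psi> \<xi>" for \<xi>
    using inv_fourier_add[OF test_function_integrable[OF assms(1)]
        integrable_mult_right[OF test_function_integrable[OF assms(2)], of "-1"], of \<xi>]
      inv_fourier_cmult[of "-1" \<psi> \<xi>] by simp
  then show ?thesis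
    using T_integrable[OF assms(1)] T_integrable[OF assms(2)]
    by (simp add: T_def right_diff_distrib)
qed

lemma T_scale:
  assumes "test_function_on U \<phi>" "s > 0"
  shows "T (\<lambda>x. \<phi> ((1 / s) *\<^sub>R x)) = - (LINT \<zeta>|lborel. of_real (f ((1 / s) *\<^sub>R \<zeta>)) * inv_fourier \<phi> \<zeta>)"
proof -
  note [measurable] = borel_measurable_integrable[OF inv_fourier_integrable[OF assms(1)]]
    test_function_measurable[OF assms(1)]
  have "(LINT \<zeta>|lborel. of_real (f ((1 / s) *\<^sub>R \<zeta>)) * inv_fourier \<phi> \<zeta>) =
      s ^ CARD('n) *\<^sub>R (LINT \<xi>|lborel. of_real (f \<xi>) * inv_fourier \<phi> (s *\<^sub>R \<xi>))"
    using integral_lborel_affine[of "\<lambda>\<zeta>. of_real (f ((1 / s) *\<^sub>R \<zeta>)) * inv_fourier \<phi> \<zeta>" s 0] assms(2)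
    by simp
  then show ?thesis
    using assms(2) by (simp add: T_def inv_fourier_scale flip: integral_scaleR_right)
qed

lemma f_dilated_le:
  assumes "c \<ge> 0"
  shows "\<bar>f (c *\<^sub>R \<zeta>)\<bar> \<le> growth * (1 + c)\<^sup>2 * (1 + norm \<zeta>)\<^sup>2"
proof -
  have "\<bar>f (c *\<^sub>R \<zeta>)\<bar> \<le> growth * (1 + norm (c *\<^sub>R \<zeta>))\<^sup>2" by (rule growth)
  also have "\<dots> \<le> growth * ((1 + c) * (1 + norm \<zeta>))\<^sup>2"
    using assms growth(1) by (intro mult_left_mono power_mono) (auto simp: algebra_simps)
  finally show ?thesis by (simp add: power_mult_distrib)
qed

text \<open>Concentrating a test function at scale s spreads its transform to frequencies of order
  1/s, where the symbol is at most of order (1/s)^2. For s >= 1 the bound is uniform.\<close>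

lemma T_scale_bound:
  assumes \<phi>: "test_function_on U \<phi>"
  obtains C where "C \<ge> 0" "\<And>s. s > 0 \<Longrightarrow> norm (T (\<lambda>x. \<phi> ((1 / s) *\<^sub>R x))) \<le> C * (1 + 1 / s)\<^sup>2"
proof -
  define C where "C = (LINT \<zeta>|lborel. growth * (1 + norm \<zeta>)\<^sup>2 * norm (inv_fourier \<phi> \<zeta>))"
  have "C \<ge> 0" unfolding C_def using growth(1) by (intro Bochner_Integration.integral_nonneg) auto
  moreover have "norm (T (\<lambda>x. \<phi> ((1 / s) *\<^sub>R x))) \<le> C * (1 + 1 / s)\<^sup>2" if s: "s > 0" for s
  proof -
    have "norm (T (\<lambda>x. \<phi> ((1 / s) *\<^sub>R x))) \<le>
        (LINT \<zeta>|lborel. norm (complex_of_real (f ((1 / s) *\<^sub>R \<zeta>)) * inv_fourier \<phi> \<zeta>))"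
      unfolding T_scale[OF \<phi> s] norm_minus_cancel by (rule integral_norm_bound)
    also have "\<dots> \<le> (LINT \<zeta>|lborel. growth * (1 + norm \<zeta>)\<^sup>2 * norm (inv_fourier \<phi> \<zeta>) * (1 + 1 / s)\<^sup>2)"
    proof (rule integral_mono)
      show "integrable lborel (\<lambda>\<zeta>. norm (complex_of_real (f ((1 / s) *\<^sub>R \<zeta>)) * inv_fourier \<phi> \<zeta>))"
        using s f_dilated_le[of "1 / s"]
        by (intro integrable_norm growth_integrable[OF \<phi>, where C="growth * (1 + 1 / s)\<^sup>2"]) auto
      show "integrable lborel (\<lambda>\<zeta>. growth * (1 + norm \<zeta>)\<^sup>2 * norm (inv_fourier \<phi> \<zeta>) * (1 + 1 / s)\<^sup>2)"
        by (intro integrable_mult_left weight_integrable[OF \<phi>])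
      show "norm (complex_of_real (f ((1 / s) *\<^sub>R \<zeta>)) * inv_fourier \<phi> \<zeta>) \<le>
          growth * (1 + norm \<zeta>)\<^sup>2 * norm (inv_fourier \<phi> \<zeta>) * (1 + 1 / s)\<^sup>2" for \<zeta>
        using mult_right_mono[OF f_dilated_le[of "1 / s" \<zeta>] norm_ge_zero[of "inv_fourier \<phi> \<zeta>"]] s
        by (simp add: norm_mult mult_ac)
    qed
    finally show ?thesis by (simp add: C_def)
  qed
  ultimately show ?thesis using that by blast
qed

section \<open>Pairing with the kernel away from the origin\<close>

lemma k_annulus_integrable:
  assumes "0 < r"
  shows "set_integrable lebesgue {h. r \<le> norm h \<and> norm h \<le> R} k"
proof -
  have "{h::real^'n. r \<le> norm h \<and> norm h \<le> R} = cball 0 R \<inter> (norm -` {r..})" by auto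
  moreover have "closed (norm -` {r..} :: (real^'n) set)"
    by (intro continuous_closed_vimage continuous_intros)
  ultimately have "compact {h::real^'n. r \<le> norm h \<and> norm h \<le> R}"
    by (metis compact_Int_closed compact_cball)
  then show ?thesis
    using k_loc_integrable assms unfolding loc_integrable_on_def by force
qed

lemma k_test_integrable:
  assumes "0 < r" "\<And>h. norm h \<le> r \<or> R \<le> norm h \<Longrightarrow> \<theta> h = 0"
    and "continuous_on UNIV \<theta>"
  shows "integrable lebesgue (\<lambda>h. k h * \<theta> h)"
proof -
  have "compact (\<theta> ` cball 0 R)" by (intro compact_continuous_image continuous_on_subset[OF assms(3)]) auto
  then obtain B where B: "\<And>h. h \<in> cball 0 R \<Longrightarrow> \<bar>\<theta> h\<bar> \<le> B"
    using compact_imp_bounded by (metis (no_types, lifting) bounded_iff image_eqI real_norm_def)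
  let ?A = "{h. r \<le> norm h \<and> norm h \<le> R}"
  have m: "\<theta> \<in> borel_measurable lebesgue"
    using borel_measurable_continuous_onI[OF assms(3)] by (simp add: measurable_completion)
  have i: "integrable lebesgue (\<lambda>h. B * (indicator ?A h *\<^sub>R k h))"
    using k_annulus_integrable[OF assms(1), of R] unfolding set_integrable_def by (intro integrable_mult_right)
  have eq: "k h * \<theta> h = (indicator ?A h *\<^sub>R k h) * \<theta> h" for h
    using assms(2)[of h] by (cases "h \<in> ?A") auto
  have "integrable lebesgue (\<lambda>h. (indicator ?A h *\<^sub>R k h) * \<theta> h)"
  proof (rule Bochner_Integration.integrable_bound[OF i])
    show "(\<lambda>h. (indicator ?A h *\<^sub>R k h) * \<theta> h) \<in> borel_measurable lebesgue"
      using k_annulus_integrable[OF assms(1), of R] unfolding set_integrable_def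
      by (intro borel_measurable_times m borel_measurable_integrable)
    have "\<bar>\<theta> h\<bar> \<le> \<bar>B\<bar>" if "h \<in> ?A" for h using B[of h] that by auto
    then show "AE h in lebesgue. norm ((indicator ?A h *\<^sub>R k h) * \<theta> h) \<le> norm (B * (indicator ?A h *\<^sub>R k h))"
      by (auto simp: indicator_def abs_mult mult.commute intro!: AE_I2 mult_right_mono)
  qed
  then show ?thesis unfolding eq .
qed

lemma test_function_punctured:
  fixes \<theta> :: "real^'n \<Rightarrow> real"
  assumes "elem_smooth \<theta>" "0 < r" "\<And>h. norm h < r \<or> R < norm h \<Longrightarrow> \<theta> h = 0"
  shows "test_function_on (- {0}) (\<lambda>h. complex_of_real (\<theta> h))"
proof (rule test_function_on_of_real[OF assms(1), of "{h. r \<le> norm h \<and> norm h \<le> R}"])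
  have "{h::real^'n. r \<le> norm h \<and> norm h \<le> R} = cball 0 R \<inter> (norm -` {r..})" by auto
  moreover have "closed (norm -` {r..} :: (real^'n) set)"
    by (intro continuous_closed_vimage continuous_intros)
  ultimately show "compact {h::real^'n. r \<le> norm h \<and> norm h \<le> R}"
    by (metis compact_Int_closed compact_cball)
qed (use assms in auto)

lemma k_pairing_real:
  assumes "elem_smooth \<theta>" "0 < r" "\<And>h. norm h < r \<or> R < norm h \<Longrightarrow> \<theta> h = 0"
  shows "complex_of_real (LINT h|lebesgue. k h * \<theta> h) = T (\<lambda>h. of_real (\<theta> h))"
  using k_pairing[OF test_function_punctured[OF assms]]
  by (simp add: T_def flip: of_real_mult)

lemma scaled_plateau_eq_1: "s > 0 \<Longrightarrow> norm h \<le> s \<Longrightarrow> plateau ((1 / s) *\<^sub>R h) = 1"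
  by (intro plateau_eq_1) simp

lemma scaled_plateau_eq_0: "s > 0 \<Longrightarrow> norm h \<ge> 2 * s \<Longrightarrow> plateau ((1 / s) *\<^sub>R h) = 0"
  by (intro plateau_eq_0) (simp add: pos_le_divide_eq)

lemma test_function_scaled_plateau:
  assumes "elem_smooth g" "s > 0"
  shows "test_function_on UNIV (\<lambda>h::real^'n. complex_of_real (g h * plateau ((1 / s) *\<^sub>R h)))"
  by (rule test_function_on_of_real[of _ "cball 0 (2 * s)"])
    (use assms in \<open>auto intro!: elem_smooth.mult elem_smooth_scale elem_smooth_plateau simp: scaled_plateau_eq_0\<close>)

text \<open>
  Testing against cutoffs of \<open>min 1 \<bar>h\<bar>\<^sup>2\<close> bounds the integral, since the pairing of a dilated
  test function grows at most quadratically under concentration.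
\<close>

lemma k_Levy_integrable: "integrable lebesgue (\<lambda>h. min 1 ((norm h)\<^sup>2) * k h)"
proof -
  define \<eta> where "\<eta> = (\<lambda>h::real^'n. complex_of_real (plateau h))"
  define \<psi> where "\<psi> = (\<lambda>h::real^'n. complex_of_real ((norm h)\<^sup>2 * plateau h))"
  have \<eta>: "test_function_on UNIV \<eta>" unfolding \<eta>_def by (rule test_function_plateau)
  have \<psi>: "test_function_on UNIV \<psi>"
    unfolding \<psi>_def using test_function_scaled_plateau[OF elem_smooth_norm_sq, of 1] by simp
  obtain C1 where C1: "C1 \<ge> 0" "\<And>s. s > 0 \<Longrightarrow> norm (T (\<lambda>x. \<eta> ((1 / s) *\<^sub>R x))) \<le> C1 * (1 + 1 / s)\<^sup>2"
    using T_scale_bound[OF \<eta>] by blast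
  obtain C2 where C2: "C2 \<ge> 0" "\<And>s. s > 0 \<Longrightarrow> norm (T (\<lambda>x. \<psi> ((1 / s) *\<^sub>R x))) \<le> C2 * (1 + 1 / s)\<^sup>2"
    using T_scale_bound[OF \<psi>] by blast
  \<comment> \<open>The first difference takes care of large |h|, the second of small |h|, and for 1
    < |h| < 2 their sum is still at least 1. Each vanishes near 0, so the pairing with
    \<open>k\<close> applies. The factor 2 in 2 (m + 1) makes the last cutoff vanish already for |h|
    >= 1/(m + 1).\<close>
  define \<theta> where "\<theta> m h = (plateau ((1 / real (m + 2)) *\<^sub>R h) - plateau h) +
    ((norm h)\<^sup>2 * plateau h - (norm h)\<^sup>2 * plateau (real (2 * (m + 1)) *\<^sub>R h))" for m and h :: "real^'n"
  define A where "A m = {h::real^'n. 1 / real (m + 1) \<le> norm h \<and> norm h \<le> real (m + 1)}" for m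
  define u where "u m h = indicator (A m) h * (min 1 ((norm h)\<^sup>2) * k h)" for m h
  have e: "plateau (real (2 * (m + 1)) *\<^sub>R h) = plateau ((1 / (1 / real (2 * (m + 1)))) *\<^sub>R h)" for m h
    by simp
  have small_0: "plateau (real (2 * (m + 1)) *\<^sub>R h) = 0" if "1 / real (m + 1) \<le> norm h" for m and h :: "real^'n"
  proof -
    have "2 * (1 / real (2 * (m + 1))) = 1 / real (m + 1)" by (simp add: field_simps)
    then show ?thesis unfolding e using that by (intro scaled_plateau_eq_0) simp_all
  qed
  have small_1: "plateau (real (2 * (m + 1)) *\<^sub>R h) = 1" if "norm h \<le> 1 / real (2 * (m + 1))" for m and h :: "real^'n"
    unfolding e using that by (intro scaled_plateau_eq_1) auto
  have le1: "1 / real (m + 1) \<le> 1" for m by simp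
  have \<theta>_smooth: "elem_smooth (\<theta> m)" for m
    unfolding \<theta>_def
    by (intro elem_smooth.add elem_smooth_diff elem_smooth.mult elem_smooth_scale elem_smooth_plateau
        elem_smooth_norm_sq)
  have \<theta>_supp: "\<theta> m h = 0" if "norm h \<le> 1 / real (2 * (m + 1)) \<or> 2 * real (m + 2) \<le> norm h" for m h
    using that
  proof
    assume h: "norm h \<le> 1 / real (2 * (m + 1))"
    have "1 / real (2 * (m + 1)) \<le> 1" by simp
    then have "norm h \<le> 1" "norm h \<le> real (m + 2)" using h by linarith+
    then show ?thesis
      using small_1[OF h] by (simp add: \<theta>_def plateau_eq_1 scaled_plateau_eq_1)
  next
    assume h: "2 * real (m + 2) \<le> norm h"
    moreover have "2 * real (m + 2) \<ge> 2" by simp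
    ultimately have "norm h \<ge> 2" "1 / real (m + 1) \<le> norm h"
      using le1[of m] by linarith+
    then show ?thesis
      using small_0[of m h] h by (simp add: \<theta>_def plateau_eq_0 scaled_plateau_eq_0)
  qed
  have \<theta>_ge: "indicator (A m) h * min 1 ((norm h)\<^sup>2) \<le> \<theta> m h" for m h
  proof -
    have 1: "plateau h \<le> plateau ((1 / real (m + 2)) *\<^sub>R h)"
      using scaled_plateau_eq_1[of "real (m + 2)" h] plateau_eq_0[of h] plateau_bounds[of h]
        plateau_bounds[of "(1 / real (m + 2)) *\<^sub>R h"]
      by (cases "norm h \<ge> 2") auto
    have 2: "plateau (real (2 * (m + 1)) *\<^sub>R h) \<le> plateau h"
      using order_trans[OF le1[of m], of "norm h"] small_0[of m h] plateau_eq_1[of h] plateau_bounds[of h]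
        plateau_bounds[of "real (2 * (m + 1)) *\<^sub>R h"]
      by (cases "norm h \<ge> 1") auto
    have nonneg: "0 \<le> \<theta> m h"
      using 1 mult_left_mono[OF 2, of "(norm h)\<^sup>2"] by (simp add: \<theta>_def)
    show ?thesis
    proof (cases "h \<in> A m")
      case True
      then have h: "1 / real (m + 1) \<le> norm h" "norm h \<le> real (m + 2)" by (auto simp: A_def)
      then have \<theta>: "\<theta> m h = 1 - plateau h + (norm h)\<^sup>2 * plateau h"
        using small_0[OF h(1)] scaled_plateau_eq_1[of "real (m + 2)" h] by (simp add: \<theta>_def)
      show ?thesis
      proof (cases "norm h \<le> 1")
        case True
        then show ?thesis using \<theta> plateau_eq_1[of h] nonneg by (auto simp: indicator_def)
      next
        case False
        then have "(norm h)\<^sup>2 \<ge> 1" by simp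
        then have "plateau h \<le> (norm h)\<^sup>2 * plateau h"
          using plateau_bounds(1)[of h] mult_right_mono[of 1 "(norm h)\<^sup>2" "plateau h"] by simp
        then show ?thesis using \<theta> nonneg by (auto simp: indicator_def)
      qed
    qed (use nonneg in auto)
  qed
  have \<theta>k: "integrable lebesgue (\<lambda>h. k h * \<theta> m h)" for m
    by (rule k_test_integrable[of "1 / real (2 * (m + 1))"])
      (use \<theta>_supp elem_smooth_continuous[OF \<theta>_smooth] in auto)
  have u_le: "u m h \<le> k h * \<theta> m h" for m h
    using mult_left_mono[OF \<theta>_ge[of m h] k_nonneg[of h]] by (cases "h = 0") (auto simp: u_def A_def mult_ac \<theta>_def)
  have \<theta>_bound: "(LINT h|lebesgue. k h * \<theta> m h) \<le> 4 * C1 + norm (T \<eta>) + norm (T \<psi>) + 4 * C2" for m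
  proof -
    define R where "R = real (m + 2)"
    define e where "e = 1 / real (2 * (m + 1))"
    have Re: "R > 0" "1 / R \<le> 1" "e > 0" "e \<le> 1" "1 / e = real (2 * (m + 1))" by (auto simp: R_def e_def)
    have \<eta>R: "test_function_on UNIV (\<lambda>h. \<eta> ((1 / R) *\<^sub>R h))"
      using test_function_scaled_plateau[OF elem_smooth.const Re(1), of 1] by (simp add: \<eta>_def)
    \<comment> \<open>\<open>\<psi>\<close> has the weight |h|^2 built in, so dilating it needs the
      factor e^2 to restore that weight. This factor offsets the growth in
      \<open>T_scale_bound\<close>: e^2 (1 + 1/e)^2 = (1 + e)^2 <= 4.\<close>
    have \<psi>e: "test_function_on UNIV (\<lambda>h. of_real (e\<^sup>2) * \<psi> ((1 / e) *\<^sub>R h))"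
      using test_function_scaled_plateau[OF elem_smooth_norm_sq Re(3)] Re(3)
      by (simp add: \<psi>_def power_divide)
    have eq: "complex_of_real (\<theta> m h) = (\<eta> ((1 / R) *\<^sub>R h) - \<eta> h) + (\<psi> h - of_real (e\<^sup>2) * \<psi> ((1 / e) *\<^sub>R h))" for h
      unfolding \<theta>_def \<eta>_def \<psi>_def R_def[symmetric] Re(5)[symmetric]
      using Re(3) by (simp add: power_divide)
    have t1: "test_function_on UNIV (\<lambda>h. \<eta> ((1 / R) *\<^sub>R h) - \<eta> h)"
    proof -
      have "test_function_on UNIV (\<lambda>h::real^'n. complex_of_real (plateau ((1 / R) *\<^sub>R h) - plateau h))"
      proof (rule test_function_on_of_real[of _ "cball 0 (2 * R)"])
        show "elem_smooth (\<lambda>h::real^'n. plateau ((1 / R) *\<^sub>R h) - plateau h)"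
          by (intro elem_smooth_diff elem_smooth_scale elem_smooth_plateau)
        fix h :: "real^'n" assume "h \<notin> cball 0 (2 * R)"
        then have "norm h \<ge> 2 * R" by simp
        moreover have "2 * R \<ge> 2" by (simp add: R_def)
        ultimately show "plateau ((1 / R) *\<^sub>R h) - plateau h = 0"
          using scaled_plateau_eq_0[OF Re(1), of h] plateau_eq_0[of h] by simp
      qed auto
      then show ?thesis by (simp add: \<eta>_def)
    qed
    have t2: "test_function_on UNIV (\<lambda>h. \<psi> h - of_real (e\<^sup>2) * \<psi> ((1 / e) *\<^sub>R h))"
    proof -
      have "test_function_on UNIV (\<lambda>h::real^'n. complex_of_real ((norm h)\<^sup>2 * plateau h - (norm h)\<^sup>2 * plateau ((1 / e) *\<^sub>R h)))"
      proof (rule test_function_on_of_real[of _ "cball 0 2"])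
        show "elem_smooth (\<lambda>h::real^'n. (norm h)\<^sup>2 * plateau h - (norm h)\<^sup>2 * plateau ((1 / e) *\<^sub>R h))"
          by (intro elem_smooth_diff elem_smooth.mult elem_smooth_norm_sq elem_smooth_scale elem_smooth_plateau)
        fix h :: "real^'n" assume "h \<notin> cball 0 2"
        then have "norm h \<ge> 2" "norm h \<ge> 2 * e" using Re(4) by auto
        then show "(norm h)\<^sup>2 * plateau h - (norm h)\<^sup>2 * plateau ((1 / e) *\<^sub>R h) = 0"
          using scaled_plateau_eq_0[OF Re(3), of h] plateau_eq_0[of h] by simp
      qed auto
      then show ?thesis using Re(3) by (simp add: \<psi>_def power_divide)
    qed
    have "complex_of_real (LINT h|lebesgue. k h * \<theta> m h) = T (\<lambda>h. of_real (\<theta> m h))"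
      by (rule k_pairing_real[OF \<theta>_smooth, of "1 / real (2 * (m + 1))" "2 * real (m + 2)"]) (use \<theta>_supp in auto)
    also have "\<dots> = (T (\<lambda>h. \<eta> ((1 / R) *\<^sub>R h)) - T \<eta>) + (T \<psi> - of_real (e\<^sup>2) * T (\<lambda>h. \<psi> ((1 / e) *\<^sub>R h)))"
      unfolding eq T_add[OF t1 t2] T_diff[OF \<eta>R \<eta>] T_diff[OF \<psi> \<psi>e] T_cmult ..
    finally have "\<bar>LINT h|lebesgue. k h * \<theta> m h\<bar> =
        norm ((T (\<lambda>h. \<eta> ((1 / R) *\<^sub>R h)) - T \<eta>) + (T \<psi> - of_real (e\<^sup>2) * T (\<lambda>h. \<psi> ((1 / e) *\<^sub>R h))))"
      by (metis norm_of_real)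
    also have "\<dots> \<le> norm (T (\<lambda>h. \<eta> ((1 / R) *\<^sub>R h))) + norm (T \<eta>) +
        (norm (T \<psi>) + e\<^sup>2 * norm (T (\<lambda>h. \<psi> ((1 / e) *\<^sub>R h))))"
      by (intro order_trans[OF norm_triangle_ineq] add_mono order_trans[OF norm_triangle_ineq4])
        (auto simp: norm_mult norm_power)
    also have "\<dots> \<le> C1 * (1 + 1)\<^sup>2 + norm (T \<eta>) + (norm (T \<psi>) + C2 * (1 + 1)\<^sup>2)"
    proof (intro add_mono order_refl)
      show "norm (T (\<lambda>h. \<eta> ((1 / R) *\<^sub>R h))) \<le> C1 * (1 + 1)\<^sup>2"
        using C1(2)[OF Re(1)] Re C1(1)
        by (elim order_trans) (intro mult_left_mono power_mono add_mono, auto)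
      have "e\<^sup>2 * norm (T (\<lambda>h. \<psi> ((1 / e) *\<^sub>R h))) \<le> e\<^sup>2 * (C2 * (1 + 1 / e)\<^sup>2)"
        by (intro mult_left_mono C2(2) Re) simp
      also have "\<dots> = C2 * (e * (1 + 1 / e))\<^sup>2" by (simp add: power_mult_distrib)
      also have "e * (1 + 1 / e) = 1 + e" using Re(3) by (simp add: distrib_left)
      also have "C2 * (1 + e)\<^sup>2 \<le> C2 * (1 + 1)\<^sup>2"
        using Re C2(1) by (intro mult_left_mono power_mono) auto
      finally show "e\<^sup>2 * norm (T (\<lambda>h. \<psi> ((1 / e) *\<^sub>R h))) \<le> C2 * (1 + 1)\<^sup>2" .
    qed
    finally show ?thesis by simp
  qed
  have u_int: "integrable lebesgue (u m)" for m
  proof -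
    have i: "integrable lebesgue (\<lambda>h. indicator (A m) h *\<^sub>R k h)"
      using k_annulus_integrable[of "1 / real (m + 1)" "real (m + 1)"] by (simp add: set_integrable_def A_def)
    have "integrable lebesgue (\<lambda>h. min 1 ((norm h)\<^sup>2) * (indicator (A m) h *\<^sub>R k h))"
    proof (rule Bochner_Integration.integrable_bound[OF i])
      have "(\<lambda>h::real^'n. min 1 ((norm h)\<^sup>2)) \<in> borel_measurable borel" by measurable
      then have "(\<lambda>h::real^'n. min 1 ((norm h)\<^sup>2)) \<in> borel_measurable lebesgue" by (simp add: measurable_completion)
      then show "(\<lambda>h. min 1 ((norm h)\<^sup>2) * (indicator (A m) h *\<^sub>R k h)) \<in> borel_measurable lebesgue"
        using borel_measurable_integrable[OF i] by (intro borel_measurable_times)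
    qed (auto intro!: AE_I2 mult_left_le_one_le simp: abs_mult)
    then show ?thesis by (simp add: u_def[abs_def] mult_ac)
  qed
  have u_mono: "mono (\<lambda>m. u m h)" for h
  proof (rule incseq_SucI)
    fix m
    have "1 / real (Suc m + 1) \<le> 1 / real (m + 1)" by (intro divide_left_mono) auto
    then have "h \<in> A m \<Longrightarrow> h \<in> A (Suc m)"
      unfolding A_def by auto
    moreover have "h \<in> A (Suc m) \<Longrightarrow> k h \<ge> 0"
      by (rule k_nonneg) (auto simp: A_def)
    ultimately show "u m h \<le> u (Suc m) h"
      by (auto simp: u_def indicator_def)
  qed
  have u_lim: "(\<lambda>m. u m h) \<longlonglongrightarrow> min 1 ((norm h)\<^sup>2) * k h" for h
  proof (cases "h = 0")
    case False
    then obtain m1 where m1: "1 / real (Suc m1) < norm h"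
      using reals_Archimedean[of "norm h"] by (auto simp: inverse_eq_divide)
    obtain m2 where m2: "norm h < real m2" using reals_Archimedean2 by blast
    have "\<forall>\<^sub>F m in sequentially. u m h = min 1 ((norm h)\<^sup>2) * k h"
      using eventually_ge_at_top[of "max m1 m2"]
    proof eventually_elim
      case (elim m)
      have "1 / real (m + 1) \<le> 1 / real (Suc m1)" using elim by (intro divide_left_mono) auto
      then have "h \<in> A m" using m1 m2 elim unfolding A_def by auto
      then show ?case by (simp add: u_def)
    qed
    then show ?thesis by (rule tendsto_eventually)
  qed (simp add: u_def)
  have inc: "incseq (\<lambda>m. LINT h|lebesgue. u m h)"
    using u_mono by (intro incseq_SucI integral_mono u_int) (auto dest: incseq_SucD)
  have "(LINT h|lebesgue. u m h) \<le> 4 * C1 + norm (T \<eta>) + norm (T \<psi>) + 4 * C2" for m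
    by (rule order_trans[OF integral_mono[OF u_int \<theta>k u_le] \<theta>_bound])
  then obtain L where L: "(\<lambda>m. LINT h|lebesgue. u m h) \<longlonglongrightarrow> L"
    using incseq_convergent[OF inc] by blast
  have "(\<lambda>h. min 1 ((norm h)\<^sup>2) * k h) \<in> borel_measurable lebesgue"
    by (rule borel_measurable_LIMSEQ_real[OF u_lim]) (use u_int in auto)
  then show ?thesis
    by (intro integrable_monotone_convergence[where f=u and x=L, OF u_int _ _ L] AE_I2 u_mono u_lim)
qed


section \<open>Vanishing first moments\<close>

text \<open>The transform of an odd function is odd and \<open>f\<close> is even, so the integrand
  is odd.\<close>

lemma T_odd:
  assumes "\<And>h. \<theta> (- h) = - \<theta> h" "integrable lborel \<theta>"
  shows "T \<theta> = 0"
proof -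
  have m [measurable]: "\<theta> \<in> borel_measurable borel" using assms(2) by auto
  have ft: "inv_fourier \<theta> (- \<xi>) = - inv_fourier \<theta> \<xi>" for \<xi>
  proof -
    have "inv_fourier \<theta> (- \<xi>) = (LINT x|lborel. \<theta> (- x) * cis (2 * pi * ((- x) \<bullet> (- \<xi>))))"
      unfolding inv_fourier_lborel[OF m]
      by (rule integral_lborel_uminus[symmetric]) measurable
    then show ?thesis
      by (simp add: assms(1) inv_fourier_lborel[OF m])
  qed
  have "inv_fourier \<theta> \<in> borel_measurable borel"
    by (rule borel_measurable_continuous_onI[OF inv_fourier_continuous[OF assms(2)]])
  then have "(LINT \<xi>|lborel. of_real (f (- \<xi>)) * inv_fourier \<theta> (- \<xi>)) = (LINT \<xi>|lborel. of_real (f \<xi>) * inv_fourier \<theta> \<xi>)"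
    by (intro integral_lborel_uminus) measurable
  then show ?thesis by (simp add: T_def ft f_even)
qed

text \<open>\<open>k\<close> itself is not assumed to be even; evenness enters through
  \<open>T\<close>. A linear form times a radial cutoff is an odd test function, on which
  \<open>T\<close> vanishes, and the cutoffs tend to the indicator of the open annulus.\<close>

lemma k_first_moment_annulus:
  assumes "0 < r"
  shows "(LINT h:{h. r < norm h \<and> norm h < R}|lebesgue. (a \<bullet> h) * k h) = 0"
proof (cases "r \<le> R")
  case True
  define \<theta> where "\<theta> m h = (a \<bullet> h) * annulus_cutoff r R m h" for m h
  have supp: "\<theta> m h = 0" if "norm h \<le> r \<or> R \<le> norm h" for m h
    using annulus_cutoff_eq_0[of r R h m] assms True that by (simp add: \<theta>_def)
  have smooth: "elem_smooth (\<theta> m)" for m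
    unfolding \<theta>_def by (intro elem_smooth.mult elem_smooth_inner elem_smooth_annulus_cutoff)
  have int: "integrable lebesgue (\<lambda>h. k h * \<theta> m h)" for m
    by (rule k_test_integrable[OF assms]) (use supp elem_smooth_continuous[OF smooth] in auto)
  have "complex_of_real (LINT h|lebesgue. k h * \<theta> m h) = T (\<lambda>h. of_real (\<theta> m h))" for m
    by (rule k_pairing_real[OF smooth assms, of R]) (use supp in auto)
  also have "T (\<lambda>h. of_real (\<theta> m h)) = 0" for m
  proof (rule T_odd)
    show "integrable lborel (\<lambda>h. complex_of_real (\<theta> m h))"
      by (rule test_function_integrable[OF test_function_punctured[OF smooth assms, of R]])
        (use supp in auto)
  qed (simp add: \<theta>_def annulus_cutoff_def)
  finally have zero: "(LINT h|lebesgue. k h * \<theta> m h) = 0" for m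
    by (metis of_real_eq_0_iff)
  let ?A = "{h. r \<le> norm h \<and> norm h \<le> R}"
  have "(\<lambda>m. LINT h|lebesgue. k h * \<theta> m h) \<longlonglongrightarrow>
      (LINT h|lebesgue. k h * ((a \<bullet> h) * (if r < norm h \<and> norm h < R then 1 else 0)))"
  proof (rule integral_dominated_convergence[where w="\<lambda>h. norm a * R * norm (indicator ?A h *\<^sub>R k h)"])
    show "(\<lambda>h. k h * \<theta> m h) \<in> borel_measurable lebesgue" for m using int by auto
    have lim: "(\<lambda>m. k h * \<theta> m h) \<longlonglongrightarrow>
        k h * ((a \<bullet> h) * (if r < norm h \<and> norm h < R then 1 else 0))" for h
      unfolding \<theta>_def using assms True
      by (intro tendsto_mult tendsto_const annulus_cutoff_tendsto) auto
    then show "AE h in lebesgue. (\<lambda>m. k h * \<theta> m h) \<longlonglongrightarrow>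
        k h * ((a \<bullet> h) * (if r < norm h \<and> norm h < R then 1 else 0))"
      by (intro AE_I2)
    show "(\<lambda>h. k h * ((a \<bullet> h) * (if r < norm h \<and> norm h < R then 1 else 0))) \<in> borel_measurable lebesgue"
      by (rule borel_measurable_LIMSEQ_metric[where f="\<lambda>m h. k h * \<theta> m h"])
        (use int lim in auto)
    show "integrable lebesgue (\<lambda>h. norm a * R * norm (indicator ?A h *\<^sub>R k h))"
      using k_annulus_integrable[OF assms, of R] unfolding set_integrable_def
      by (intro integrable_mult_right integrable_norm)
    show "AE h in lebesgue. norm (k h * \<theta> m h) \<le> norm a * R * norm (indicator ?A h *\<^sub>R k h)" for m
    proof (intro AE_I2)
      fix h
      show "norm (k h * \<theta> m h) \<le> norm a * R * norm (indicator ?A h *\<^sub>R k h)"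
      proof (cases "h \<in> ?A")
        case True
        have "\<bar>\<theta> m h\<bar> \<le> \<bar>a \<bullet> h\<bar> * 1"
          using annulus_cutoff_bounds[of r R m h] unfolding \<theta>_def abs_mult by (intro mult_left_mono) auto
        also have "\<dots> \<le> norm a * norm h" using Cauchy_Schwarz_ineq2 by simp
        also have "\<dots> \<le> norm a * R" using True by (intro mult_left_mono) auto
        finally have "\<bar>k h\<bar> * \<bar>\<theta> m h\<bar> \<le> \<bar>k h\<bar> * (norm a * R)" by (intro mult_left_mono) auto
        then show ?thesis using True by (simp add: abs_mult mult_ac)
      next
        case False
        then show ?thesis using supp[of h m] by auto
      qed
    qed
  qed
  then have "(LINT h|lebesgue. k h * ((a \<bullet> h) * (if r < norm h \<and> norm h < R then 1 else 0))) = 0"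
    unfolding zero by (simp add: LIMSEQ_const_iff)
  moreover have "(LINT h:{h. r < norm h \<and> norm h < R}|lebesgue. (a \<bullet> h) * k h) =
      (LINT h|lebesgue. k h * ((a \<bullet> h) * (if r < norm h \<and> norm h < R then 1 else 0)))"
    unfolding set_lebesgue_integral_def by (intro Bochner_Integration.integral_cong) auto
  ultimately show ?thesis by simp
next
  case False
  then have "{h::real^'n. r < norm h \<and> norm h < R} = {}" by auto
  then show ?thesis by (simp only: set_lebesgue_integral_def) simp
qed

end

section \<open>Nontriviality of the kernel\<close>

context symbol_kernel
begin

text \<open>
  If \<open>k\<close> vanished, \<open>T\<close> would give the same value on all functions \<open>(1 - cos (2 \<pi> b\<cdot>h)) plateau (h / s)\<close>.
  As \<open>s\<close> grows these values tend to a nonzero multiple of \<open>f b\<close>; as \<open>s\<close> shrinks they tend to \<open>0\<close>,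
  because \<open>f\<close> is subquadratic.
\<close>

lemma k_nonzero:
  assumes "f b \<noteq> 0"
  shows "\<not> (AE h in lebesgue. k h = 0)"
proof
  assume k0: "AE h in lebesgue. k h = 0"
  define \<eta> where "\<eta> = (\<lambda>h::real^'n. complex_of_real (plateau h))"
  have \<eta>: "test_function_on UNIV \<eta>" unfolding \<eta>_def by (rule test_function_plateau)
  have g_cont: "continuous_on A (inv_fourier \<eta>)" for A
    by (rule inv_fourier_continuous[OF test_function_integrable[OF \<eta>]])
  have [measurable]: "inv_fourier \<eta> \<in> borel_measurable borel"
    by (rule borel_measurable_continuous_onI[OF g_cont])
  define \<theta> where "\<theta> s h = plateau ((1 / s) *\<^sub>R h) - cos (2 * pi * (b \<bullet> h)) * plateau ((1 / s) *\<^sub>R h)"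
    for s and h :: "real^'n"
  define V where "V s = T (\<lambda>h. of_real (\<theta> s h))" for s
  have \<theta>_smooth: "elem_smooth (\<theta> s)" for s
    unfolding \<theta>_def
    by (intro elem_smooth_diff elem_smooth.mult elem_smooth_cos elem_smooth.const elem_smooth_inner
        elem_smooth_scale elem_smooth_plateau)
  have \<theta>_test: "test_function_on UNIV (\<lambda>h. complex_of_real (\<theta> s h))" if "s > 0" for s
    by (rule test_function_on_of_real[OF \<theta>_smooth, of "cball 0 (2 * s)"])
      (use that in \<open>auto simp: \<theta>_def scaled_plateau_eq_0\<close>)
  \<comment> \<open>The two functions agree for |h| < s', where both cutoffs are 1, so their
    difference can be paired with \<open>k\<close>; since \<open>k\<close> is null, the result is
    0.\<close>
  have V_const: "V s = V s'" if s: "0 < s'" "s' \<le> s" for s s'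
  proof -
    have "complex_of_real (LINT h|lebesgue. k h * (\<theta> s h - \<theta> s' h)) = T (\<lambda>h. of_real (\<theta> s h - \<theta> s' h))"
    proof (rule k_pairing_real[of _ s' "2 * s"])
      show "elem_smooth (\<lambda>h. \<theta> s h - \<theta> s' h)" by (intro elem_smooth_diff \<theta>_smooth)
      fix h :: "real^'n" assume h: "norm h < s' \<or> 2 * s < norm h"
      show "\<theta> s h - \<theta> s' h = 0"
      proof (cases "norm h < s'")
        case True
        then show ?thesis using s by (simp add: \<theta>_def scaled_plateau_eq_1)
      next
        case False
        then show ?thesis using s h by (simp add: \<theta>_def scaled_plateau_eq_0)
      qed
    qed (use s in auto)
    moreover have "(LINT h|lebesgue. k h * (\<theta> s h - \<theta> s' h)) = 0"
      by (rule integral_eq_zero_AE) (use k0 in auto)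
    ultimately show ?thesis
      using T_diff[OF \<theta>_test \<theta>_test, of s s'] s by (simp add: V_def)
  qed
  \<comment> \<open>Modulation by the cosine averages the transform over the shifts by b and -b, and
    the dilation turns them into shifts by s b. The symbol is then read at frequency
    \<xi>/s.\<close>
  have V_eq: "V s = - (LINT \<xi>|lborel. of_real (f ((1 / s) *\<^sub>R \<xi>)) *
      (inv_fourier \<eta> \<xi> - (inv_fourier \<eta> (\<xi> + s *\<^sub>R b) + inv_fourier \<eta> (\<xi> - s *\<^sub>R b)) / 2))"
    if s: "s > 0" for s
  proof -
    have \<eta>s: "test_function_on UNIV (\<lambda>h. \<eta> ((1 / s) *\<^sub>R h))"
      using test_function_scaled_plateau[OF elem_smooth.const s, of 1] by (simp add: \<eta>_def)
    have "test_function_on UNIV (\<lambda>h. complex_of_real (cos (2 * pi * (b \<bullet> h)) * plateau ((1 / s) *\<^sub>R h)))"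
      by (intro test_function_scaled_plateau s elem_smooth_cos elem_smooth.mult elem_smooth.const elem_smooth_inner)
    then have c\<eta>s: "test_function_on UNIV (\<lambda>h. of_real (cos (2 * pi * (b \<bullet> h))) * \<eta> ((1 / s) *\<^sub>R h))"
      by (simp add: \<eta>_def)
    have ft: "inv_fourier (\<lambda>h. of_real (\<theta> s h)) \<xi> = s ^ CARD('n) *\<^sub>R
        (inv_fourier \<eta> (s *\<^sub>R \<xi>) - (inv_fourier \<eta> (s *\<^sub>R \<xi> + s *\<^sub>R b) + inv_fourier \<eta> (s *\<^sub>R \<xi> - s *\<^sub>R b)) / 2)" for \<xi>
    proof -
      have "inv_fourier (\<lambda>h. of_real (\<theta> s h)) \<xi> = inv_fourier (\<lambda>h. \<eta> ((1 / s) *\<^sub>R h)) \<xi> -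
          inv_fourier (\<lambda>h. of_real (cos (2 * pi * (b \<bullet> h))) * \<eta> ((1 / s) *\<^sub>R h)) \<xi>"
        using inv_fourier_add[OF test_function_integrable[OF \<eta>s]
            integrable_mult_right[OF test_function_integrable[OF c\<eta>s], of "-1"], of \<xi>]
          inv_fourier_cmult[of "-1" _ \<xi>]
        by (simp add: \<theta>_def \<eta>_def)
      also have "\<dots> = s ^ CARD('n) *\<^sub>R inv_fourier \<eta> (s *\<^sub>R \<xi>) -
          (s ^ CARD('n) *\<^sub>R inv_fourier \<eta> (s *\<^sub>R (\<xi> + b)) + s ^ CARD('n) *\<^sub>R inv_fourier \<eta> (s *\<^sub>R (\<xi> - b))) / 2"
        by (simp add: inv_fourier_modulate[OF test_function_integrable[OF \<eta>s]]
            inv_fourier_scale[OF test_function_measurable[OF \<eta>] s])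
      finally show ?thesis
        by (simp add: scaleR_add_right scaleR_diff_right scaleR_conv_of_real field_simps)
    qed
    let ?g = "\<lambda>\<zeta>. of_real (f ((1 / s) *\<^sub>R \<zeta>)) *
      (inv_fourier \<eta> \<zeta> - (inv_fourier \<eta> (\<zeta> + s *\<^sub>R b) + inv_fourier \<eta> (\<zeta> - s *\<^sub>R b)) / 2)"
    have "(LINT \<zeta>|lborel. ?g \<zeta>) = s ^ CARD('n) *\<^sub>R (LINT \<xi>|lborel. ?g (s *\<^sub>R \<xi>))"
      using integral_lborel_affine[of ?g s 0] s by simp
    then show ?thesis
      using s by (simp add: V_def T_def ft flip: integral_scaleR_right)
  qed
  \<comment> \<open>Large scales: translating the variable by s c turns the dilated symbol into
    f(\<zeta>/s + c), which tends to f(c). The unshifted term contributes f(0) = 0, and the shifts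
    by b and -b both contribute f(b) by evenness.\<close>
  have "(\<lambda>m. V (real (Suc m))) \<longlonglongrightarrow> of_real (f b) * (LINT \<zeta>|lborel. inv_fourier \<eta> \<zeta>)"
  proof -
    have lim: "(\<lambda>m. LINT \<zeta>|lborel. of_real (f ((1 / real (Suc m)) *\<^sub>R \<zeta> + c)) * inv_fourier \<eta> \<zeta>) \<longlonglongrightarrow>
        (LINT \<zeta>|lborel. of_real (f c) * inv_fourier \<eta> \<zeta>)"
      and int: "integrable lborel (\<lambda>\<zeta>. complex_of_real (f ((1 / real (Suc m)) *\<^sub>R \<zeta> + c)) * inv_fourier \<eta> \<zeta>)" for c m
    proof -
      define C where "C = growth * (1 + norm c)\<^sup>2"
      have bd: "\<bar>f ((1 / real (Suc m)) *\<^sub>R \<zeta> + c)\<bar> \<le> C * (1 + norm \<zeta>)\<^sup>2" for m \<zeta>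
      proof -
        have "norm ((1 / real (Suc m)) *\<^sub>R \<zeta> + c) \<le> norm ((1 / real (Suc m)) *\<^sub>R \<zeta>) + norm c"
          by (rule norm_triangle_ineq)
        moreover have "norm ((1 / real (Suc m)) *\<^sub>R \<zeta>) \<le> norm \<zeta>"
          by (simp add: divide_le_eq mult_le_cancel_left1)
        moreover have "0 \<le> norm c * norm \<zeta>" by simp
        ultimately have "1 + norm ((1 / real (Suc m)) *\<^sub>R \<zeta> + c) \<le> (1 + norm c) * (1 + norm \<zeta>)"
          unfolding distrib_left distrib_right by linarith
        then have "growth * (1 + norm ((1 / real (Suc m)) *\<^sub>R \<zeta> + c))\<^sup>2 \<le> growth * ((1 + norm c) * (1 + norm \<zeta>))\<^sup>2"
          by (intro mult_left_mono power_mono growth(1)) auto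
        with growth(2)[of "(1 / real (Suc m)) *\<^sub>R \<zeta> + c"] show ?thesis
          by (simp add: C_def power_mult_distrib)
      qed
      show "integrable lborel (\<lambda>\<zeta>. complex_of_real (f ((1 / real (Suc m)) *\<^sub>R \<zeta> + c)) * inv_fourier \<eta> \<zeta>)"
        by (rule growth_integrable[OF \<eta> _ bd]) measurable
      show "(\<lambda>m. LINT \<zeta>|lborel. of_real (f ((1 / real (Suc m)) *\<^sub>R \<zeta> + c)) * inv_fourier \<eta> \<zeta>) \<longlonglongrightarrow>
          (LINT \<zeta>|lborel. of_real (f c) * inv_fourier \<eta> \<zeta>)"
      proof (rule integral_dominated_convergence[OF _ _ weight_integrable[OF \<eta>, of C]])
        have "continuous_on UNIV (\<lambda>\<zeta>. f (\<zeta> + c))"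
          by (intro continuous_on_compose2[OF f_continuous] continuous_intros) auto
        then have "(\<lambda>m. f ((1 / real (Suc m)) *\<^sub>R \<zeta> + c)) \<longlonglongrightarrow> f c" for \<zeta>
          using scaled_argument_tendsto[of "\<lambda>\<zeta>. f (\<zeta> + c)" \<zeta>] by simp
        then show "AE \<zeta> in lborel. (\<lambda>m. complex_of_real (f ((1 / real (Suc m)) *\<^sub>R \<zeta> + c)) * inv_fourier \<eta> \<zeta>) \<longlonglongrightarrow>
            of_real (f c) * inv_fourier \<eta> \<zeta>"
          by (intro AE_I2 tendsto_mult tendsto_of_real tendsto_const)
        show "AE \<zeta> in lborel. norm (complex_of_real (f ((1 / real (Suc m)) *\<^sub>R \<zeta> + c)) * inv_fourier \<eta> \<zeta>) \<le>
            C * (1 + norm \<zeta>)\<^sup>2 * norm (inv_fourier \<eta> \<zeta>)" for m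
          unfolding norm_mult norm_of_real by (intro AE_I2 mult_right_mono bd) auto
      qed measurable
    qed
    define L where "L c m = (LINT \<zeta>|lborel. complex_of_real (f ((1 / real (Suc m)) *\<^sub>R \<zeta> + c)) * inv_fourier \<eta> \<zeta>)" for c m
    have shift: "(LINT \<zeta>|lborel. complex_of_real (f ((1 / real (Suc m)) *\<^sub>R \<zeta>)) * inv_fourier \<eta> (\<zeta> - real (Suc m) *\<^sub>R c)) = L c m"
      and shift_int: "integrable lborel (\<lambda>\<zeta>. complex_of_real (f ((1 / real (Suc m)) *\<^sub>R \<zeta>)) * inv_fourier \<eta> (\<zeta> - real (Suc m) *\<^sub>R c))"
      for c m
    proof -
      define G where "G = (\<lambda>\<zeta>. complex_of_real (f ((1 / real (Suc m)) *\<^sub>R \<zeta>)) * inv_fourier \<eta> (\<zeta> - real (Suc m) *\<^sub>R c))"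
      have [measurable]: "G \<in> borel_measurable borel" unfolding G_def by measurable
      have G: "G (\<zeta> + real (Suc m) *\<^sub>R c) = complex_of_real (f ((1 / real (Suc m)) *\<^sub>R \<zeta> + c)) * inv_fourier \<eta> \<zeta>" for \<zeta>
        by (simp add: G_def scaleR_add_right)
      show "(LINT \<zeta>|lborel. complex_of_real (f ((1 / real (Suc m)) *\<^sub>R \<zeta>)) * inv_fourier \<eta> (\<zeta> - real (Suc m) *\<^sub>R c)) = L c m"
        using integral_lborel_translate[of G "real (Suc m) *\<^sub>R c"] unfolding G by (simp add: L_def G_def)
      have "integrable lborel (\<lambda>\<zeta>. G (\<zeta> + real (Suc m) *\<^sub>R c))" unfolding G by (rule int)
      then have "integrable (distr lborel borel ((+) (real (Suc m) *\<^sub>R c))) G"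
        by (subst integrable_distr_eq) (auto simp: add.commute)
      then show "integrable lborel (\<lambda>\<zeta>. complex_of_real (f ((1 / real (Suc m)) *\<^sub>R \<zeta>)) * inv_fourier \<eta> (\<zeta> - real (Suc m) *\<^sub>R c))"
        unfolding lborel_distr_plus G_def .
    qed
    have V_L: "V (real (Suc m)) = - (L 0 m - (L (- b) m + L b m) / 2)" for m
    proof -
      have "V (real (Suc m)) = - (LINT \<zeta>|lborel.
          complex_of_real (f ((1 / real (Suc m)) *\<^sub>R \<zeta>)) * inv_fourier \<eta> (\<zeta> - real (Suc m) *\<^sub>R 0) -
          (complex_of_real (f ((1 / real (Suc m)) *\<^sub>R \<zeta>)) * inv_fourier \<eta> (\<zeta> - real (Suc m) *\<^sub>R (- b)) +
           complex_of_real (f ((1 / real (Suc m)) *\<^sub>R \<zeta>)) * inv_fourier \<eta> (\<zeta> - real (Suc m) *\<^sub>R b)) / 2)"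
        by (subst V_eq) (simp_all add: right_diff_distrib distrib_left del: of_nat_Suc)
      also have "\<dots> = - (L 0 m - (L (- b) m + L b m) / 2)"
        using shift_int[of m] shift[of m]
        by (simp del: of_nat_Suc scaleR_minus_right scaleR_zero_right)
      finally show ?thesis .
    qed
    have "(\<lambda>m. V (real (Suc m))) \<longlonglongrightarrow> - ((LINT \<zeta>|lborel. of_real (f 0) * inv_fourier \<eta> \<zeta>) -
        ((LINT \<zeta>|lborel. of_real (f (- b)) * inv_fourier \<eta> \<zeta>) + (LINT \<zeta>|lborel. of_real (f b) * inv_fourier \<eta> \<zeta>)) / 2)"
      unfolding V_L L_def by (intro tendsto_intros lim) auto
    then show ?thesis by (simp add: f_0 f_even)
  qed
  moreover have "(\<lambda>m. V (real (Suc m))) = (\<lambda>m. V 1)"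
    by (intro ext V_const) auto
  ultimately have V1: "V 1 = of_real (f b) * (LINT \<zeta>|lborel. inv_fourier \<eta> \<zeta>)"
    by (simp add: LIMSEQ_const_iff)
  have "(\<lambda>m. V (1 / real (Suc m))) \<longlonglongrightarrow> 0"
  proof -
    \<comment> \<open>Of the n + 4 powers of decay, two absorb the growth of the symbol and n + 2
      leave an integrable majorant.\<close>
    obtain C where C: "C \<ge> 0" "\<And>\<xi> t. 0 \<le> t \<Longrightarrow> t \<le> 1 \<Longrightarrow> (1 + norm \<xi>) ^ (CARD('n) + 4) *
        norm (inv_fourier \<eta> (\<xi> + t *\<^sub>R b) + inv_fourier \<eta> (\<xi> - t *\<^sub>R b) - 2 * inv_fourier \<eta> \<xi>) \<le> C * t\<^sup>2"
      unfolding \<eta>_def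
      using inv_fourier_second_difference[OF elem_smooth_plateau, of 2 "CARD('n) + 4" b] plateau_eq_0 by metis
    define d where "d m \<xi> = inv_fourier \<eta> \<xi> - (inv_fourier \<eta> (\<xi> + (1 / real (Suc m)) *\<^sub>R b) +
      inv_fourier \<eta> (\<xi> - (1 / real (Suc m)) *\<^sub>R b)) / 2" for m \<xi>
    \<comment> \<open>A factor (m + 1)^2 is moved from the symbol to the second difference. The
      latter is O((m + 1)^-2) and so stays bounded after multiplication, while the former tends to 0
      because the symbol is subquadratic.\<close>
    define F where "F m \<xi> = f (real (Suc m) *\<^sub>R \<xi>) / (real (Suc m))\<^sup>2" for m \<xi>
    have F_le: "\<bar>F m \<xi>\<bar> \<le> growth * (1 + norm \<xi>)\<^sup>2" for m \<xi>
    proof -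
      have "\<bar>f (real (Suc m) *\<^sub>R \<xi>)\<bar> \<le> growth * (1 + norm (real (Suc m) *\<^sub>R \<xi>))\<^sup>2" by (rule growth)
      also have "\<dots> \<le> growth * (real (Suc m) * (1 + norm \<xi>))\<^sup>2"
      proof (intro mult_left_mono power_mono growth(1))
        have *: "norm (real (Suc m) *\<^sub>R \<xi>) = real (Suc m) * norm \<xi>" by simp
        show "1 + norm (real (Suc m) *\<^sub>R \<xi>) \<le> real (Suc m) * (1 + norm \<xi>)"
          unfolding * distrib_left by simp
      qed simp
      finally show ?thesis
        by (simp add: F_def power_mult_distrib pos_divide_le_eq mult_ac del: of_nat_Suc)
    qed
    have d_le: "(real (Suc m))\<^sup>2 * norm (d m \<xi>) \<le> C * inverse ((1 + norm \<xi>) ^ (CARD('n) + 4))" for m \<xi>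
    proof -
      have pos: "(1 + norm \<xi>) ^ (CARD('n) + 4) > 0" by (simp add: add_pos_nonneg)
      have "d m \<xi> = - (inv_fourier \<eta> (\<xi> + (1 / real (Suc m)) *\<^sub>R b) + inv_fourier \<eta> (\<xi> - (1 / real (Suc m)) *\<^sub>R b)
          - 2 * inv_fourier \<eta> \<xi>) / 2"
        by (simp add: d_def field_simps)
      then have "norm (d m \<xi>) \<le> norm (inv_fourier \<eta> (\<xi> + (1 / real (Suc m)) *\<^sub>R b) + inv_fourier \<eta> (\<xi> - (1 / real (Suc m)) *\<^sub>R b)
          - 2 * inv_fourier \<eta> \<xi>)"
        by (simp only: norm_divide norm_minus_cancel norm_numeral) simp
      then have "(1 + norm \<xi>) ^ (CARD('n) + 4) * norm (d m \<xi>) \<le> (1 + norm \<xi>) ^ (CARD('n) + 4) *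
          norm (inv_fourier \<eta> (\<xi> + (1 / real (Suc m)) *\<^sub>R b) + inv_fourier \<eta> (\<xi> - (1 / real (Suc m)) *\<^sub>R b)
          - 2 * inv_fourier \<eta> \<xi>)"
        using pos by (intro mult_left_mono) auto
      also have "\<dots> \<le> C * (1 / real (Suc m))\<^sup>2"
        by (rule C(2)) auto
      finally have "(1 + norm \<xi>) ^ (CARD('n) + 4) * norm (d m \<xi>) \<le> C * (1 / real (Suc m))\<^sup>2" .
      then show ?thesis
        using pos by (simp add: field_simps power_divide del: of_nat_Suc)
    qed
    have "(\<lambda>m. LINT \<xi>|lborel. of_real (F m \<xi>) * (of_real ((real (Suc m))\<^sup>2) * d m \<xi>)) \<longlonglongrightarrow> (LINT \<xi>::real^'n|lborel. 0)"
    proof (rule integral_dominated_convergence[where w="\<lambda>\<xi>. growth * C * inverse ((1 + norm \<xi>) ^ (DIM(real^'n) + 2))"])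
      show "integrable lborel (\<lambda>\<xi>::real^'n. growth * C * inverse ((1 + norm \<xi>) ^ (DIM(real^'n) + 2)))"
        by (intro integrable_mult_right integrable_inverse_power_norm)
      have bd: "norm (complex_of_real (F m \<xi>) * (of_real ((real (Suc m))\<^sup>2) * d m \<xi>)) \<le>
          \<bar>F m \<xi>\<bar> * (C * inverse ((1 + norm \<xi>) ^ (CARD('n) + 4)))" for m \<xi>
        unfolding norm_mult norm_of_real using mult_left_mono[OF d_le[of m \<xi>] abs_ge_zero[of "F m \<xi>"]]
        by (simp del: of_nat_Suc)
      show "AE \<xi> in lborel. (\<lambda>m. complex_of_real (F m \<xi>) * (of_real ((real (Suc m))\<^sup>2) * d m \<xi>)) \<longlonglongrightarrow> 0"
      proof (intro AE_I2)
        fix \<xi> :: "real^'n"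
        have "(\<lambda>m. F m \<xi>) \<longlonglongrightarrow> 0" unfolding F_def by (rule f_subquadratic)
        then have "(\<lambda>m. \<bar>F m \<xi>\<bar> * (C * inverse ((1 + norm \<xi>) ^ (CARD('n) + 4)))) \<longlonglongrightarrow> 0"
          by (intro tendsto_mult_left_zero tendsto_rabs_zero)
        then show "(\<lambda>m. complex_of_real (F m \<xi>) * (of_real ((real (Suc m))\<^sup>2) * d m \<xi>)) \<longlonglongrightarrow> 0"
          by (rule Lim_null_comparison[rotated]) (use bd in auto)
      qed
      show "AE \<xi> in lborel. norm (complex_of_real (F m \<xi>) * (of_real ((real (Suc m))\<^sup>2) * d m \<xi>)) \<le>
          growth * C * inverse ((1 + norm \<xi>) ^ (DIM(real^'n) + 2))" for m
      proof (intro AE_I2)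
        fix \<xi> :: "real^'n"
        have pos: "1 + norm \<xi> > 0" by (simp add: add_pos_nonneg)
        have "norm (complex_of_real (F m \<xi>) * (of_real ((real (Suc m))\<^sup>2) * d m \<xi>)) \<le>
            (growth * (1 + norm \<xi>)\<^sup>2) * (C * inverse ((1 + norm \<xi>) ^ (CARD('n) + 4)))"
          using C(1) pos by (intro order_trans[OF bd] mult_right_mono F_le) auto
        also have "CARD('n) + 4 = 2 + (CARD('n) + 2)" by simp
        also have "(1 + norm \<xi>) ^ \<dots> = (1 + norm \<xi>)\<^sup>2 * (1 + norm \<xi>) ^ (CARD('n) + 2)"
          by (rule power_add)
        also have "(growth * (1 + norm \<xi>)\<^sup>2) * (C * inverse ((1 + norm \<xi>)\<^sup>2 * (1 + norm \<xi>) ^ (CARD('n) + 2))) =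
            growth * C * inverse ((1 + norm \<xi>) ^ (CARD('n) + 2))"
          using pos by (simp add: inverse_mult_distrib)
        finally show "norm (complex_of_real (F m \<xi>) * (of_real ((real (Suc m))\<^sup>2) * d m \<xi>)) \<le>
            growth * C * inverse ((1 + norm \<xi>) ^ (DIM(real^'n) + 2))" by simp
      qed
      show "(\<lambda>\<xi>. complex_of_real (F m \<xi>) * (of_real ((real (Suc m))\<^sup>2) * d m \<xi>)) \<in> borel_measurable lborel" for m
        unfolding F_def d_def by measurable
    qed simp
    moreover have "V (1 / real (Suc m)) = - (LINT \<xi>|lborel. of_real (F m \<xi>) * (of_real ((real (Suc m))\<^sup>2) * d m \<xi>))" for m
    proof -
      have eq: "complex_of_real (F m \<xi>) * (of_real ((real (Suc m))\<^sup>2) * d m \<xi>) = of_real (f (real (Suc m) *\<^sub>R \<xi>)) * d m \<xi>" for \<xi>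
        by (simp add: F_def del: of_nat_Suc flip: mult.assoc of_real_mult)
      have "1 / (1 / real (Suc m)) = real (Suc m)" by simp
      then show ?thesis
        unfolding eq using V_eq[of "1 / real (Suc m)"] by (simp only: d_def) simp
    qed
    ultimately show ?thesis by (simp add: tendsto_minus_cancel_left[symmetric])
  qed
  moreover have "(\<lambda>m. V (1 / real (Suc m))) = (\<lambda>m. V 1)"
    by (intro ext V_const[symmetric]) auto
  ultimately have "V 1 = 0" by (simp add: LIMSEQ_const_iff)
  then show False
    using V1 assms integral_inv_fourier_plateau_nonzero[where ?'n='n] by (simp add: \<eta>_def)
qed

end

section \<open>The comparison principle for symbol kernels\<close>

text \<open>\<open>L_infinity\<close> bounds \<open>u\<close> almost everywhere; by continuity a
  larger value at one point would persist on an open set, which is not null.\<close>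

lemma L_infinity_continuous_bounded:
  assumes "L_infinity u" "continuous_on UNIV u"
  obtains M where "M \<ge> 0" "\<And>x. \<bar>u x\<bar> \<le> M"
proof -
  obtain M where M: "AE x in lebesgue. \<bar>u x\<bar> \<le> M"
    using assms(1) unfolding L_infinity_def by blast
  have "\<bar>u x\<bar> \<le> M" for x
  proof (rule ccontr)
    assume "\<not> ?thesis"
    moreover have "open ((\<lambda>x. \<bar>u x\<bar>) -` {M<..})"
      by (intro open_vimage continuous_intros assms(2))
    ultimately obtain y where "y \<in> (\<lambda>x. \<bar>u x\<bar>) -` {M<..}" "\<bar>u y\<bar> \<le> M"
      using AE_lebesgue_open_ex[OF _ _ M, of "(\<lambda>x. \<bar>u x\<bar>) -` {M<..}" x] by auto
    then show False by simp
  qed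
  moreover from this[of 0] have "M \<ge> 0" by linarith
  ultimately show ?thesis using that by blast
qed

text \<open>Mean value inequality for \<open>u\<close> minus its linear part at \<open>x\<close> on
  the ball of radius |h|, where the gradient differs from \<open>g x\<close> by at most L |h|. The
  restriction |h| <= 1 fixes one compact ball, hence one Lipschitz constant.\<close>

lemma C11_quadratic_estimate:
  fixes u :: "real^'n \<Rightarrow> real"
  assumes d: "\<And>x. (u has_derivative (\<lambda>h. g x \<bullet> h)) (at x)"
    and lip: "\<forall>C. compact C \<longrightarrow> (\<exists>L. L-lipschitz_on C g)"
  obtains L where "L \<ge> 0" "\<And>h. norm h \<le> 1 \<Longrightarrow> \<bar>u (x + h) - u x - g x \<bullet> h\<bar> \<le> L * (norm h)\<^sup>2"
proof -
  obtain L where L: "L-lipschitz_on (cball x 1) g" using lip compact_cball by blast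
  then have "L \<ge> 0" by (rule lipschitz_on_nonneg)
  moreover have "\<bar>u (x + h) - u x - g x \<bullet> h\<bar> \<le> L * (norm h)\<^sup>2" if h: "norm h \<le> 1" for h
  proof -
    have "norm ((u (x + h) - g x \<bullet> (x + h)) - (u x - g x \<bullet> x)) \<le> (L * norm h) * norm ((x + h) - x)"
    proof (rule differentiable_bound[of "cball x (norm h)"])
      show "((\<lambda>y. u y - g x \<bullet> y) has_derivative (\<lambda>v. (g y - g x) \<bullet> v)) (at y within cball x (norm h))" for y
        by (rule has_derivative_at_withinI)
          (auto intro!: derivative_eq_intros d simp: inner_diff_left)
      fix y assume y: "y \<in> cball x (norm h)"
      have "dist (g y) (g x) \<le> L * dist y x"
        using y h by (intro lipschitz_onD[OF L]) (auto simp: dist_commute)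
      also have "\<dots> \<le> L * norm h"
        using y \<open>L \<ge> 0\<close> by (intro mult_left_mono) (auto simp: dist_commute)
      finally have *: "norm (g y - g x) \<le> L * norm h" by (simp add: dist_norm)
      show "onorm (\<lambda>v. (g y - g x) \<bullet> v) \<le> L * norm h"
      proof (rule onorm_le)
        fix v
        have "norm ((g y - g x) \<bullet> v) \<le> norm (g y - g x) * norm v"
          using Cauchy_Schwarz_ineq2 by auto
        also have "\<dots> \<le> (L * norm h) * norm v" by (intro mult_right_mono *) auto
        finally show "norm ((g y - g x) \<bullet> v) \<le> (L * norm h) * norm v" .
      qed
    qed (auto simp: dist_norm)
    then show ?thesis by (simp add: inner_add_right power2_eq_square algebra_simps)
  qed
  ultimately show ?thesis using that by blast
qed

section \<open>The operator as an absolutely convergent integral\<close>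

context symbol_kernel
begin

text \<open>At h = 0 the bound forces c(0) = 0, so the uncontrolled value \<open>k 0\<close> does no
  harm and the division by min 1 |h|^2 agrees with the convention that a quotient by 0 is 0.\<close>

lemma k_times_integrable:
  fixes c :: "real^'n \<Rightarrow> real"
  assumes c: "c \<in> borel_measurable borel" and le: "\<And>h. \<bar>c h\<bar> \<le> B * min 1 ((norm h)\<^sup>2)"
  shows "integrable lebesgue (\<lambda>h. c h * k h)"
proof -
  have eq: "c h * k h = (c h / min 1 ((norm h)\<^sup>2)) * (min 1 ((norm h)\<^sup>2) * k h)" for h
    using le[of h] by (cases "h = 0") auto
  have "(\<lambda>h. c h / min 1 ((norm h)\<^sup>2)) \<in> borel_measurable borel" using c by measurable
  then have m: "(\<lambda>h. c h / min 1 ((norm h)\<^sup>2)) \<in> borel_measurable lebesgue" by (simp add: measurable_completion)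
  have q: "\<bar>c h / min 1 ((norm h)\<^sup>2)\<bar> \<le> \<bar>B\<bar>" for h
  proof (cases "h = 0")
    case False
    then have "min 1 ((norm h)\<^sup>2) > 0" by simp
    moreover from this have "B * min 1 ((norm h)\<^sup>2) \<le> \<bar>B\<bar> * min 1 ((norm h)\<^sup>2)"
      by (intro mult_right_mono) auto
    then have "\<bar>c h\<bar> \<le> \<bar>B\<bar> * min 1 ((norm h)\<^sup>2)" using le[of h] by linarith
    ultimately show ?thesis by (simp add: pos_divide_le_eq)
  qed auto
  have "integrable lebesgue (\<lambda>h. (c h / min 1 ((norm h)\<^sup>2)) * (min 1 ((norm h)\<^sup>2) * k h))"
  proof (rule Bochner_Integration.integrable_bound[OF integrable_mult_right[OF k_Levy_integrable, of "\<bar>B\<bar>"]])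
    show "(\<lambda>h. (c h / min 1 ((norm h)\<^sup>2)) * (min 1 ((norm h)\<^sup>2) * k h)) \<in> borel_measurable lebesgue"
      by (rule borel_measurable_times[OF m borel_measurable_integrable[OF k_Levy_integrable]])
    show "AE h in lebesgue. norm ((c h / min 1 ((norm h)\<^sup>2)) * (min 1 ((norm h)\<^sup>2) * k h)) \<le>
        norm (\<bar>B\<bar> * (min 1 ((norm h)\<^sup>2) * k h))"
    proof (intro AE_I2)
      fix h
      show "norm ((c h / min 1 ((norm h)\<^sup>2)) * (min 1 ((norm h)\<^sup>2) * k h)) \<le> norm (\<bar>B\<bar> * (min 1 ((norm h)\<^sup>2) * k h))"
        using mult_right_mono[OF q[of h] abs_ge_zero[of "min 1 ((norm h)\<^sup>2) * k h"]]
        by (simp only: real_norm_def abs_mult abs_idempotent)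
    qed
  qed
  then show ?thesis by (simp only: eq[symmetric])
qed

text \<open>With \<open>a\<close> the gradient of \<open>u\<close> at \<open>x\<close>, the linear
  term cancels the first order part of the increment. It is confined to the unit ball, so that large
  displacements see only the bounded increment of \<open>u\<close>.\<close>

definition compensated :: "(real^'n \<Rightarrow> real) \<Rightarrow> real^'n \<Rightarrow> real^'n \<Rightarrow> real^'n \<Rightarrow> real"
  where "compensated u a x h = u x - u (x + h) + indicator (ball 0 1) h * (a \<bullet> h)"

text \<open>For r < 1 the correction integrates to 0 over r < |h| < 1 by the first moment identity,
  so each truncated integral may be taken with the compensated increment, which has a majorant
  independent of r. Hence the limit exists and \<open>Lim\<close> returns it.\<close>

lemma pv_operator_compensated:
  assumes d: "\<And>x. (u has_derivative (\<lambda>h. g x \<bullet> h)) (at x)"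
    and lip: "\<forall>C. compact C \<longrightarrow> (\<exists>L. L-lipschitz_on C g)"
    and u: "L_infinity u"
  shows "integrable lebesgue (\<lambda>h. compensated u (g x) x h * k h)" (is "integrable _ ?J")
    and "pv_operator k u x = (LINT h|lebesgue. compensated u (g x) x h * k h)"
proof -
  have cont: "continuous_on UNIV u"
    by (intro continuous_at_imp_continuous_on ballI has_derivative_continuous[OF d])
  have [measurable]: "u \<in> borel_measurable borel" by (rule borel_measurable_continuous_onI[OF cont])
  have ux [measurable]: "(\<lambda>h. u (x + h)) \<in> borel_measurable borel" by measurable
  obtain M where M: "M \<ge> 0" "\<And>x. \<bar>u x\<bar> \<le> M"
    using L_infinity_continuous_bounded[OF u cont] by blast
  obtain L where L: "L \<ge> 0" "\<And>h. norm h \<le> 1 \<Longrightarrow> \<bar>u (x + h) - u x - g x \<bullet> h\<bar> \<le> L * (norm h)\<^sup>2"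
    using C11_quadratic_estimate[OF d lip] by blast
  have [measurable]: "(\<lambda>h. g x \<bullet> h) \<in> borel_measurable borel"
    by (intro borel_measurable_continuous_onI continuous_intros)
  have [measurable]: "(\<lambda>h. indicator (ball (0::real^'n) 1) h :: real) \<in> borel_measurable borel"
    by (intro borel_measurable_indicator) auto
  have meas: "compensated u (g x) x \<in> borel_measurable borel"
    unfolding compensated_def[abs_def] by measurable
  have le: "\<bar>compensated u (g x) x h\<bar> \<le> (L + 2 * M) * min 1 ((norm h)\<^sup>2)" for h
  proof (cases "norm h < 1")
    case True
    then have "(norm h)\<^sup>2 \<le> 1" by (simp add: power_le_one)
    moreover have "\<bar>compensated u (g x) x h\<bar> \<le> L * (norm h)\<^sup>2"
      using L(2)[of h] True by (simp add: compensated_def)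
    moreover have "0 \<le> 2 * M * (norm h)\<^sup>2" using M(1) by simp
    ultimately show ?thesis by (simp add: distrib_right)
  next
    case False
    then have "(norm h)\<^sup>2 \<ge> 1" by simp
    moreover have "\<bar>compensated u (g x) x h\<bar> \<le> 2 * M"
      using M(2)[of x] M(2)[of "x + h"] False by (simp add: compensated_def)
    ultimately show ?thesis using L(1) by simp
  qed
  show int: "integrable lebesgue ?J" by (rule k_times_integrable[OF meas le])
  have eq: "(LINT h:{h. r < norm h}|lebesgue. (u x - u (x + h)) * k h) =
      (LINT h:{h. r < norm h}|lebesgue. ?J h)" if r: "0 < r" "r < 1" for r
  proof -
    define c where "c h = indicator {h. r < norm h \<and> norm h < 1} h * (g x \<bullet> h)" for h
    have "integrable lebesgue (\<lambda>h. c h * k h)"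
    proof (rule k_times_integrable)
      show "c \<in> borel_measurable borel" unfolding c_def by measurable
      fix h
      \<comment> \<open>On the support |h| > r, so the linear bound becomes quadratic: |h| <= |h|^2
        / r.\<close>
      show "\<bar>c h\<bar> \<le> (norm (g x) / r) * min 1 ((norm h)\<^sup>2)"
      proof (cases "r < norm h \<and> norm h < 1")
        case True
        have "\<bar>g x \<bullet> h\<bar> \<le> norm (g x) * norm h" by (rule Cauchy_Schwarz_ineq2)
        also have "\<dots> \<le> norm (g x) * ((norm h)\<^sup>2 / r)"
          using True r by (intro mult_left_mono) (auto simp: pos_le_divide_eq power2_eq_square intro!: mult_left_mono)
        finally show ?thesis using True by (simp add: c_def power_le_one min_absorb2)
      next
        case False
        then show ?thesis using r by (auto simp: c_def indicator_def)
      qed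
    qed
    moreover have "integrable lebesgue (\<lambda>h. indicator {h. r < norm h} h *\<^sub>R ?J h)"
      using int by (intro integrable_mult_indicator) auto
    moreover have "indicator {h. r < norm h} h *\<^sub>R ((u x - u (x + h)) * k h) =
        indicator {h. r < norm h} h *\<^sub>R ?J h - c h * k h" for h
      by (auto simp: c_def compensated_def indicator_def algebra_simps)
    ultimately have "(LINT h:{h. r < norm h}|lebesgue. (u x - u (x + h)) * k h) =
        (LINT h:{h. r < norm h}|lebesgue. ?J h) - (LINT h|lebesgue. c h * k h)"
      unfolding set_lebesgue_integral_def by simp
    also have "(LINT h|lebesgue. c h * k h) = (LINT h:{h. r < norm h \<and> norm h < 1}|lebesgue. (g x \<bullet> h) * k h)"
      unfolding set_lebesgue_integral_def by (simp add: c_def mult.assoc)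
    finally show ?thesis by (simp add: k_first_moment_annulus[OF r(1)])
  qed
  have "((\<lambda>r. LINT h:{h. r < norm h}|lebesgue. (u x - u (x + h)) * k h) \<longlongrightarrow> (LINT h|lebesgue. ?J h)) (at_right 0)"
    unfolding tendsto_at_iff_sequentially o_def
  proof (intro allI impI)
    fix X :: "nat \<Rightarrow> real" assume X: "\<forall>i. X i \<in> {0<..} - {0}" "X \<longlonglongrightarrow> 0"
    have "(\<lambda>i. LINT h|lebesgue. indicator {h. X i < norm h} h *\<^sub>R ?J h) \<longlonglongrightarrow> (LINT h|lebesgue. ?J h)"
    proof (rule integral_dominated_convergence[where w="\<lambda>h. norm (?J h)"])
      show "AE h in lebesgue. (\<lambda>i. indicator {h. X i < norm h} h *\<^sub>R ?J h) \<longlonglongrightarrow> ?J h"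
      proof (intro AE_I2)
        fix h
        show "(\<lambda>i. indicator {h. X i < norm h} h *\<^sub>R ?J h) \<longlonglongrightarrow> ?J h"
        proof (cases "h = 0")
          case True
          then show ?thesis by (simp add: compensated_def)
        next
          case False
          then have "\<forall>\<^sub>F i in sequentially. X i < norm h"
            using X(2) by (intro order_tendstoD) auto
          then have "\<forall>\<^sub>F i in sequentially. indicator {h. X i < norm h} h *\<^sub>R ?J h = ?J h"
            by eventually_elim auto
          then show ?thesis by (rule tendsto_eventually)
        qed
      qed
      show "(\<lambda>h. indicator {h. X i < norm h} h *\<^sub>R ?J h) \<in> borel_measurable lebesgue" for i
        using integrable_mult_indicator[OF _ int, of "{h. X i < norm h}"] by auto
    qed (use int in \<open>auto simp: indicator_def\<close>)
    moreover have "\<forall>\<^sub>F i in sequentially. X i < 1" using X(2) by (intro order_tendstoD) auto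
    then have "\<forall>\<^sub>F i in sequentially. (LINT h|lebesgue. indicator {h. X i < norm h} h *\<^sub>R ?J h) =
        (LINT h:{h. X i < norm h}|lebesgue. (u x - u (x + h)) * k h)"
    proof eventually_elim
      case (elim i)
      then show ?case using eq[of "X i"] X(1) by (auto simp: set_lebesgue_integral_def)
    qed
    ultimately show "(\<lambda>i. LINT h:{h. X i < norm h}|lebesgue. (u x - u (x + h)) * k h) \<longlonglongrightarrow> (LINT h|lebesgue. ?J h)"
      by (rule Lim_transform_eventually)
  qed
  then show "pv_operator k u x = (LINT h|lebesgue. ?J h)"
    unfolding pv_operator_def by (intro tendsto_Lim) auto
qed

text \<open>On the other half space -h_j k(h) is nonnegative, and over every annulus its integral is
  0 by the first moment identity, so it vanishes almost everywhere. The hyperplane h_j = 0 is null,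
  and countably many annuli exhaust the rest.\<close>

lemma k_zero_if_zero_on_half_space:
  assumes "AE h in lebesgue. h $ j > 0 \<longrightarrow> k h = 0"
  shows "AE h in lebesgue. k h = 0"
proof -
  have "AE h in lebesgue. 1 / real (m + 1) < norm h \<and> norm h < real (m + 1) \<longrightarrow> h $ j * k h = 0" for m
  proof -
    let ?A = "{h::real^'n. 1 / real (m + 1) < norm h \<and> norm h < real (m + 1)}"
    let ?B = "{h::real^'n. 1 / real (m + 1) \<le> norm h \<and> norm h \<le> real (m + 1)}"
    define c where "c h = indicator ?A h * (- h $ j)" for h
    have "integrable lebesgue (\<lambda>h. c h * k h)"
    proof (rule k_times_integrable)
      show "c \<in> borel_measurable borel" unfolding c_def by measurable
      fix h
      \<comment> \<open>With r = m + 1 and 1/r < |h| < r one has |h_j| <= r <= r (r |h|)^2 = r^3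
        |h|^2, and also r <= r^3; hence the cube.\<close>
      show "\<bar>c h\<bar> \<le> real (m + 1) ^ 3 * min 1 ((norm h)\<^sup>2)"
      proof (cases "h \<in> ?A")
        case True
        define r where "r = real (m + 1)"
        have r: "r \<ge> 1" by (simp add: r_def)
        have hr: "1 / r < norm h" "norm h < r" using True by (auto simp: r_def)
        have "\<bar>h $ j\<bar> \<le> norm h" by (rule component_le_norm_cart)
        then have c: "\<bar>c h\<bar> \<le> r" using True hr by (simp add: c_def)
        have "1 \<le> r * norm h" using hr(1) r by (simp add: pos_divide_less_eq mult.commute)
        then have "1 \<le> (r * norm h)\<^sup>2" by simp
        then have "r * 1 \<le> r * (r * norm h)\<^sup>2" using r by (intro mult_left_mono) auto
        then have "r \<le> r ^ 3 * (norm h)\<^sup>2"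
          by (simp add: power_mult_distrib power3_eq_cube power2_eq_square mult_ac)
        moreover have "r ^ 1 \<le> r ^ 3" by (intro power_increasing r) auto
        ultimately show ?thesis using c unfolding r_def[symmetric] by (simp add: min_def)
      qed (simp add: c_def)
    qed
    moreover have nonneg: "AE h in lebesgue. 0 \<le> c h * k h"
      using assms
    proof eventually_elim
      case (elim h)
      then show ?case
        using k_nonneg[of h] by (cases "h = 0"; cases "h $ j > 0") (auto simp: c_def indicator_def mult_nonpos_nonneg)
    qed
    moreover have "(LINT h|lebesgue. c h * k h) = 0"
    proof -
      have "(LINT h:?A|lebesgue. (axis j (- 1) \<bullet> h) * k h) = (0::real)"
        by (rule k_first_moment_annulus) simp
      then show ?thesis
        by (simp add: set_lebesgue_integral_def c_def inner_axis' mult.assoc)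
    qed
    ultimately have "AE h in lebesgue. c h * k h = 0"
      using integral_nonneg_eq_0_iff_AE by blast
    then show ?thesis by eventually_elim (auto simp: c_def)
  qed
  then have "AE h in lebesgue. \<forall>m. 1 / real (m + 1) < norm h \<and> norm h < real (m + 1) \<longrightarrow> h $ j * k h = 0"
    by (subst AE_all_countable) blast
  moreover have "negligible {h::real^'n. h $ j = 0}"
    using negligible_standard_hyperplane_cart by blast
  then have "AE h::real^'n in lebesgue. h $ j \<noteq> 0"
    unfolding negligible_iff_null_sets by (rule AE_I') auto
  ultimately show ?thesis
  proof eventually_elim
    case (elim h)
    then have h: "norm h > 0" by auto
    obtain m1 where m1: "1 / real (Suc m1) < norm h"
      using reals_Archimedean[OF h] by (auto simp: inverse_eq_divide)
    obtain m2 where m2: "norm h < real m2" using reals_Archimedean2 by blast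
    let ?m = "max m1 m2"
    have "1 / real (?m + 1) \<le> 1 / real (Suc m1)" by (intro divide_left_mono) auto
    then have "1 / real (?m + 1) < norm h \<and> norm h < real (?m + 1)" using m1 m2 by auto
    then show ?case using elim by (metis mult_eq_0_iff)
  qed
qed

text \<open>
  At a maximum point of \<open>v - u\<close> the operator inequality forces the kernel to charge only
  displacements to other maximum points; at the maximum point that is extreme in direction \<open>j\<close>
  this excludes the half space \<open>h\<^sub>j > 0\<close>.
\<close>

theorem comparison_principle:
  assumes nontrivial: "f b \<noteq> 0"
    and \<Omega>: "bounded \<Omega>"
    and u: "C11_loc u" "L_infinity u" and v: "C11_loc v" "L_infinity v"
    and op: "\<And>x. x \<in> \<Omega> \<Longrightarrow> pv_operator k u x \<ge> pv_operator k v x"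
    and out: "\<And>x. x \<in> - \<Omega> \<Longrightarrow> u x \<ge> v x"
  shows "u x \<ge> v x"
proof (rule ccontr)
  assume neg: "\<not> u x \<ge> v x"
  define w where "w y = v y - u y" for y
  obtain gu where gu: "\<And>x. (u has_derivative (\<lambda>h. gu x \<bullet> h)) (at x)"
    "\<forall>C. compact C \<longrightarrow> (\<exists>L. L-lipschitz_on C gu)"
    using u(1) unfolding C11_loc_def by blast
  obtain gv where gv: "\<And>x. (v has_derivative (\<lambda>h. gv x \<bullet> h)) (at x)"
    "\<forall>C. compact C \<longrightarrow> (\<exists>L. L-lipschitz_on C gv)"
    using v(1) unfolding C11_loc_def by blast
  have dw: "(w has_derivative (\<lambda>h. (gv y - gu y) \<bullet> h)) (at y)" for y
    unfolding w_def[abs_def] using has_derivative_diff[OF gv(1) gu(1)] by (simp add: inner_diff_left)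
  have cont: "continuous_on A w" for A
    by (intro continuous_at_imp_continuous_on ballI has_derivative_continuous[OF dw])
  have w_out: "w y \<le> 0" if "y \<notin> \<Omega>" for y using out[of y] that by (simp add: w_def)
  have wx: "w x > 0" using neg by (simp add: w_def)
  then have "x \<in> \<Omega>" using w_out by force
  have cl: "compact (closure \<Omega>)" using \<Omega> by simp
  \<comment> \<open>The maximum over the closure is positive and \<open>w\<close> is nonpositive
    outside \<Omega>. So the maximum is global, and all points where it is attained lie in \<Omega>
    itself.\<close>
  obtain x0 where x0: "x0 \<in> closure \<Omega>" "\<And>y. y \<in> closure \<Omega> \<Longrightarrow> w y \<le> w x0"
    using continuous_attains_sup[OF cl _ cont] \<open>x \<in> \<Omega>\<close> closure_subset by blast
  define M where "M = w x0"
  have M_pos: "M > 0" using x0(2)[of x] wx \<open>x \<in> \<Omega>\<close> closure_subset by (force simp: M_def)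
  have le_M: "w y \<le> M" for y
    using x0(2)[of y] w_out[of y] M_pos closure_subset[of \<Omega>] by (cases "y \<in> \<Omega>") (auto simp: M_def)
  define A where "A = closure \<Omega> \<inter> w -` {M}"
  have "closed (w -` {M})" by (intro continuous_closed_vimage) (use cont[of UNIV] in \<open>auto simp: continuous_on_eq_continuous_at\<close>)
  then have A: "compact A" "A \<noteq> {}"
    unfolding A_def using cl x0(1) by (auto simp: M_def intro: compact_Int_closed)
  \<comment> \<open>The direction is arbitrary; it only serves to single out one point
    \<open>p\<close> of the compact set \<open>A\<close> of maximum points.\<close>
  fix j :: 'n
  obtain p where p: "p \<in> A" "\<And>y. y \<in> A \<Longrightarrow> y $ j \<le> p $ j"
    using continuous_attains_sup[OF A continuous_on_component[OF continuous_on_id]] by blast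
  have wp: "w p = M" using p(1) by (simp add: A_def)
  have p\<Omega>: "p \<in> \<Omega>" using w_out[of p] wp M_pos by fastforce
  \<comment> \<open>The gradient of \<open>w\<close> vanishes at \<open>p\<close>, so
    \<open>u\<close> and \<open>v\<close> have the same compensating term there and it cancels in
    the difference. What remains is integrable and nonnegative without compensation.\<close>
  have "(\<lambda>h. (gv p - gu p) \<bullet> h) = (\<lambda>h. 0)"
    by (rule differential_zero_maxmin[of p UNIV, OF _ _ dw]) (use le_M wp in auto)
  then have gp: "gv p \<bullet> h = gu p \<bullet> h" for h
    by (metis eq_iff_diff_eq_0 inner_diff_left)
  note Ju = pv_operator_compensated[OF gu u(2), where x=p]
  note Jv = pv_operator_compensated[OF gv v(2), where x=p]
  have J: "compensated v (gv p) p h * k h - compensated u (gu p) p h * k h = (w p - w (p + h)) * k h" for h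
    by (simp add: compensated_def w_def gp algebra_simps)
  have int: "integrable lebesgue (\<lambda>h. (w p - w (p + h)) * k h)"
    using Bochner_Integration.integrable_diff[OF Jv(1) Ju(1)] unfolding J .
  have nonneg: "0 \<le> (w p - w (p + h)) * k h" for h
    using le_M[of "p + h"] k_nonneg[of h] wp by (cases "h = 0") auto
  have "(LINT h|lebesgue. (w p - w (p + h)) * k h) = pv_operator k v p - pv_operator k u p"
    unfolding Ju(2) Jv(2) J[symmetric] by (rule Bochner_Integration.integral_diff[OF Jv(1) Ju(1)])
  also have "\<dots> \<le> 0" using op[OF p\<Omega>] by simp
  finally have "(LINT h|lebesgue. (w p - w (p + h)) * k h) \<le> 0" .
  moreover have "0 \<le> (LINT h|lebesgue. (w p - w (p + h)) * k h)"
    by (rule Bochner_Integration.integral_nonneg) (rule nonneg)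
  ultimately have "(LINT h|lebesgue. (w p - w (p + h)) * k h) = 0" by linarith
  then have "AE h in lebesgue. (w p - w (p + h)) * k h = 0"
    using integral_nonneg_eq_0_iff_AE[OF int] nonneg by auto
  then have "AE h in lebesgue. h $ j > 0 \<longrightarrow> k h = 0"
  proof eventually_elim
    case (elim h)
    show ?case
    proof
      assume h: "h $ j > 0"
      \<comment> \<open>Otherwise p + h would be a point of \<open>A\<close> with a larger j-th
        coordinate than \<open>p\<close>.\<close>
      have "w (p + h) \<noteq> M"
      proof
        assume eq: "w (p + h) = M"
        then have "p + h \<in> \<Omega>" using w_out[of "p + h"] M_pos by fastforce
        then have "p + h \<in> A" using eq closure_subset by (auto simp: A_def)
        then show False using p(2)[of "p + h"] h by simp
      qed
      then show "k h = 0" using elim wp by auto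
    qed
  qed
  then show False
    using k_zero_if_zero_on_half_space k_nonzero[OF nontrivial] by blast
qed

end

section \<open>The symbol of an admissible kernel\<close>

text \<open>The symbol of \<open>K\<^sub>\<rho>\<close> at \<open>\<xi>\<close> is the square of the profile at \<open>\<bar>\<xi>\<bar>\<close>.\<close>

definition profile :: "(real^'n \<Rightarrow> real) \<Rightarrow> real \<Rightarrow> real"
  where "profile \<rho> s = (LINT x|lebesgue. \<rho> x *
    (x $ first_index / (norm x)\<^sup>2 * sin (2 * pi * s * x $ first_index)))"

locale admissible =
  fixes \<rho> :: "real^'n \<Rightarrow> real"
  assumes admissible: "admissible_kernel \<rho>"
begin

text \<open>The size of \<open>\<rho>\<close> is controlled through this product: every function
  paired with \<open>\<rho>\<close> below is bounded by a multiple of the weight, so |W| serves as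
  the common majorant.\<close>

definition W :: "real^'n \<Rightarrow> real"
  where "W x = min 1 (1 / norm x) * \<rho> x"

lemma W_integrable: "integrable lebesgue W"
  using admissible unfolding admissible_kernel_def W_def[abs_def] by blast

lemma \<rho>_nonneg: "x \<noteq> 0 \<Longrightarrow> \<rho> x \<ge> 0"
  using admissible unfolding admissible_kernel_def by blast

lemma \<rho>_positive_near_0:
  obtains e where "e > 0" "\<And>x. norm x < e \<Longrightarrow> x \<noteq> 0 \<Longrightarrow> \<rho> x > 0"
proof -
  obtain e where e: "e > 0" "(INF x\<in>cball 0 e - {0}. \<rho> x) > 0"
    using admissible unfolding admissible_kernel_def by blast
  have "\<rho> x > 0" if "norm x < e" "x \<noteq> 0" for x
  proof -
    have "bdd_below (\<rho> ` (cball 0 e - {0}))"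
      by (rule bdd_belowI2[of _ 0]) (use \<rho>_nonneg in auto)
    then have "(INF x\<in>cball 0 e - {0}. \<rho> x) \<le> \<rho> x"
      using that by (intro cINF_lower) auto
    then show ?thesis using e(2) by linarith
  qed
  then show ?thesis using e(1) that by blast
qed

text \<open>At the origin the hypothesis reads \<open>c 0 = 0\<close>, because \<open>1 / norm 0 = 0\<close>.\<close>

lemma
  assumes c: "c \<in> borel_measurable borel" and le: "\<And>x. \<bar>c x\<bar> \<le> B * min 1 (1 / norm x)"
  shows \<rho>_times_measurable: "(\<lambda>x. \<rho> x * c x) \<in> borel_measurable lebesgue"
    and \<rho>_times_le: "norm (\<rho> x * c x) \<le> B * norm (W x)"
    and \<rho>_times_integrable: "integrable lebesgue (\<lambda>x. \<rho> x * c x)"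
proof -
  have eq: "\<rho> x * c x = W x * (c x / min 1 (1 / norm x))" for x
    using le[of x] by (cases "x = 0") (auto simp: W_def)
  have "(\<lambda>x. c x / min 1 (1 / norm x)) \<in> borel_measurable borel" using c by measurable
  then have "(\<lambda>x. c x / min 1 (1 / norm x)) \<in> borel_measurable lebesgue" by (simp add: measurable_completion)
  then show m: "(\<lambda>x. \<rho> x * c x) \<in> borel_measurable lebesgue"
    unfolding eq by (intro borel_measurable_times borel_measurable_integrable[OF W_integrable])
  show le': "norm (\<rho> x * c x) \<le> B * norm (W x)" for x
  proof -
    have "0 \<le> min 1 (1 / norm x)" by simp
    then have "\<bar>W x\<bar> = min 1 (1 / norm x) * \<bar>\<rho> x\<bar>" unfolding W_def abs_mult by simp
    then show ?thesis
      using mult_left_mono[OF le[of x] abs_ge_zero[of "\<rho> x"]] by (simp add: abs_mult mult_ac)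
  qed
  show "integrable lebesgue (\<lambda>x. \<rho> x * c x)"
  proof (rule Bochner_Integration.integrable_bound[OF integrable_mult_right[OF integrable_norm[OF W_integrable], of B] m])
    show "AE x in lebesgue. norm (\<rho> x * c x) \<le> norm (B * norm (W x))"
      using le' by (intro AE_I2) (metis abs_ge_self order_trans real_norm_def)
  qed
qed

section \<open>Bounds, continuity and growth of the profile\<close>

definition q :: "real \<Rightarrow> real^'n \<Rightarrow> real"
  where "q s x = x $ first_index / (norm x)\<^sup>2 * sin (2 * pi * s * x $ first_index)"

lemma \<rho>q_measurableurable: "q s \<in> borel_measurable borel"
  unfolding q_def by measurable

text \<open>|x_1| <= |x| with |sin| <= 1 gives 1/|x|, while |sin t| <= |t| gives 2 pi |s|; the sum
  of the two constants serves both branches of the minimum. At x = 0 both sides are 0 by the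
  convention on division.\<close>

lemma q_le: "\<bar>q s x\<bar> \<le> (1 + 2 * pi * \<bar>s\<bar>) * min 1 (1 / norm x)"
proof (cases "x = 0")
  case False
  define t where "t = \<bar>x $ first_index\<bar>"
  define r where "r = norm x"
  have r: "r > 0" using False by (simp add: r_def)
  have t: "0 \<le> t" "t \<le> r" unfolding t_def r_def by (auto intro: component_le_norm_cart)
  have q: "\<bar>q s x\<bar> = t / r\<^sup>2 * \<bar>sin (2 * pi * s * x $ first_index)\<bar>"
    by (simp add: q_def t_def r_def abs_mult)
  have "\<bar>q s x\<bar> \<le> t / r\<^sup>2 * 1" unfolding q using t by (intro mult_left_mono) auto
  also have "\<dots> \<le> r / r\<^sup>2" using t by (simp add: divide_right_mono)
  also have "\<dots> = 1 / r" using r by (simp add: power2_eq_square)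
  finally have 1: "\<bar>q s x\<bar> \<le> 1 / r" .
  have "\<bar>q s x\<bar> \<le> t / r\<^sup>2 * (2 * pi * \<bar>s\<bar> * t)"
    unfolding q using t abs_sin_x_le_abs_x[of "2 * pi * s * x $ first_index"]
    by (intro mult_left_mono) (auto simp: abs_mult t_def)
  also have "\<dots> = 2 * pi * \<bar>s\<bar> * (t / r)\<^sup>2" by (simp add: power2_eq_square)
  also have "\<dots> \<le> 2 * pi * \<bar>s\<bar> * 1\<^sup>2" using t r by (intro mult_left_mono power_mono) auto
  finally have 2: "\<bar>q s x\<bar> \<le> 2 * pi * \<bar>s\<bar>" by simp
  have "0 \<le> 2 * pi * \<bar>s\<bar> * (1 / r)" using r by simp
  then show ?thesis
    using 1 2 unfolding r_def[symmetric] by (simp add: min_def distrib_right)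
qed (simp add: q_def)

lemmas \<rho>q_measurable = \<rho>_times_measurable[OF \<rho>q_measurableurable q_le]
  and \<rho>q_le = \<rho>_times_le[OF \<rho>q_measurableurable q_le]
  and \<rho>q_integrable = \<rho>_times_integrable[OF \<rho>q_measurableurable q_le]

lemma profile_q: "profile \<rho> s = (LINT x|lebesgue. \<rho> x * q s x)"
  by (simp add: profile_def q_def)

lemma \<rho>q_le_bounded:
  assumes "\<bar>s\<bar> \<le> B"
  shows "norm (\<rho> x * q s x) \<le> (1 + 2 * pi * B) * norm (W x)"
  by (rule order_trans[OF \<rho>q_le]) (use assms in \<open>auto intro!: mult_right_mono\<close>)

lemma profile_continuous: "continuous_on A (profile \<rho>)"
proof -
  have "isCont (profile \<rho>) s" for s
    unfolding continuous_at_sequentially o_def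
  proof (intro allI impI)
    fix X assume X: "X \<longlonglongrightarrow> s"
    then obtain B where B: "\<And>i. \<bar>X i\<bar> \<le> B"
      using convergent_imp_Bseq[of X] unfolding Bseq_def convergent_def by auto
    show "(\<lambda>i. profile \<rho> (X i)) \<longlonglongrightarrow> profile \<rho> s"
      unfolding profile_q
    proof (rule integral_dominated_convergence[where w="\<lambda>x. (1 + 2 * pi * B) * norm (W x)"])
      show "AE x in lebesgue. (\<lambda>i. \<rho> x * q (X i) x) \<longlonglongrightarrow> \<rho> x * q s x"
        unfolding q_def using X by (intro AE_I2 tendsto_intros)
      show "AE x in lebesgue. norm (\<rho> x * q (X i) x) \<le> (1 + 2 * pi * B) * norm (W x)" for i
        by (intro AE_I2 \<rho>q_le_bounded B)
    qed (auto intro!: \<rho>q_measurable W_integrable)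
  qed
  then show ?thesis by (simp add: continuous_at_imp_continuous_on)
qed

definition W_mass :: real
  where "W_mass = (LINT x|lebesgue. norm (W x))"

lemma profile_le: "\<bar>profile \<rho> s\<bar> \<le> (1 + 2 * pi * \<bar>s\<bar>) * W_mass"
proof -
  have "norm (LINT x|lebesgue. \<rho> x * q s x) \<le> (LINT x|lebesgue. (1 + 2 * pi * \<bar>s\<bar>) * norm (W x))"
    by (rule Bochner_Integration.integral_norm_bound_integral) (auto intro!: \<rho>q_integrable W_integrable \<rho>q_le[unfolded real_norm_def])
  then show ?thesis by (simp add: profile_q W_mass_def)
qed

lemma profile_0: "profile \<rho> 0 = 0"
  by (simp add: profile_def)

text \<open>For fixed x the sine is bounded, so dividing by m + 1 sends the integrand to 0, and the
  linear bound on \<open>q\<close> in s gives a majorant independent of m. This is the source of the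
  subquadratic growth of the symbol.\<close>

lemma profile_sublinear: "(\<lambda>m. profile \<rho> (real (Suc m) * s) / real (Suc m)) \<longlonglongrightarrow> 0"
proof -
  have "(\<lambda>m. LINT x|lebesgue. \<rho> x * q (real (Suc m) * s) x / real (Suc m)) \<longlonglongrightarrow> (LINT x::real^'n|lebesgue. 0)"
  proof (rule integral_dominated_convergence[where w="\<lambda>x. (1 + 2 * pi * \<bar>s\<bar>) * norm (W x)"])
    show "AE x in lebesgue. (\<lambda>m. \<rho> x * q (real (Suc m) * s) x / real (Suc m)) \<longlonglongrightarrow> 0"
    proof (intro AE_I2)
      fix x
      define A where "A = \<bar>\<rho> x * (x $ first_index / (norm x)\<^sup>2)\<bar>"
      have lim: "(\<lambda>m. A * inverse (real (Suc m))) \<longlonglongrightarrow> 0"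
        by (intro tendsto_mult_right_zero LIMSEQ_inverse_real_of_nat)
      have bd: "norm (\<rho> x * q (real (Suc m) * s) x / real (Suc m)) \<le> A * inverse (real (Suc m))" for m
      proof -
        have "\<bar>\<rho> x * q (real (Suc m) * s) x\<bar> = A * \<bar>sin (2 * pi * (real (Suc m) * s) * x $ first_index)\<bar>"
          by (simp add: q_def A_def abs_mult mult.assoc)
        also have "\<dots> \<le> A * 1" by (intro mult_left_mono) (auto simp: A_def)
        finally show ?thesis by (simp add: divide_inverse abs_mult mult_right_mono)
      qed
      show "(\<lambda>m. \<rho> x * q (real (Suc m) * s) x / real (Suc m)) \<longlonglongrightarrow> 0"
        by (rule Lim_null_comparison[OF always_eventually lim]) (rule allI, rule bd)
    qed
    show "AE x in lebesgue. norm (\<rho> x * q (real (Suc m) * s) x / real (Suc m)) \<le> (1 + 2 * pi * \<bar>s\<bar>) * norm (W x)" for m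
    proof (intro AE_I2)
      fix x
      define M where "M = real (Suc m)"
      have M: "M \<ge> 1" by (simp add: M_def)
      have "norm (\<rho> x * q (M * s) x) \<le> (1 + 2 * pi * \<bar>M * s\<bar>) * norm (W x)" by (rule \<rho>q_le)
      also have "\<dots> \<le> (M * (1 + 2 * pi * \<bar>s\<bar>)) * norm (W x)"
        using M by (intro mult_right_mono) (auto simp: abs_mult distrib_left)
      finally have "norm (\<rho> x * q (M * s) x) / M \<le> (1 + 2 * pi * \<bar>s\<bar>) * norm (W x)"
        using M by (simp add: pos_divide_le_eq mult_ac)
      then show "norm (\<rho> x * q (real (Suc m) * s) x / real (Suc m)) \<le> (1 + 2 * pi * \<bar>s\<bar>) * norm (W x)"
        unfolding M_def norm_divide by simp
    qed
    show "(\<lambda>x. \<rho> x * q (real (Suc m) * s) x / real (Suc m)) \<in> borel_measurable lebesgue" for m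
      by (intro borel_measurable_divide \<rho>q_measurable) auto
  qed (auto intro!: W_integrable)
  then show ?thesis by (simp add: profile_q)
qed

lemma profile_odd: "profile \<rho> (- s) = - profile \<rho> s"
  by (simp add: profile_def flip: Bochner_Integration.integral_minus)

text \<open>
  The primitive of the profile is the integral of \<open>\<rho>(x) (1 - cos (2 \<pi> S x\<^sub>1)) / (2 \<pi> \<bar>x\<bar>\<^sup>2)\<close>, which is
  positive because \<open>\<rho>\<close> is positive near the origin.
\<close>

lemma profile_nonzero: "\<exists>s\<ge>0. profile \<rho> s \<noteq> 0"
proof (rule ccontr)
  assume "\<not> ?thesis"
  then have z: "s \<ge> 0 \<Longrightarrow> profile \<rho> s = 0" for s by blast
  \<comment> \<open>Oddness extends the vanishing to negative s, because the primitive is shown to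
    have derivative 0 on the whole line.\<close>
  have zero: "profile \<rho> s = 0" for s
    using z[of s] z[of "- s"] profile_odd[of s] by (cases "s \<ge> 0") auto
  define p where "p S x = (1 - cos (2 * pi * S * x $ first_index)) / (2 * pi * (norm x)\<^sup>2)" for S and x :: "real^'n"
  have p_meas: "p S \<in> borel_measurable borel" for S unfolding p_def by measurable
  \<comment> \<open>One estimate with two uses: for S = 0 it makes \<rho> p integrable, and divided
    by t it dominates the difference quotients. Writing the difference of cosines as a product of
    sines, one sine yields the factor t and the other is bounded as in \<open>q_le\<close>.\<close>
  have diff: "\<bar>p (S + t) x - p S x\<bar> \<le> \<bar>t\<bar> * ((1 + pi * (2 * \<bar>S\<bar> + \<bar>t\<bar>)) * min 1 (1 / norm x))" for S t x
  proof (cases "x = 0")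
    case False
    define y where "y = x $ first_index"
    define r where "r = norm x"
    have r: "r > 0" using False by (simp add: r_def)
    have y: "\<bar>y\<bar> \<le> r" unfolding y_def r_def by (rule component_le_norm_cart)
    have e1: "(2 * pi * S * y + 2 * pi * (S + t) * y) / 2 = pi * (2 * S + t) * y"
      and e2: "(2 * pi * (S + t) * y - 2 * pi * S * y) / 2 = pi * t * y"
      by (auto simp: algebra_simps)
    have "p (S + t) x - p S x = (cos (2 * pi * S * y) - cos (2 * pi * (S + t) * y)) / (2 * pi * r\<^sup>2)"
      by (simp add: p_def y_def r_def diff_divide_distrib)
    also have "\<dots> = sin (pi * (2 * S + t) * y) * sin (pi * t * y) / (pi * r\<^sup>2)"
      unfolding cos_diff_cos e1 e2 by simp
    finally have "\<bar>p (S + t) x - p S x\<bar> = \<bar>sin (pi * (2 * S + t) * y)\<bar> * \<bar>sin (pi * t * y)\<bar> / (pi * r\<^sup>2)"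
      by (simp add: abs_mult)
    also have "\<dots> \<le> \<bar>sin (pi * (2 * S + t) * y)\<bar> * (pi * \<bar>t\<bar> * \<bar>y\<bar>) / (pi * r\<^sup>2)"
      using abs_sin_x_le_abs_x[of "pi * t * y"] by (intro divide_right_mono mult_left_mono) (auto simp: abs_mult)
    also have "\<dots> = \<bar>t\<bar> * (\<bar>sin (pi * (2 * S + t) * y)\<bar> * (\<bar>y\<bar> / r) / r)"
      using r by (simp add: power2_eq_square field_simps)
    also have "\<dots> \<le> \<bar>t\<bar> * ((1 + pi * (2 * \<bar>S\<bar> + \<bar>t\<bar>)) * min 1 (1 / r))"
    proof (intro mult_left_mono)
      have yr: "0 \<le> \<bar>y\<bar> / r" "\<bar>y\<bar> / r \<le> 1" using y r by auto
      have "\<bar>sin (pi * (2 * S + t) * y)\<bar> * (\<bar>y\<bar> / r) \<le> 1 * 1"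
        using yr by (intro mult_mono) auto
      from divide_right_mono[OF this, of r] have a: "\<bar>sin (pi * (2 * S + t) * y)\<bar> * (\<bar>y\<bar> / r) / r \<le> 1 / r"
        using r by simp
      have "\<bar>sin (pi * (2 * S + t) * y)\<bar> \<le> pi * \<bar>2 * S + t\<bar> * \<bar>y\<bar>"
        using abs_sin_x_le_abs_x[of "pi * (2 * S + t) * y"] by (simp add: abs_mult)
      also have "\<dots> \<le> pi * (2 * \<bar>S\<bar> + \<bar>t\<bar>) * r"
        using y by (intro mult_mono) auto
      finally have "\<bar>sin (pi * (2 * S + t) * y)\<bar> * (\<bar>y\<bar> / r) \<le> (pi * (2 * \<bar>S\<bar> + \<bar>t\<bar>) * r) * 1"
        using yr r by (intro mult_mono) auto
      then have b: "\<bar>sin (pi * (2 * S + t) * y)\<bar> * (\<bar>y\<bar> / r) / r \<le> pi * (2 * \<bar>S\<bar> + \<bar>t\<bar>)"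
        using r by (simp add: pos_divide_le_eq)
      have "0 \<le> pi * (2 * \<bar>S\<bar> + \<bar>t\<bar>) * (1 / r)" using r by simp
      then show "\<bar>sin (pi * (2 * S + t) * y)\<bar> * (\<bar>y\<bar> / r) / r \<le> (1 + pi * (2 * \<bar>S\<bar> + \<bar>t\<bar>)) * min 1 (1 / r)"
        using a b by (simp add: min_def distrib_right)
    qed auto
    finally show ?thesis by (simp add: r_def)
  qed (simp add: p_def)
  have p0: "p 0 x = 0" for x by (simp add: p_def)
  have p_le: "\<bar>p S x\<bar> \<le> (\<bar>S\<bar> * (1 + pi * \<bar>S\<bar>)) * min 1 (1 / norm x)" for S x
    using diff[of 0 S x] by (simp add: p0 mult.assoc)
  note p_int = \<rho>_times_integrable[OF p_meas p_le]
  define H where "H S = (LINT x|lebesgue. \<rho> x * p S x)" for S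
  \<comment> \<open>Differentiation under the integral sign turns \<open>p\<close> into
    \<open>q\<close>, so the derivative is the profile, assumed to vanish.\<close>
  have "(H has_real_derivative 0) (at S)" for S
    unfolding has_real_derivative_iff_has_vector_derivative has_vector_derivative_sequentially
  proof (intro allI impI)
    fix t :: "nat \<Rightarrow> real" assume t: "t \<longlonglongrightarrow> 0" "\<forall>m. t m \<noteq> 0"
    then obtain B where B: "\<And>i. \<bar>t i\<bar> \<le> B"
      using convergent_imp_Bseq[of t] unfolding Bseq_def convergent_def by auto
    have d_meas: "(\<lambda>x. (p (S + t m) x - p S x) / t m) \<in> borel_measurable borel" for m
      by (intro borel_measurable_divide borel_measurable_diff p_meas) auto
    have d_le: "\<bar>(p (S + t m) x - p S x) / t m\<bar> \<le> (1 + pi * (2 * \<bar>S\<bar> + B)) * min 1 (1 / norm x)" for m x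
    proof -
      have "\<bar>(p (S + t m) x - p S x) / t m\<bar> \<le> (1 + pi * (2 * \<bar>S\<bar> + \<bar>t m\<bar>)) * min 1 (1 / norm x)"
        using diff[of S "t m" x] t(2) by (simp add: pos_divide_le_eq mult_ac)
      also have "\<dots> \<le> (1 + pi * (2 * \<bar>S\<bar> + B)) * min 1 (1 / norm x)"
        using B[of m] by (intro mult_right_mono add_left_mono mult_left_mono) auto
      finally show ?thesis .
    qed
    have "(\<lambda>m. LINT x|lebesgue. \<rho> x * ((p (S + t m) x - p S x) / t m)) \<longlonglongrightarrow> (LINT x|lebesgue. \<rho> x * q S x)"
    proof (rule integral_dominated_convergence[where w="\<lambda>x. (1 + pi * (2 * \<bar>S\<bar> + B)) * norm (W x)"])
      show "AE x in lebesgue. (\<lambda>m. \<rho> x * ((p (S + t m) x - p S x) / t m)) \<longlonglongrightarrow> \<rho> x * q S x"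
      proof (intro AE_I2 tendsto_mult tendsto_const)
        fix x
        have "((\<lambda>S. p S x) has_real_derivative q S x) (at S)"
        proof (cases "x = 0")
          case True
          then show ?thesis by (simp add: p_def q_def)
        next
          case False
          then show ?thesis unfolding p_def q_def
            by (auto intro!: derivative_eq_intros simp: field_simps)
        qed
        then show "(\<lambda>m. (p (S + t m) x - p S x) / t m) \<longlonglongrightarrow> q S x"
          using t unfolding has_real_derivative_iff_has_vector_derivative has_vector_derivative_sequentially
          by (simp add: divide_inverse_commute)
      qed
      show "AE x in lebesgue. norm (\<rho> x * ((p (S + t m) x - p S x) / t m)) \<le> (1 + pi * (2 * \<bar>S\<bar> + B)) * norm (W x)" for m
        by (intro AE_I2 \<rho>_times_le[OF d_meas d_le])
      show "(\<lambda>x. \<rho> x * ((p (S + t m) x - p S x) / t m)) \<in> borel_measurable lebesgue" for m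
        by (rule \<rho>_times_measurable[OF d_meas d_le])
    qed (auto intro!: \<rho>q_measurable W_integrable)
    moreover have "(LINT x|lebesgue. \<rho> x * ((p (S + t m) x - p S x) / t m)) = (H (S + t m) - H S) /\<^sub>R t m" for m
    proof -
      have "H (S + t m) - H S = (LINT x|lebesgue. \<rho> x * p (S + t m) x - \<rho> x * p S x)"
        unfolding H_def by (rule Bochner_Integration.integral_diff[symmetric]) (rule p_int)+
      then have "(H (S + t m) - H S) /\<^sub>R t m =
          (LINT x|lebesgue. inverse (t m) * (\<rho> x * p (S + t m) x - \<rho> x * p S x))"
        by simp
      moreover have "inverse (t m) * (\<rho> x * p (S + t m) x - \<rho> x * p S x) = \<rho> x * ((p (S + t m) x - p S x) / t m)" for x
        by (simp add: divide_inverse right_diff_distrib mult_ac)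
      ultimately show ?thesis by (simp only:)
    qed
    ultimately show "(\<lambda>m. (H (S + t m) - H S) /\<^sub>R t m) \<longlonglongrightarrow> 0"
      using zero[of S] by (simp add: profile_q)
  qed
  then have "H 1 = H 0" using DERIV_isconst_all by blast
  then have H1: "(LINT x|lebesgue. \<rho> x * p 1 x) = 0" by (simp add: H_def p0)
  have nonneg: "0 \<le> \<rho> x * p 1 x" for x
    using \<rho>_nonneg[of x] by (cases "x = 0") (auto simp: p_def)
  have ae: "AE x in lebesgue. \<rho> x * p 1 x = 0"
    using integral_nonneg_eq_0_iff_AE[OF p_int[of 1]] nonneg H1 by auto
  obtain e where e: "e > 0" "\<And>x. norm x < e \<Longrightarrow> x \<noteq> 0 \<Longrightarrow> \<rho> x > 0" using \<rho>_positive_near_0 by blast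
  \<comment> \<open>On \<open>U\<close> the coordinate y_1 lies strictly between 0 and 1, so cos (2
    pi y_1) cannot be 1; the radius \<open>min e 1\<close> also keeps \<rho> positive at y.\<close>
  define U where "U = ball (0::real^'n) (min e 1) \<inter> {x. 0 < x $ first_index}"
  define x0 where "x0 = (min e 1 / 2) *\<^sub>R axis (first_index::'n) (1::real)"
  have "open U" unfolding U_def by (intro open_Int open_ball open_halfspace_component_gt_cart)
  moreover have "x0 \<in> U" using e(1) by (auto simp: U_def x0_def norm_axis_1 min_def)
  ultimately obtain y where y: "y \<in> U" "\<rho> y * p 1 y = 0"
    using AE_lebesgue_open_ex[OF _ _ ae] by blast
  then have ny: "norm y < e" "norm y < 1" "0 < y $ first_index" "y \<noteq> 0" by (auto simp: U_def)
  then have "p 1 y = 0" using e(2)[of y] y(2) by auto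
  then have "cos (2 * pi * y $ first_index) = 1" using ny(4) by (simp add: p_def)
  then obtain n :: int where "2 * pi * y $ first_index = real_of_int n * 2 * pi"
    unfolding cos_one_2pi_int by blast
  then have "y $ first_index = real_of_int n" by simp
  moreover have "y $ first_index < 1"
    using component_le_norm_cart[of y first_index] ny(2) by linarith
  ultimately show False using ny(3) by simp
qed

definition symbol :: "real^'n \<Rightarrow> real"
  where "symbol \<xi> = (profile \<rho> (norm \<xi>))\<^sup>2"

text \<open>The modulus of the vector is 2 pi |\<xi>| times that of \<open>Q_hat\<close>, which
  cancels the prefactor of \<open>Q_hat\<close>. At the origin, where that prefactor divides by
  zero, both sides are 0.\<close>

lemma norm_lambda_rho_sq: "(norm (lambda_rho \<rho> \<xi>))\<^sup>2 = symbol \<xi>"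
proof -
  have "norm (lambda_rho \<rho> \<xi> $ j) = (2 * pi * \<bar>Q_hat \<rho> \<xi>\<bar>) * \<bar>\<xi> $ j\<bar>" for j
    by (simp add: lambda_rho_def norm_mult)
  then have "norm (lambda_rho \<rho> \<xi>) = L2_set (\<lambda>j. (2 * pi * \<bar>Q_hat \<rho> \<xi>\<bar>) * \<bar>\<xi> $ j\<bar>) UNIV"
    by (simp add: norm_vec_def)
  also have "\<dots> = (2 * pi * \<bar>Q_hat \<rho> \<xi>\<bar>) * norm \<xi>"
    by (simp add: L2_set_right_distrib norm_vec_def)
  finally have n: "norm (lambda_rho \<rho> \<xi>) = (2 * pi * \<bar>Q_hat \<rho> \<xi>\<bar>) * norm \<xi>" .
  show ?thesis
  proof (cases "\<xi> = 0")
    case True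
    then show ?thesis using n by (simp add: symbol_def profile_0)
  next
    case False
    have "Q_hat \<rho> \<xi> = 1 / (2 * pi * norm \<xi>) * profile \<rho> (norm \<xi>)"
      by (simp add: Q_hat_def profile_def mult.assoc)
    then have "norm (lambda_rho \<rho> \<xi>) = \<bar>profile \<rho> (norm \<xi>)\<bar>"
      using False by (simp add: n abs_mult)
    then show ?thesis by (simp add: symbol_def)
  qed
qed

lemma symbol_continuous: "continuous_on UNIV symbol"
  unfolding symbol_def
  by (intro continuous_intros continuous_on_compose2[OF profile_continuous[of UNIV]]) auto

lemma symbol_nonzero: obtains b where "symbol b \<noteq> 0"
proof -
  obtain s where s: "s \<ge> 0" "profile \<rho> s \<noteq> 0" using profile_nonzero by blast
  have "symbol (s *\<^sub>R axis first_index 1) \<noteq> 0"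
    using s by (simp add: symbol_def norm_axis_1)
  then show ?thesis using that by blast
qed

lemma symbol_kernel:
  assumes rep: "represented_on (K_rho \<rho>) (- {0}) k" and k: "\<And>h. h \<noteq> 0 \<Longrightarrow> k h \<ge> 0"
  shows "symbol_kernel symbol k"
proof
  show "continuous_on UNIV symbol" by (rule symbol_continuous)
  show "symbol (- \<xi>) = symbol \<xi>" for \<xi> by (simp add: symbol_def)
  show "symbol 0 = 0" by (simp add: symbol_def profile_0)
  show "k h \<ge> 0" if "h \<noteq> 0" for h by (rule k[OF that])
  show "loc_integrable_on k (- {0})" using rep by (simp add: represented_on_def)
  have W: "W_mass \<ge> 0" by (simp add: W_mass_def)
  show "\<exists>C\<ge>0. \<forall>\<xi>. \<bar>symbol \<xi>\<bar> \<le> C * (1 + norm \<xi>)\<^sup>2"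
  \<comment> \<open>The constant comes from 1 + 2 pi t <= 2 pi (1 + t) for t >= 0, inserted in the
    linear bound on the profile and squared.\<close>
  proof (intro exI[of _ "(2 * pi * W_mass)\<^sup>2"] conjI allI)
    fix \<xi> :: "real^'n"
    have "1 + 2 * pi * \<bar>norm \<xi>\<bar> \<le> 2 * pi * (1 + norm \<xi>)"
      using pi_gt3 by (simp add: distrib_left)
    then have "\<bar>profile \<rho> (norm \<xi>)\<bar> \<le> (2 * pi * (1 + norm \<xi>)) * W_mass"
      using profile_le[of "norm \<xi>"] W by (meson mult_right_mono order_trans)
    then have "\<bar>profile \<rho> (norm \<xi>)\<bar>\<^sup>2 \<le> ((2 * pi * (1 + norm \<xi>)) * W_mass)\<^sup>2"
      by (intro power_mono) auto
    then show "\<bar>symbol \<xi>\<bar> \<le> (2 * pi * W_mass)\<^sup>2 * (1 + norm \<xi>)\<^sup>2"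
      by (simp only: symbol_def power2_abs abs_power2 power_mult_distrib mult_ac)
  qed simp
  show "(\<lambda>m. symbol (real (Suc m) *\<^sub>R \<xi>) / (real (Suc m))\<^sup>2) \<longlonglongrightarrow> 0" for \<xi>
  proof -
    have "(\<lambda>m. (profile \<rho> (real (Suc m) * norm \<xi>) / real (Suc m))\<^sup>2) \<longlonglongrightarrow> 0\<^sup>2"
      by (intro tendsto_power profile_sublinear)
    then show ?thesis by (simp add: symbol_def power_divide)
  qed
  fix \<phi> :: "real^'n \<Rightarrow> complex" assume \<phi>: "test_function_on (- {0}) \<phi>"
  have m: "(\<lambda>\<xi>. - of_real (symbol \<xi>) * inv_fourier \<phi> \<xi>) \<in> borel_measurable lborel"
    using borel_measurable_continuous_onI[OF symbol_continuous]
      borel_measurable_integrable[OF inv_fourier_integrable[OF \<phi>]] by auto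
  have "(LINT h|lebesgue. of_real (k h) * \<phi> h) = K_rho \<rho> \<phi>"
    using rep \<phi> by (simp add: represented_on_def regular_dist_def)
  also have "\<dots> = (LINT \<xi>|lebesgue. - of_real (symbol \<xi>) * inv_fourier \<phi> \<xi>)"
    unfolding K_rho_def inv_fourier_dist_def regular_dist_def norm_lambda_rho_sq ..
  also have "\<dots> = (LINT \<xi>|lborel. - of_real (symbol \<xi>) * inv_fourier \<phi> \<xi>)"
    by (rule integral_completion[OF m])
  finally show "(LINT h|lebesgue. of_real (k h) * \<phi> h) = - (LINT \<xi>|lborel. of_real (symbol \<xi>) * inv_fourier \<phi> \<xi>)"
    by simp
qed

end

theorem corollary5p3:
  fixes \<rho> k u v :: "real^'n \<Rightarrow> real" and \<Omega> :: "(real^'n) set"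
  assumes "admissible_kernel \<rho>"
    and "represented_on (K_rho \<rho>) (- {0}) k"
    and "\<And>h. h \<noteq> 0 \<Longrightarrow> k h \<ge> 0"
    and "bounded \<Omega>" and "open \<Omega>"
    and "C11_loc u" and "L_infinity u"
    and "C11_loc v" and "L_infinity v"
    and "\<And>x. x \<in> \<Omega> \<Longrightarrow> pv_operator k u x \<ge> pv_operator k v x"
    and "\<And>x. x \<in> - \<Omega> \<Longrightarrow> u x \<ge> v x"
  shows "\<forall>x. u x \<ge> v x"
proof -
  interpret admissible \<rho> using assms(1) by unfold_locales
  interpret symbol_kernel symbol k by (rule symbol_kernel[OF assms(2,3)])
  obtain b where "symbol b \<noteq> 0" by (rule symbol_nonzero)
  then show ?thesis
    using comparison_principle[OF _ assms(4,6-11)] by blast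
qed

end
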